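(* Assume $p$ odd, $p\nmid n$, $\ell\ge2$. A regular representation $\delta$ of ${\rm SL}_n(\mathfrak o_\ell)$ admits a $\theta$-Whittaker model for every non-degenerate character $\theta$ of $\mathbf U(\mathfrak o_\ell)$ if and only if $\delta$ is special-regular.
   Context: $\mathfrak o$: ring of integers of a non-archimedean local field, uniformizer $\varpi$, residue field $\mathbb F_q$ of characteristic $p$; $\mathfrak o_r=\mathfrak o/\varpi^r\mathfrak o$. $\mathbf U(\mathfrak o_\ell)$: upper unitriangular matrices in ${\rm SL}_n(\mathfrak o_\ell)$. A primitive character of $(\mathfrak o_\ell,+)$ is one nontrivial on $\varpi^{\ell-1}\mathfrak o_\ell$; a non-degenerate character of $\mathbf U(\mathfrak o_\ell)$ is $\theta((u_{ij}))=\prod_{i=1}^{n-1}\varphi_i(u_{i,i+1})$ with all $\varphi_i$ primitive; $\delta$ admits a $\theta$-Whittaker model if $\mathrm{Hom}(\delta,\mathrm{Ind}_{\mathbf U(\mathfrak o_\ell)}^{{\rm SL}_n(\mathfrak o_\ell)}\theta)\ne0$. For $\mathbf G\in\{{\rm GL}_n,{\rm SL}_n\}$ with $\mathfrak g=M_n$ or $\mathfrak{sl}_n$: $K_\ell^{\ell-1}=\ker(\mathbf G(\mathfrak o_\ell)\to\mathbf G(\mathfrak o_{\ell-1}))$, and for a fixed primitive $\varphi$ each $x\in\mathfrak g(\mathbb F_q)$ gives a character $\varphi_x(I+\varpi^{\ell-1}y)=\varphi(\varpi^{\ell-1}\mathrm{tr}(\hat xy))$; $x$ is regular if its characteristic polynomial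 equals its minimal polynomial; an irreducible representation is regular if its restriction to $K_\ell^{\ell-1}$ contains $\varphi_x$ with $x$ regular. A regular representation $\delta$ of ${\rm SL}_n(\mathfrak o_\ell)$ is special-regular if $\delta\cong\mathrm{Res}^{{\rm GL}_n(\mathfrak o_\ell)}_{{\rm SL}_n(\mathfrak o_\ell)}\rho$ for some regular representation $\rho$ of ${\rm GL}_n(\mathfrak o_\ell)$. *)

theory Defs
  imports Complex_Main "Jordan_Normal_Form.Char_Poly"
begin

definition mat_trace :: "'a::comm_ring_1 mat \<Rightarrow> 'a" where
  "mat_trace A = (\<Sum>i<dim_row A. A $$ (i, i))"

definition poly_eval_mat :: "'a::comm_ring_1 poly \<Rightarrow> 'a mat \<Rightarrow> 'a mat" where
  "poly_eval_mat f A = foldr (\<lambda>i M. coeff f i \<cdot>\<^sub>m (A ^\<^sub>m i) + M) [0..<Suc (degree f)]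
      (0\<^sub>m (dim_row A) (dim_row A))"

definition min_poly :: "'a::field mat \<Rightarrow> 'a poly" where
  "min_poly A = (THE m. monic m \<and> poly_eval_mat m A = 0\<^sub>m (dim_row A) (dim_row A) \<and>
      (\<forall>q. q \<noteq> 0 \<and> poly_eval_mat q A = 0\<^sub>m (dim_row A) (dim_row A) \<longrightarrow> degree m \<le> degree q))"

definition regular_mat :: "'a::field mat \<Rightarrow> bool" where
  "regular_mat x \<longleftrightarrow> char_poly x = min_poly x"

text \<open>o_l = o / varpi^l o, abstractly: a finite commutative local ring whose maximal ideal
  (= the set of non-units) is generated by varpi, with varpi^l = 0 and varpi^(l-1) \<noteq> 0.\<close>
definition trunc_dvr :: "'r::{comm_ring_1,finite} \<Rightarrow> nat \<Rightarrow> bool" where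
  "trunc_dvr \<pi> l \<longleftrightarrow> (\<forall>a::'r. \<not> a dvd 1 \<longleftrightarrow> \<pi> dvd a) \<and> \<pi> ^ l = 0 \<and> \<pi> ^ (l - 1) \<noteq> 0"

definition residue_map :: "('r::comm_ring_1 \<Rightarrow> 'k::field) \<Rightarrow> 'r \<Rightarrow> bool" where
  "residue_map red \<pi> \<longleftrightarrow> (\<forall>a b. red (a + b) = red a + red b) \<and> (\<forall>a b. red (a * b) = red a * red b)
     \<and> red 1 = 1 \<and> surj red \<and> (\<forall>a. red a = 0 \<longleftrightarrow> \<pi> dvd a)"

definition add_char :: "('r::comm_ring_1 \<Rightarrow> complex) \<Rightarrow> bool" where
  "add_char \<phi> \<longleftrightarrow> \<phi> 0 = 1 \<and> (\<forall>a b. \<phi> (a + b) = \<phi> a * \<phi> b)"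

definition primitive_char :: "'r::comm_ring_1 \<Rightarrow> nat \<Rightarrow> ('r \<Rightarrow> complex) \<Rightarrow> bool" where
  "primitive_char \<pi> l \<phi> \<longleftrightarrow> add_char \<phi> \<and> (\<exists>a. \<phi> (\<pi> ^ (l - 1) * a) \<noteq> 1)"

definition SL_mat :: "nat \<Rightarrow> 'r::comm_ring_1 mat set" where
  "SL_mat n = {A \<in> carrier_mat n n. det A = 1}"

definition GL_mat :: "nat \<Rightarrow> 'r::comm_ring_1 mat set" where
  "GL_mat n = {A \<in> carrier_mat n n. det A dvd 1}"

definition U_mat :: "nat \<Rightarrow> 'r::comm_ring_1 mat set" where
  "U_mat n = {A \<in> carrier_mat n n. \<forall>i<n. \<forall>j<n. (j < i \<longrightarrow> A $$ (i, j) = 0) \<and> A $$ (i, i) = 1}"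

definition nondeg_char :: "'r::comm_ring_1 \<Rightarrow> nat \<Rightarrow> nat \<Rightarrow> ('r mat \<Rightarrow> complex) \<Rightarrow> bool" where
  "nondeg_char \<pi> l n \<theta> \<longleftrightarrow> (\<exists>\<phi>s :: nat \<Rightarrow> 'r \<Rightarrow> complex.
      (\<forall>i < n - 1. primitive_char \<pi> l (\<phi>s i)) \<and>
      (\<forall>u \<in> U_mat n. \<theta> u = (\<Prod>i < n - 1. \<phi>s i (u $$ (i, i + 1)))))"

definition is_rep :: "'r::comm_ring_1 mat set \<Rightarrow> nat \<Rightarrow> nat \<Rightarrow> ('r mat \<Rightarrow> complex mat) \<Rightarrow> bool" where
  "is_rep G n d \<delta> \<longleftrightarrow> (\<forall>g \<in> G. \<delta> g \<in> carrier_mat d d) \<and>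
     (\<forall>g \<in> G. \<forall>h \<in> G. \<delta> (g * h) = \<delta> g * \<delta> h) \<and> \<delta> (1\<^sub>m n) = 1\<^sub>m d"

definition invariant_subspace :: "'r mat set \<Rightarrow> nat \<Rightarrow> ('r mat \<Rightarrow> complex mat) \<Rightarrow> complex vec set \<Rightarrow> bool" where
  "invariant_subspace G d \<delta> W \<longleftrightarrow> W \<subseteq> carrier_vec d \<and> 0\<^sub>v d \<in> W \<and>
     (\<forall>v \<in> W. \<forall>w \<in> W. v + w \<in> W) \<and> (\<forall>c. \<forall>v \<in> W. c \<cdot>\<^sub>v v \<in> W) \<and>
     (\<forall>g \<in> G. \<forall>v \<in> W. \<delta> g *\<^sub>v v \<in> W)"

definition irreducible_rep :: "'r::comm_ring_1 mat set \<Rightarrow> nat \<Rightarrow> nat \<Rightarrow> ('r mat \<Rightarrow> complex mat) \<Rightarrow> bool" where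
  "irreducible_rep G n d \<delta> \<longleftrightarrow> is_rep G n d \<delta> \<and> d > 0 \<and>
     (\<forall>W. invariant_subspace G d \<delta> W \<longrightarrow> W = {0\<^sub>v d} \<or> W = carrier_vec d)"

definition iso_rep :: "'r mat set \<Rightarrow> nat \<Rightarrow> ('r mat \<Rightarrow> complex mat) \<Rightarrow> nat \<Rightarrow> ('r mat \<Rightarrow> complex mat) \<Rightarrow> bool" where
  "iso_rep G d1 \<delta>1 d2 \<delta>2 \<longleftrightarrow> d1 = d2 \<and> (\<exists>P \<in> carrier_mat d1 d1. invertible_mat P \<and>
     (\<forall>g \<in> G. P * \<delta>1 g = \<delta>2 g * P))"

text \<open>Hom(delta, Ind_U^G theta) \<noteq> 0, with Ind_U^G theta = {f : G \<rightarrow> C. f(u g) = theta(u) f(g)}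
  and G acting by right translation.\<close>
definition has_whittaker :: "'r::comm_ring_1 mat set \<Rightarrow> 'r mat set \<Rightarrow> nat \<Rightarrow> ('r mat \<Rightarrow> complex mat)
    \<Rightarrow> ('r mat \<Rightarrow> complex) \<Rightarrow> bool" where
  "has_whittaker G U d \<delta> \<theta> \<longleftrightarrow> (\<exists>T :: complex vec \<Rightarrow> 'r mat \<Rightarrow> complex.
     (\<forall>v \<in> carrier_vec d. \<forall>w \<in> carrier_vec d. \<forall>g \<in> G. T (v + w) g = T v g + T w g) \<and>
     (\<forall>c. \<forall>v \<in> carrier_vec d. \<forall>g \<in> G. T (c \<cdot>\<^sub>v v) g = c * T v g) \<and>
     (\<forall>v \<in> carrier_vec d. \<forall>u \<in> U. \<forall>g \<in> G. T v (u * g) = \<theta> u * T v g) \<and>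
     (\<forall>v \<in> carrier_vec d. \<forall>h \<in> G. \<forall>g \<in> G. T (\<delta> h *\<^sub>v v) g = T v (g * h)) \<and>
     (\<exists>v \<in> carrier_vec d. \<exists>g \<in> G. T v g \<noteq> 0))"

text \<open>The character phi_x of K_l^(l-1), evaluated at I + varpi^(l-1) y; x-hat is a lift of x.\<close>
definition phi_x :: "('r::comm_ring_1 \<Rightarrow> 'k::field) \<Rightarrow> 'r \<Rightarrow> nat \<Rightarrow> ('r \<Rightarrow> complex) \<Rightarrow> 'k mat \<Rightarrow> 'r mat \<Rightarrow> complex" where
  "phi_x red \<pi> l \<phi> x y = \<phi> (\<pi> ^ (l - 1) * mat_trace (map_mat (inv_into UNIV red) x * y))"

text \<open>Res to K_l^(l-1) = ker(G(o_l) \<rightarrow> G(o_(l-1))) = {I + varpi^(l-1) y \<in> G} contains phi_x.\<close>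
definition contains_phi_x :: "'r::comm_ring_1 mat set \<Rightarrow> nat \<Rightarrow> nat \<Rightarrow> ('r mat \<Rightarrow> complex mat) \<Rightarrow>
    ('r \<Rightarrow> 'k::field) \<Rightarrow> 'r \<Rightarrow> nat \<Rightarrow> ('r \<Rightarrow> complex) \<Rightarrow> 'k mat \<Rightarrow> bool" where
  "contains_phi_x G n d \<delta> red \<pi> l \<phi> x \<longleftrightarrow> (\<exists>v \<in> carrier_vec d. v \<noteq> 0\<^sub>v d \<and>
     (\<forall>y \<in> carrier_mat n n. 1\<^sub>m n + (\<pi> ^ (l - 1)) \<cdot>\<^sub>m y \<in> G \<longrightarrow>
        \<delta> (1\<^sub>m n + (\<pi> ^ (l - 1)) \<cdot>\<^sub>m y) *\<^sub>v v = phi_x red \<pi> l \<phi> x y \<cdot>\<^sub>v v))"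

definition regular_rep_GL :: "nat \<Rightarrow> nat \<Rightarrow> ('r::comm_ring_1 mat \<Rightarrow> complex mat) \<Rightarrow>
    ('r \<Rightarrow> 'k::field) \<Rightarrow> 'r \<Rightarrow> nat \<Rightarrow> ('r \<Rightarrow> complex) \<Rightarrow> bool" where
  "regular_rep_GL n d \<rho> red \<pi> l \<phi> \<longleftrightarrow> irreducible_rep (GL_mat n) n d \<rho> \<and>
     (\<exists>x \<in> carrier_mat n n. regular_mat x \<and> contains_phi_x (GL_mat n) n d \<rho> red \<pi> l \<phi> x)"

definition regular_rep_SL :: "nat \<Rightarrow> nat \<Rightarrow> ('r::comm_ring_1 mat \<Rightarrow> complex mat) \<Rightarrow>
    ('r \<Rightarrow> 'k::field) \<Rightarrow> 'r \<Rightarrow> nat \<Rightarrow> ('r \<Rightarrow> complex) \<Rightarrow> bool" where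
  "regular_rep_SL n d \<delta> red \<pi> l \<phi> \<longleftrightarrow> irreducible_rep (SL_mat n) n d \<delta> \<and>
     (\<exists>x \<in> carrier_mat n n. mat_trace x = 0 \<and> regular_mat x \<and>
        contains_phi_x (SL_mat n) n d \<delta> red \<pi> l \<phi> x)"

definition special_regular :: "nat \<Rightarrow> nat \<Rightarrow> ('r::comm_ring_1 mat \<Rightarrow> complex mat) \<Rightarrow>
    ('r \<Rightarrow> 'k::field) \<Rightarrow> 'r \<Rightarrow> nat \<Rightarrow> ('r \<Rightarrow> complex) \<Rightarrow> bool" where
  "special_regular n d \<delta> red \<pi> l \<phi> \<longleftrightarrow> regular_rep_SL n d \<delta> red \<pi> l \<phi> \<and>
     (\<exists>d' (\<rho> :: 'r mat \<Rightarrow> complex mat). regular_rep_GL n d' \<rho> red \<pi> l \<phi> \<and>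
        iso_rep (SL_mat n) d \<delta> d' \<rho>)"

end

theory Submission
  imports Defs "HOL-Computational_Algebra.Fundamental_Theorem_Algebra"
    "HOL-Computational_Algebra.Polynomial_Factorial" "HOL-Library.Function_Algebras"
begin

text \<open>
  The key is that a Whittaker functional on an irreducible representation \<open>V\<close> of \<open>GL\<^sub>n\<close> is unique up
  to scalars. Write \<open>l = m + M\<close> with \<open>m = \<lfloor>l/2\<rfloor>\<close>. A Whittaker functional sees only those
  characters of the abelian congruence subgroup of level \<open>M\<close> which come from Hessenberg matrices
  modulo \<open>\<pi>\<^sup>m\<close>, and these are conjugate under upper unitriangular matrices to companion matrices \<open>C\<close>.
  As 2 is a unit there is a truncated exponential \<open>E(y) = 1 + \<pi>\<^sup>m y + \<pi>\<^sup>2\<^sup>m y\<^sup>2 / 2\<close>, and the character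
  attached to \<open>C\<close> extends to the group \<open>E(L)\<close>, where \<open>L\<close> is spanned by the strictly upper triangular
  matrices, the centralizer of \<open>C\<close> and the multiples of \<open>\<pi>\<^sup>M\<^sup>-\<^sup>m\<close>. The corresponding projection \<open>F\<close>
  satisfies \<open>F g F = 0\<close> unless \<open>g \<in> E(L) z E(L)\<close> with \<open>z\<close> a unit centralizing \<open>C\<close>. An
  anti-automorphism fixing \<open>C\<close> therefore fixes all \<open>F g F\<close>; by Gelfand's trick these operators
  commute and \<open>F V\<close> is at most a line.

  If \<open>\<delta>\<close> is the restriction of \<open>\<rho>\<close>, then some companion matrix occurs in \<open>\<rho>\<close>, because a regular
  matrix is conjugate to a companion matrix. Averaging over the conjugates of \<open>U\<close> by the \<open>E(y)\<close> yields
  a Whittaker functional for the standard character, and diagonal matrices in \<open>GL\<^sub>n\<close> carry it to every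
  other non-degenerate character.

  Conversely, take a minimal subrepresentation \<open>V\<close> of the representation of \<open>GL\<^sub>n\<close> induced from \<open>\<delta>\<close>.
  If evaluation at 1 were not injective on \<open>V\<close>, some evaluation at a diagonal \<open>t\<close> would be nonzero on
  its kernel. Composing the evaluations at 1 and at \<open>t\<close> with Whittaker functionals of \<open>\<delta>\<close> for two
  conjugate characters would then give two independent Whittaker functionals for one character of \<open>V\<close>.
  So evaluation at 1 is an isomorphism and \<open>V\<close> extends \<open>\<delta>\<close>.\<close>

section \<open>The ring of linear endomorphisms of sequences\<close>

text \<open>The parity of l shapes the argument. For even l the elements E(y) commute, so a
  companion matrix C directly gives a character of all of them. For odd l they form a group of
  Heisenberg type: commutators are governed by the form tr(C[w,y]), whose radical modulo \<pi> is
  the centralizer of C. Strictly upper triangular matrices are isotropic because tr(Ca) is the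
  superdiagonal sum of a, and together with the centralizer they span a maximal isotropic space; L
  is its preimage. The same trace identity makes the chosen character agree on U with the standard
  Whittaker character, so one operator F serves both the functionals and the Gelfand argument.
  Congruences are written as annihilation: \<open>scl (\<pi> ^ k) a = 0\<close> means that a
  vanishes modulo \<open>\<pi> ^ (l - k)\<close>. In the converse, a character of the bottom
  congruence subgroup of SL sees its matrix only up to scalars. The matrix found over GL may
  therefore differ from the given one by a scalar, and regularity has to be shown invariant under
  such shifts.\<close>

text \<open>Matrices of the carrier type of \<^typ>\<open>'a mat\<close> do not form a type-class ring. Embedding the
  \<open>n \<times> n\<close> matrices as a corner of the ring of linear endomorphisms of \<open>nat \<Rightarrow> 'r\<close> gives ring
  arithmetic without dimension side conditions; a group element \<open>g\<close> is embedded as \<open>g \<oplus> 1\<close>.\<close>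

typedef (overloaded) ('r::comm_ring_1) lmap =
  "{f :: (nat \<Rightarrow> 'r) \<Rightarrow> nat \<Rightarrow> 'r. (\<forall>u v. f (\<lambda>i. u i + v i) = (\<lambda>i. f u i + f v i)) \<and>
      (\<forall>c v. f (\<lambda>i. c * v i) = (\<lambda>i. c * f v i))}"
  morphisms ap Abs_lmap
  by (rule exI[of _ "\<lambda>v. v"]) auto

setup_lifting type_definition_lmap

instantiation lmap :: (comm_ring_1) ring_1
begin

lift_definition zero_lmap :: "'a lmap" is "\<lambda>v i. 0" by auto
lift_definition one_lmap :: "'a lmap" is "\<lambda>v. v" by auto
lift_definition plus_lmap :: "'a lmap \<Rightarrow> 'a lmap \<Rightarrow> 'a lmap" is "\<lambda>f g v i. f v i + g v i"
  by (auto simp: algebra_simps)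
lift_definition uminus_lmap :: "'a lmap \<Rightarrow> 'a lmap" is "\<lambda>f v i. - f v i"
  by (auto simp: algebra_simps)
lift_definition minus_lmap :: "'a lmap \<Rightarrow> 'a lmap \<Rightarrow> 'a lmap" is "\<lambda>f g v i. f v i - g v i"
  by (auto simp: algebra_simps)
lift_definition times_lmap :: "'a lmap \<Rightarrow> 'a lmap \<Rightarrow> 'a lmap" is "\<lambda>f g v. f (g v)"
  by auto

instance
proof
  show "(0::'a lmap) \<noteq> 1"
    by transfer (metis zero_neq_one)
qed (transfer; auto simp: algebra_simps fun_eq_iff)+

end

lift_definition scl :: "'r::comm_ring_1 \<Rightarrow> 'r lmap \<Rightarrow> 'r lmap" is "\<lambda>c f v i. c * f v i"
  by (auto simp: algebra_simps)

lemma scl_simps [simp]: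
  fixes a b :: "'r::comm_ring_1 lmap"
  shows "scl c a * b = scl c (a * b)" "a * scl c b = scl c (a * b)"
    "scl c (scl d a) = scl (c * d) a" "scl 1 a = a" "scl 0 a = 0" "scl c 0 = 0"
    "scl c (- a) = - scl c a" "scl (- c) a = - scl c a"
  by (transfer; auto simp: algebra_simps fun_eq_iff)+

lemma scl_distribs:
  fixes a b :: "'r::comm_ring_1 lmap"
  shows "scl c (a + b) = scl c a + scl c b" "scl (c + d) a = scl c a + scl d a"
    "scl c (a - b) = scl c a - scl c b" "scl (c - d) a = scl c a - scl d a"
  by (transfer; auto simp: algebra_simps fun_eq_iff)+

lemma ap_add: "ap a (\<lambda>i. u i + v i) = (\<lambda>i. ap a u i + ap a v i)"
  and ap_scale: "ap a (\<lambda>i. c * v i) = (\<lambda>i. c * ap a v i)"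
  using ap[of a] by auto

lemma ap_simps [simp]:
  "ap 0 v i = 0" "ap 1 v = v" "ap (a + b) v i = ap a v i + ap b v i"
  "ap (a - b) v i = ap a v i - ap b v i" "ap (- a) v i = - ap a v i"
  "ap (scl c a) v i = c * ap a v i"
  by (transfer; auto)+

lemma ap_mult: "ap (a * b) v = ap a (ap b v)"
  by transfer auto

lemma ap_zero: "ap a (\<lambda>i. 0) = (\<lambda>i. 0)"
  using ap_scale[of a 0 "\<lambda>i. 0"] by simp

lemma ap_sum: "ap a (\<lambda>i. \<Sum>k\<in>K. v k i) = (\<lambda>i. \<Sum>k\<in>K. ap a (v k) i)"
proof (induction K rule: infinite_finite_induct)
  case (insert x F)
  then show ?case using ap_add[of a "v x" "\<lambda>i. \<Sum>k\<in>F. v k i"] by simp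
qed (auto simp: ap_zero)

lemma sum_ap: "ap (\<Sum>k\<in>K. a k) v i = (\<Sum>k\<in>K. ap (a k) v i)"
  by (induction K rule: infinite_finite_induct) auto

lemma scl_sum: "scl c (\<Sum>k\<in>K. a k) = (\<Sum>k\<in>K. scl c (a k))"
  by (induction K rule: infinite_finite_induct) (auto simp: scl_distribs)

section \<open>Matrix entries and the corner ring of n by n matrices\<close>

definition unitv :: "nat \<Rightarrow> nat \<Rightarrow> 'r::comm_ring_1" where
  "unitv j = (\<lambda>i. if i = j then 1 else 0)"

definition ent :: "'r::comm_ring_1 lmap \<Rightarrow> nat \<Rightarrow> nat \<Rightarrow> 'r" where
  "ent a i j = ap a (unitv j) i"

lemma ent_simps [simp]:
  "ent 0 i j = 0" "ent (a + b) i j = ent a i j + ent b i j"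
  "ent (a - b) i j = ent a i j - ent b i j" "ent (- a) i j = - ent a i j"
  "ent (scl c a) i j = c * ent a i j" "ent (\<Sum>k\<in>K. f k) i j = (\<Sum>k\<in>K. ent (f k) i j)"
  by (auto simp: ent_def sum_ap)

lemma ent_one: "ent 1 i j = (if i = j then 1 else 0)"
  by (simp add: ent_def unitv_def)

lift_definition mk :: "nat \<Rightarrow> (nat \<Rightarrow> nat \<Rightarrow> 'r) \<Rightarrow> 'r::comm_ring_1 lmap" is
  "\<lambda>n f v i. if i < n then \<Sum>j<n. f i j * v j else 0"
  by (auto simp: fun_eq_iff algebra_simps sum.distrib sum_distrib_left)

lemma ap_mk: "ap (mk n f) v i = (if i < n then \<Sum>j<n. f i j * v j else 0)"
  by transfer auto

lemma ent_mk: "ent (mk n f) i j = (if i < n \<and> j < n then f i j else 0)"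
  by (auto simp: ent_def ap_mk unitv_def if_distrib cong: if_cong)

definition Mn :: "nat \<Rightarrow> 'r::comm_ring_1 lmap set" where
  "Mn n = range (mk n)"

text \<open>The idempotent that is the unit of the corner ring \<open>Mn n\<close>; it differs from
  the ring unit \<open>1\<close>, which is the identity on all coordinates.\<close>

definition JJ :: "nat \<Rightarrow> 'r::comm_ring_1 lmap" where
  "JJ n = mk n (\<lambda>i j. if i = j then 1 else 0)"

lemma mk_in_Mn [simp]: "mk n f \<in> Mn n"
  by (simp add: Mn_def)

lemma mk_ent:
  assumes "a \<in> Mn n" shows "mk n (ent a) = a"
proof -
  obtain f where a: "a = mk n f" using assms by (auto simp: Mn_def)
  have "ap (mk n (ent a)) v i = ap a v i" for v i
    unfolding a by (auto simp: ap_mk ent_mk intro!: sum.cong)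
  then show ?thesis by (metis ap_inject ext)
qed

lemma Mn_eqI:
  assumes "a \<in> Mn n" "b \<in> Mn n" "\<And>i j. i < n \<Longrightarrow> j < n \<Longrightarrow> ent a i j = ent b i j"
  shows "a = b"
proof -
  have "ap (mk n (ent a)) v i = ap (mk n (ent b)) v i" for v i
    using assms(3) by (auto simp: ap_mk intro!: sum.cong)
  then have "mk n (ent a) = mk n (ent b)" by (metis ap_inject ext)
  then show ?thesis using assms mk_ent by metis
qed

lemma ent_out: "a \<in> Mn n \<Longrightarrow> \<not> (i < n \<and> j < n) \<Longrightarrow> ent a i j = 0"
  using ent_mk mk_ent by metis

lemma ap_JJ: "ap (JJ n) v i = (if i < n then v i else 0)"
  by (auto simp: JJ_def ap_mk if_distrib if_distribR cong: if_cong)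

lemma ap_expand: "ap a (ap (JJ n) v) = (\<lambda>i. \<Sum>j<n. v j * ent a i j)"
proof -
  have "ap (JJ n) v = (\<lambda>i. \<Sum>j<n. v j * unitv j i)"
    by (auto simp: ap_JJ fun_eq_iff unitv_def if_distrib cong: if_cong)
  then show ?thesis using ap_sum[of a "\<lambda>j i. v j * unitv j i" "{..<n}"]
    by (simp add: ap_scale ent_def)
qed

text \<open>Absorption by \<open>JJ n\<close> on both sides turns membership into equations, so that
  closure properties become ring algebra.\<close>

lemma Mn_iff: "a \<in> Mn n \<longleftrightarrow> JJ n * a = a \<and> a * JJ n = a"
proof
  assume "a \<in> Mn n"
  then have a: "a = mk n (ent a)" using mk_ent by metis
  have "ap (JJ n * a) v i = ap a v i" for v i
    apply (subst (1 2) a) by (auto simp: ap_mult ap_JJ ap_mk)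
  moreover have "ap (a * JJ n) v i = ap a v i" for v i
    by (subst (1 2) a) (auto simp: ap_mult ap_JJ ap_mk)
  ultimately show "JJ n * a = a \<and> a * JJ n = a" by (metis ap_inject ext)
next
  assume *: "JJ n * a = a \<and> a * JJ n = a"
  have "ap a v i = ap (mk n (ent a)) v i" for v i
  proof -
    have "ap a v i = ap (JJ n * (a * JJ n)) v i" using * by simp
    also have "\<dots> = ap (mk n (ent a)) v i"
      by (simp add: ap_mult ap_JJ ap_expand ap_mk mult.commute)
    finally show ?thesis .
  qed
  then have "a = mk n (ent a)" by (metis ap_inject ext)
  then show "a \<in> Mn n" by (metis mk_in_Mn)
qed

lemma JJ_idem [simp]: "JJ n * JJ n = JJ n" and JJ_Mn [simp]: "JJ n \<in> Mn n"
  using Mn_iff[of "JJ n :: 'a lmap" n] by (auto simp: JJ_def)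

lemma Mn_JJ: "a \<in> Mn n \<Longrightarrow> JJ n * a = a" "a \<in> Mn n \<Longrightarrow> a * JJ n = a"
  using Mn_iff by auto

lemma Mn_closed [simp, intro]:
  "0 \<in> Mn n"
  "a \<in> Mn n \<Longrightarrow> b \<in> Mn n \<Longrightarrow> a + b \<in> Mn n"
  "a \<in> Mn n \<Longrightarrow> b \<in> Mn n \<Longrightarrow> a - b \<in> Mn n"
  "a \<in> Mn n \<Longrightarrow> - a \<in> Mn n"
  "a \<in> Mn n \<Longrightarrow> b \<in> Mn n \<Longrightarrow> a * b \<in> Mn n"
  "a \<in> Mn n \<Longrightarrow> scl c a \<in> Mn n"
  unfolding Mn_iff
       apply (simp_all add: algebra_simps)
  by (metis mult.assoc)

lemma Mn_sum [intro]: "(\<And>k. k \<in> K \<Longrightarrow> f k \<in> Mn n) \<Longrightarrow> (\<Sum>k\<in>K. f k) \<in> Mn n"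
  by (induction K rule: infinite_finite_induct) auto

lemma ent_mult:
  assumes "b \<in> Mn n"
  shows "ent (a * b) i j = (\<Sum>k<n. ent a i k * ent b k j)"
proof -
  have "ap b v = ap (JJ n) (ap b v)" for v
    using Mn_JJ(1)[OF assms] by (metis ap_mult)
  then show ?thesis by (simp add: ent_def[of "a*b"] ap_mult ap_expand[of a n "ap b (unitv j)"] ent_def mult.commute)
      (metis (no_types, lifting) ap_expand ent_def mult.commute sum.cong)
qed

lemma finite_Mn_UNIV:
  assumes "finite (UNIV :: 'r::comm_ring_1 set)" shows "finite (Mn n :: 'r lmap set)"
proof -
  have "Mn n \<subseteq> (\<lambda>f. mk n (\<lambda>i j. f (i, j))) ` (PiE ({..<n} \<times> {..<n}) (\<lambda>_. UNIV :: 'r set))"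
  proof
    fix a :: "'r lmap" assume a: "a \<in> Mn n"
    define f where "f = restrict (\<lambda>(i, j). ent a i j) ({..<n} \<times> {..<n})"
    have "mk n (\<lambda>i j. f (i, j)) = a"
      by (rule Mn_eqI[of _ n]) (use a in \<open>auto simp: ent_mk f_def\<close>)
    then show "a \<in> (\<lambda>f. mk n (\<lambda>i j. f (i, j))) ` (PiE ({..<n} \<times> {..<n}) (\<lambda>_. UNIV :: 'r set))"
      by (intro image_eqI[of _ _ f]) (auto simp: f_def)
  qed
  then show ?thesis by (rule finite_subset) (auto intro!: finite_imageI finite_PiE assms)
qed

lemma finite_Mn [simp, intro]: "finite (Mn n :: 'r::{comm_ring_1,finite} lmap set)"
  by (rule finite_Mn_UNIV) simp

section \<open>Trace and elementary matrices\<close>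

definition mtr :: "nat \<Rightarrow> 'r::comm_ring_1 lmap \<Rightarrow> 'r" where
  "mtr n a = (\<Sum>i<n. ent a i i)"

lemma mtr_simps [simp]:
  "mtr n 0 = 0" "mtr n (a + b) = mtr n a + mtr n b" "mtr n (a - b) = mtr n a - mtr n b"
  "mtr n (- a) = - mtr n a" "mtr n (scl c a) = c * mtr n a"
  by (auto simp: mtr_def sum.distrib sum_subtractf sum_negf sum_distrib_left)

lemma mtr_commute: "a \<in> Mn n \<Longrightarrow> b \<in> Mn n \<Longrightarrow> mtr n (a * b) = mtr n (b * a)"
  unfolding mtr_def by (simp add: ent_mult) (subst sum.swap, simp add: mult.commute)

definition eij :: "nat \<Rightarrow> nat \<Rightarrow> nat \<Rightarrow> 'r::comm_ring_1 \<Rightarrow> 'r lmap" where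
  "eij n i j c = mk n (\<lambda>i' j'. if i' = i \<and> j' = j then c else 0)"

lemma eij_Mn [simp]: "eij n i j c \<in> Mn n" by (simp add: eij_def)

lemma ent_eij: "ent (eij n i j c) i' j' = (if i' < n \<and> j' < n \<and> i' = i \<and> j' = j then c else 0)"
  by (auto simp: eij_def ent_mk)

lemma mtr_eij:
  assumes "i < n" "j < n"
  shows "mtr n (x * eij n j i c) = c * ent x i j"
proof -
  have "(\<Sum>k<n. ent x i' k * ent (eij n j i c) k i') = (if i' = i then c * ent x i j else 0)"
    if "i' < n" for i'
    using assms that by (auto simp: ent_eij if_distrib cong: if_cong)
  then have "ent (x * eij n j i c) i' i' = (if i' = i then c * ent x i j else 0)" if "i' < n" for i'
    using that by (simp add: ent_mult[OF eij_Mn])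
  then show ?thesis using assms by (simp add: mtr_def)
qed

section \<open>The general linear group inside the endomorphism ring\<close>

definition Gn :: "nat \<Rightarrow> 'r::comm_ring_1 lmap set" where
  "Gn n = {g. g - 1 \<in> Mn n \<and> (\<exists>g'. g' - 1 \<in> Mn n \<and> g * g' = 1 \<and> g' * g = 1)}"

definition ginv :: "'r::comm_ring_1 lmap \<Rightarrow> 'r lmap" where
  "ginv g = (THE g'. g * g' = 1 \<and> g' * g = 1)"

lemma ginv_eq: "g * g' = 1 \<Longrightarrow> g' * g = 1 \<Longrightarrow> ginv g = g'"
  unfolding ginv_def by (rule the_equality) (auto, metis mult.assoc mult_1_left mult_1_right)

lemma Gn_inv [simp]:
  assumes "g \<in> Gn n" shows "g * ginv g = 1" "ginv g * g = 1"
    "g * (ginv g * a) = a" "ginv g * (g * a) = a"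
proof -
  show *: "g * ginv g = 1" "ginv g * g = 1" using assms ginv_eq by (auto simp: Gn_def)
  show "g * (ginv g * a) = a" "ginv g * (g * a) = a" using * by (simp_all flip: mult.assoc)
qed

lemma ginv_Gn [simp, intro]: "g \<in> Gn n \<Longrightarrow> ginv g \<in> Gn n"
  using ginv_eq by (auto simp: Gn_def)

lemma ginv_ginv [simp]: "g \<in> Gn n \<Longrightarrow> ginv (ginv g) = g"
  by (rule ginv_eq) auto

lemma Gn_minus_one: "g \<in> Gn n \<Longrightarrow> g - 1 \<in> Mn n" by (auto simp: Gn_def)

lemma Gn_one [simp]: "1 \<in> Gn n" by (auto simp: Gn_def)

lemma one_plus_mult: "a - 1 \<in> Mn n \<Longrightarrow> b - 1 \<in> Mn n \<Longrightarrow> a * b - (1::'r::comm_ring_1 lmap) \<in> Mn n"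
proof -
  assume "a - 1 \<in> Mn n" "b - 1 \<in> Mn n"
  then have "(a - 1) * (b - 1) + (a - 1) + (b - 1) \<in> Mn n" by blast
  then show ?thesis by (simp add: algebra_simps)
qed

lemma Gn_mult [simp, intro]: "g \<in> Gn n \<Longrightarrow> h \<in> Gn n \<Longrightarrow> g * h \<in> Gn n"
proof -
  assume g: "g \<in> Gn n" and h: "h \<in> Gn n"
  have "(g * h) * (ginv h * ginv g) = 1" "(ginv h * ginv g) * (g * h) = 1"
    using g h by (auto simp: mult.assoc)
  moreover have "g * h - 1 \<in> Mn n" "ginv h * ginv g - 1 \<in> Mn n"
    using one_plus_mult[OF Gn_minus_one[OF g] Gn_minus_one[OF h]]
      one_plus_mult[OF Gn_minus_one[OF ginv_Gn[OF h]] Gn_minus_one[OF ginv_Gn[OF g]]] by auto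
  ultimately show ?thesis unfolding Gn_def by blast
qed

lemma Mn_one_mult:
  assumes "g - 1 \<in> Mn n" "a \<in> Mn n" shows "g * a \<in> Mn n" "a * g \<in> Mn n"
proof -
  have "(g - 1) * a + a \<in> Mn n" "a * (g - 1) + a \<in> Mn n" using assms by blast+
  then show "g * a \<in> Mn n" "a * g \<in> Mn n" by (simp_all add: algebra_simps)
qed

lemma Gn_Mn [simp, intro]:
  assumes "g \<in> Gn n" "a \<in> Mn n" shows "g * a \<in> Mn n" "a * g \<in> Mn n"
  using Mn_one_mult[OF Gn_minus_one[OF assms(1)] assms(2)] by auto

lemma finite_Gn [simp, intro]: "finite (Gn n :: 'r::{comm_ring_1,finite} lmap set)"
proof -
  have "Gn n \<subseteq> (\<lambda>a. 1 + a) ` (Mn n :: 'r lmap set)"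
    using Gn_minus_one by (force intro: image_eqI[of _ _ "_ - 1"])
  then show ?thesis by (rule finite_subset) auto
qed

text \<open>Cyclicity of the trace is available for factors in \<open>Mn n\<close>, which
  \<open>g\<close> and \<open>ginv g\<close> are not; inserting \<open>JJ n\<close> before
  \<open>ginv g\<close> moves both factors into the corner.\<close>

lemma mtr_conj:
  assumes "g \<in> Gn n" "a \<in> Mn n" shows "mtr n (g * a * ginv g) = mtr n a"
proof -
  have "mtr n (g * a * ginv g) = mtr n ((g * a) * (JJ n * ginv g))"
    using Mn_JJ(2)[of "g * a" n] assms by (metis Gn_Mn(1) mult.assoc)
  also have "\<dots> = mtr n ((JJ n * ginv g) * (g * a))"
    using assms by (intro mtr_commute) auto
  also have "(JJ n * ginv g) * (g * a) = a"
    using assms Mn_JJ(1)[of a n] by (simp add: mult.assoc)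
  finally show ?thesis .
qed

section \<open>Characters of truncated valuation rings\<close>

text \<open>Translation by \<open>d0\<close> multiplies the sum by \<open>\<chi> d0\<close>, which
  differs from 1.\<close>

lemma char_sum_zero:
  fixes \<chi> :: "'g::ab_group_add \<Rightarrow> complex"
  assumes fin: "finite D" and add: "\<And>x y. x \<in> D \<Longrightarrow> y \<in> D \<Longrightarrow> x + y \<in> D"
    and min: "\<And>x y. x \<in> D \<Longrightarrow> y \<in> D \<Longrightarrow> x - y \<in> D"
    and hom: "\<And>x y. x \<in> D \<Longrightarrow> y \<in> D \<Longrightarrow> \<chi> (x + y) = \<chi> x * \<chi> y"
    and d0: "d0 \<in> D" "\<chi> d0 \<noteq> 1"
  shows "(\<Sum>d\<in>D. \<chi> d) = 0"
proof -
  have "(\<Sum>d\<in>D. \<chi> d) = (\<Sum>d\<in>D. \<chi> (d0 + d))"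
    by (rule sum.reindex_bij_witness[of _ "\<lambda>d. d0 + d" "\<lambda>d. d - d0"])
      (use add min d0 in \<open>auto simp: algebra_simps\<close>)
  also have "\<dots> = \<chi> d0 * (\<Sum>d\<in>D. \<chi> d)"
    by (simp add: hom d0 sum_distrib_left)
  finally show ?thesis using d0 by simp
qed

text \<open>\<open>hf\<close> plays the part of 1/2, the coefficient of the quadratic term of the
  truncated exponential; as a parameter it spares defining a division.\<close>

locale trunc =
  fixes \<pi> :: "'r::{comm_ring_1,finite}" and l n :: nat and \<phi> :: "'r \<Rightarrow> complex" and hf :: 'r
  assumes dvr: "trunc_dvr \<pi> l" and l2: "l \<ge> 2" and prim: "primitive_char \<pi> l \<phi>"
    and hf: "hf + hf = 1" and n0: "n > 0"
begin

abbreviation A :: "'r lmap set" where "A \<equiv> Mn n"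
abbreviation G :: "'r lmap set" where "G \<equiv> Gn n"

text \<open>\<open>m\<close> and \<open>M\<close> are the floor and the ceiling of l/2, and
  \<open>h\<close> is the parity of l. Two inequalities drive everything: 2M >= l makes level
  \<open>M\<close> abelian, and 3m >= l, which amounts to h <= m, cuts off the exponential after the
  quadratic term.\<close>

definition m :: nat where "m = l div 2"
definition M :: nat where "M = l - l div 2"
definition h :: nat where "h = M - m"

lemma mMh: "m \<ge> 1" "M = m + h" "l = m + M" "h \<le> 1" "h \<le> m"
  using l2 by (auto simp: m_def M_def h_def)

lemma pi_l: "\<pi> ^ l = 0" and pi_l1: "\<pi> ^ (l - 1) \<noteq> 0"
  and unit_iff: "\<And>a. a dvd 1 \<longleftrightarrow> \<not> \<pi> dvd a"
  using dvr by (auto simp: trunc_dvr_def)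

lemma pi_zero: "k \<ge> l \<Longrightarrow> \<pi> ^ k = 0"
  using pi_l by (metis le_iff_add mult_zero_left power_add)

text \<open>Factors \<open>\<pi>\<close> are peeled off \<open>a\<close> one at a time: if
  \<open>\<pi>\<close> did not divide \<open>a\<close>, then \<open>a\<close> would be a unit and
  \<open>\<pi> ^ k\<close> would vanish, against \<open>pi_l1\<close>. This converts annihilation
  into congruence.\<close>

lemma pi_ann: "k \<le> l \<Longrightarrow> \<pi> ^ k * a = 0 \<Longrightarrow> \<pi> ^ (l - k) dvd a"
proof (induction "l - k" arbitrary: k a)
  case (Suc d)
  have "\<pi> dvd a"
  proof (rule ccontr)
    assume "\<not> \<pi> dvd a"
    then obtain b where "a * b = 1" using unit_iff[of a] by (auto elim: dvdE)
    then have "\<pi> ^ k = 0" using Suc(4) by (metis mult.assoc mult.right_neutral mult_zero_left)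
    moreover have "\<pi> ^ (l - 1) = \<pi> ^ k * \<pi> ^ (l - 1 - k)"
      using Suc(2) by (simp flip: power_add)
    ultimately show False using pi_l1 by simp
  qed
  then obtain b where a: "a = \<pi> * b" by (auto elim: dvdE)
  have "d = l - Suc k" using Suc(2) by simp
  moreover have "Suc k \<le> l" using Suc(2) by simp
  moreover have "\<pi> ^ Suc k * b = 0" using Suc(4) a by (simp add: mult_ac)
  ultimately have "\<pi> ^ (l - Suc k) dvd b" using Suc(1) by blast
  moreover have "l - k = Suc (l - Suc k)" using Suc(2) by simp
  ultimately show ?case using a by (auto intro: mult_dvd_mono)
qed auto

lemma phi_0: "\<phi> 0 = 1" and phi_add: "\<phi> (a + b) = \<phi> a * \<phi> b"
  using prim by (auto simp: primitive_char_def add_char_def)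

lemma phi_minus: "\<phi> a * \<phi> (- a) = 1"
  using phi_add[of a "- a"] phi_0 by simp

lemma phi_nz: "\<phi> a \<noteq> 0" using phi_minus[of a] by auto

lemma phi_uminus: "\<phi> (- a) = inverse (\<phi> a)"
  using phi_minus[of a] by (metis inverse_unique)

lemma phi_diff: "\<phi> (a - b) = \<phi> a * inverse (\<phi> b)"
  using phi_add[of a "- b"] by (simp add: phi_uminus)

text \<open>If \<open>i\<close> is the exact exponent of \<open>\<pi>\<close> in a nonzero
  \<open>a\<close>, the multiples of \<open>a\<close> include all
  \<open>\<pi> ^ (l - 1) * b\<close>, where a primitive character is nontrivial.\<close>

lemma phi_nondeg:
  assumes "\<And>r. \<phi> (a * r) = 1" shows "a = 0"
proof (rule ccontr)
  assume a: "a \<noteq> 0"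
  define P where "P i \<longleftrightarrow> \<pi> ^ i dvd a" for i
  have P0: "P 0" by (simp add: P_def)
  have bd: "i < l" if "P i" for i
    using that a pi_zero[of i] by (force simp: P_def)
  define i where "i = Greatest P"
  have Pi: "P i" unfolding i_def using P0 bd by (intro GreatestI_nat[of P 0 l]) (auto intro: less_imp_le)
  have nP: "\<not> P (Suc i)"
    using Greatest_le_nat[of P "Suc i" l] bd by (force simp: i_def)
  obtain u where u: "a = \<pi> ^ i * u" using Pi by (auto simp: P_def)
  have "\<not> \<pi> dvd u" using nP by (auto simp: P_def u mult_ac)
  then obtain v where v: "u * v = 1" using unit_iff[of u] by (auto elim: dvdE)
  obtain b where b: "\<phi> (\<pi> ^ (l - 1) * b) \<noteq> 1" using prim by (auto simp: primitive_char_def)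
  have "a * (v * \<pi> ^ (l - 1 - i) * b) = (u * v) * (\<pi> ^ i * \<pi> ^ (l - 1 - i)) * b"
    by (simp add: u mult_ac)
  also have "\<dots> = \<pi> ^ (l - 1) * b"
    using bd[OF Pi] by (simp add: v flip: power_add)
  finally show False using assms b by metis
qed

text \<open>Fourier inversion on the finite ring: the correlations of \<open>\<chi>\<close> with all
  characters \<open>\<phi> (a * y)\<close> add up to the order of the ring, so one of them is
  nonzero, and a nonzero character sum forces the quotient character to be trivial.\<close>

lemma phi_dual:
  assumes "add_char \<chi>" obtains a where "\<And>x. \<chi> x = \<phi> (a * x)"
proof -
  have S: "(\<Sum>a\<in>UNIV. \<phi> (- (a * y))) = (if y = 0 then of_nat (card (UNIV :: 'r set)) else 0)" for y
  proof (cases "y = 0")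
    case False
    then obtain r where "\<phi> (y * r) \<noteq> 1" using phi_nondeg by blast
    then have "(\<Sum>a\<in>UNIV. \<phi> (- (a * y))) = 0"
      by (intro char_sum_zero[where ?d0.0 = "- r"]) (auto simp: distrib_left distrib_right phi_uminus phi_add phi_diff mult.commute)
    then show ?thesis using False by simp
  qed (simp add: phi_0)
  have "(\<Sum>a\<in>UNIV. \<Sum>y\<in>UNIV. \<chi> y * \<phi> (- (a * y))) = (\<Sum>y\<in>UNIV. \<chi> y * (\<Sum>a\<in>UNIV. \<phi> (- (a * y))))"
    by (subst sum.swap) (simp add: sum_distrib_left)
  also have "\<dots> = of_nat (card (UNIV :: 'r set))"
    using assms by (simp add: S add_char_def if_distrib sum.delta cong: if_cong)
  finally have "(\<Sum>a\<in>UNIV. \<Sum>y\<in>UNIV. \<chi> y * \<phi> (- (a * y))) \<noteq> 0"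
    by (simp add: finite_UNIV_card_ge_0)
  then obtain a where a: "(\<Sum>y\<in>UNIV. \<chi> y * \<phi> (- (a * y))) \<noteq> 0"
    by (metis (no_types, lifting) sum.neutral)
  have "\<chi> y * \<phi> (- (a * y)) = 1" for y
  proof (rule ccontr)
    assume "\<chi> y * \<phi> (- (a * y)) \<noteq> 1"
    then have "(\<Sum>y\<in>UNIV. \<chi> y * \<phi> (- (a * y))) = 0"
      using assms by (intro char_sum_zero[where ?d0.0 = y])
        (auto simp: add_char_def distrib_left phi_uminus phi_add phi_diff)
    then show False using a by simp
  qed
  then have "\<chi> y = \<phi> (a * y)" for y
    using phi_minus[of "a * y"] phi_nz by (metis mult.commute mult_right_cancel)
  then show ?thesis using that by blast
qed

subsection \<open>The trace pairing\<close>

definition Psi :: "'r lmap \<Rightarrow> complex" where "Psi a = \<phi> (mtr n a)"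

lemma Psi_simps: "Psi 0 = 1" "Psi (a + b) = Psi a * Psi b" "Psi (- a) = inverse (Psi a)"
  "Psi (a - b) = Psi a * inverse (Psi b)" "Psi a \<noteq> 0"
  by (auto simp: Psi_def phi_0 phi_add phi_uminus phi_nz diff_conv_add_uminus simp del: add_uminus_conv_diff)

lemma Psi_commute: "a \<in> A \<Longrightarrow> b \<in> A \<Longrightarrow> Psi (a * b) = Psi (b * a)"
  by (simp add: Psi_def mtr_commute)

lemma Psi_nondeg:
  assumes "x \<in> A" "\<And>y. y \<in> A \<Longrightarrow> Psi (x * y) = 1" shows "x = 0"
proof (rule Mn_eqI[of _ n])
  fix i j assume ij: "i < n" "j < n"
  have "\<phi> (ent x i j * r) = 1" for r
    using assms(2)[of "eij n j i r"] ij by (simp add: Psi_def mtr_eij mult.commute)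
  then show "ent x i j = ent 0 i j" using phi_nondeg by simp
qed (use assms in auto)

lemma Psi_sum:
  assumes "y \<in> A"
  shows "(\<Sum>x\<in>A. Psi (x * y)) = (if y = 0 then of_nat (card A) else 0)"
proof (cases "y = 0")
  case False
  then obtain x where "x \<in> A" "Psi (y * x) \<noteq> 1" using Psi_nondeg assms by blast
  then show ?thesis using False Psi_commute[of x y] assms
    by (auto intro!: char_sum_zero[where ?d0.0 = x] simp: algebra_simps Psi_simps)
qed (simp add: Psi_simps)

lemma card_A: "card A > 0"
  using finite_Mn[of n, where 'r = 'r] Mn_closed(1)[of n] by (metis card_gt_0_iff empty_iff)

text \<open>Finite duality for the trace pairing. If \<open>y\<close> were outside \<open>D\<close>,
  the sum of \<open>Psi (x * (d - y))\<close> would vanish when \<open>x\<close> runs first, while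
  letting \<open>d\<close> run first gives the order of \<open>D\<close> times that of its
  annihilator.\<close>

lemma double_annihilator:
  assumes D: "D \<subseteq> A" "0 \<in> D" "\<And>x y. x \<in> D \<Longrightarrow> y \<in> D \<Longrightarrow> x + y \<in> D"
      "\<And>x y. x \<in> D \<Longrightarrow> y \<in> D \<Longrightarrow> x - y \<in> D"
    and y: "y \<in> A" and *: "\<And>x. x \<in> A \<Longrightarrow> (\<And>d. d \<in> D \<Longrightarrow> Psi (x * d) = 1) \<Longrightarrow> Psi (x * y) = 1"
  shows "y \<in> D"
proof (rule ccontr)
  assume ny: "y \<notin> D"
  have fin: "finite D" using D(1) finite_subset by blast
  define D' where "D' = {x \<in> A. \<forall>d\<in>D. Psi (x * d) = 1}"
  have DA: "\<And>d. d \<in> D \<Longrightarrow> d \<in> A" using D(1) by blast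
  have 1: "(\<Sum>x\<in>A. \<Sum>d\<in>D. Psi (x * (d - y))) = 0"
    by (subst sum.swap, rule sum.neutral) (use ny y DA in \<open>auto simp: Psi_sum\<close>)
  have "(\<Sum>x\<in>A. \<Sum>d\<in>D. Psi (x * (d - y))) = (\<Sum>x\<in>A. (\<Sum>d\<in>D. Psi (x * d)) * inverse (Psi (x * y)))"
    by (simp add: sum_distrib_right right_diff_distrib Psi_simps)
  also have "\<dots> = (\<Sum>x\<in>A. if x \<in> D' then of_nat (card D) else 0)"
  proof (rule sum.cong)
    fix x assume x: "x \<in> A"
    show "(\<Sum>d\<in>D. Psi (x * d)) * inverse (Psi (x * y)) = (if x \<in> D' then of_nat (card D) else 0)"
    proof (cases "x \<in> D'")
      case True
      then have "Psi (x * y) = 1" using * by (auto simp: D'_def)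
      then show ?thesis using True by (auto simp: D'_def)
    next
      case False
      then obtain d where d: "d \<in> D" "Psi (x * d) \<noteq> 1" using x by (auto simp: D'_def)
      have "(\<Sum>d\<in>D. Psi (x * d)) = 0"
        by (rule char_sum_zero[where ?d0.0 = d]) (use d D fin in \<open>auto simp: algebra_simps Psi_simps\<close>)
      then show ?thesis using False by simp
    qed
  qed auto
  also have "\<dots> = of_nat (card D' * card D)"
    using sum.inter_filter[of A "\<lambda>_. complex_of_nat (card D)" "\<lambda>x. x \<in> D'"]
    by (simp add: D'_def conj_absorb cong: conj_cong)
  finally have "card D' * card D = 0" using 1 by (metis of_nat_eq_0_iff)
  moreover have "0 \<in> D'" by (auto simp: D'_def Psi_simps)
  moreover have "finite D'" by (auto simp: D'_def)
  ultimately show False using D(2) fin by auto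
qed

lemma Mn_ann:
  assumes "a \<in> A" "k \<le> l" "scl (\<pi> ^ k) a = 0"
  obtains y where "y \<in> A" "a = scl (\<pi> ^ (l - k)) y"
proof -
  have "\<exists>b. ent a i j = \<pi> ^ (l - k) * b" for i j
  proof -
    have "ent (scl (\<pi> ^ k) a) i j = 0" using assms(3) by simp
    then show ?thesis using pi_ann[OF assms(2)] by (auto elim: dvdE)
  qed
  then obtain f where f: "\<And>i j. ent a i j = \<pi> ^ (l - k) * f i j" by metis
  have "a = scl (\<pi> ^ (l - k)) (mk n f)"
    by (rule Mn_eqI[of _ n]) (use assms f in \<open>auto simp: ent_mk\<close>)
  then show ?thesis using that[of "mk n f"] by auto
qed

subsection \<open>Truncated exponentials\<close>

text \<open>The cubic term of the exponential would carry \<open>\<pi> ^ (3 * m) = 0\<close>; only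
  1/2 is needed as a denominator, also in residue characteristic 3.\<close>

definition E :: "'r lmap \<Rightarrow> 'r lmap" where
  "E y = 1 + scl (\<pi> ^ m) y + scl (hf * (\<pi> ^ m * \<pi> ^ m)) (y * y)"

lemma pi_mM: "\<pi> ^ m * \<pi> ^ M = 0" "\<pi> ^ m * (\<pi> ^ M * x) = 0"
  "\<pi> ^ M * \<pi> ^ m = 0" "\<pi> ^ M * \<pi> ^ M = 0" "\<pi> ^ M * (\<pi> ^ M * x) = 0"
  "\<pi> ^ m * (\<pi> ^ m * \<pi> ^ m) = 0" "\<pi> ^ m * (\<pi> ^ m * (\<pi> ^ m * x)) = 0"
  "\<pi> ^ m * \<pi> ^ h = \<pi> ^ M" "\<pi> ^ (2 * m) = \<pi> ^ m * \<pi> ^ m"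
  using mMh by (simp_all flip: power_add mult.assoc add: pi_zero mult_2 add_ac)

lemma scl_halves: "scl (a * a) z = scl (a * (a * hf)) z + scl (a * (a * hf)) z" for a
  by (metis distrib_left hf mult.assoc mult.right_neutral scl_distribs(2))

lemma E_zero [simp]: "E 0 = 1" by (simp add: E_def)

text \<open>The Baker-Campbell-Hausdorff series stops after the first bracket, since longer brackets
  carry \<open>\<pi> ^ (3 * m)\<close>. One of the two factors \<open>\<pi> ^ m\<close> of that
  bracket is already built into \<open>E\<close>.\<close>

lemma E_mult:
  "E y * E y' = E (y + y' + scl (hf * \<pi> ^ m) (y * y' - y' * y))"
proof -
  define a where "a = \<pi> ^ m"
  have a: "a * (a * a) = 0" "\<And>x. a * (a * (a * x)) = 0" by (auto simp: a_def pi_mM)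
  show ?thesis
    unfolding E_def a_def[symmetric]
    apply (simp add: algebra_simps scl_distribs a)
    apply (subst scl_halves)
    apply (simp add: algebra_simps scl_distribs)
    done
qed

text \<open>The parameter of \<open>E\<close> matters only modulo \<open>\<pi> ^ M\<close>, which
  leaves room for correction terms later.\<close>

lemma E_shift: "E (z + scl (\<pi> ^ M) c) = E z"
proof -
  have "\<pi> ^ m * (\<pi> ^ m * \<pi> ^ M) = 0" "\<pi> ^ m * (\<pi> ^ m * (\<pi> ^ M * x)) = 0" for x
    using pi_mM(1,2) by (auto simp: mult.left_commute)
  moreover have "hf * (\<pi> ^ m * \<pi> ^ m) * \<pi> ^ M = 0" "hf * (\<pi> ^ m * \<pi> ^ m) * (\<pi> ^ M * x) = 0" for x
    using pi_mM(1,2) by (metis mult.assoc mult_zero_right)+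
  ultimately show ?thesis
    unfolding E_def by (simp add: algebra_simps scl_distribs pi_mM)
qed

lemma E_inverse: "E y * E (- y) = 1" "E (- y) * E y = 1"
  by (simp_all add: E_mult)

lemma E_minus_one: "y \<in> A \<Longrightarrow> E y - 1 \<in> A"
  by (simp add: E_def)

lemma E_G [simp, intro]: "y \<in> A \<Longrightarrow> E y \<in> G"
  using E_inverse E_minus_one Mn_closed(4) unfolding Gn_def by blast

lemma E_conj: "g \<in> G \<Longrightarrow> g * E y = E (g * y * ginv g) * g"
proof -
  assume g: "g \<in> G"
  have "E (g * y * ginv g) = g * E y * ginv g"
    using g by (simp add: E_def algebra_simps)
  then show ?thesis using g by (simp add: mult.assoc)
qed

text \<open>The truncated logarithm.\<close>

lemma E_surj: "1 + scl (\<pi> ^ m) y = E (y - scl (hf * \<pi> ^ m) (y * y))"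
proof -
  define a where "a = \<pi> ^ m"
  have a: "a * (a * a) = 0" "\<And>x. a * (a * (a * x)) = 0" by (auto simp: a_def pi_mM)
  show ?thesis
    unfolding E_def a_def[symmetric] by (simp add: algebra_simps scl_distribs a)
qed

lemma E_high: "E (scl (\<pi> ^ h) y) = 1 + scl (\<pi> ^ M) y"
proof -
  have "hf * (\<pi> ^ m * \<pi> ^ m) * (\<pi> ^ h * \<pi> ^ h) = hf * ((\<pi> ^ m * \<pi> ^ h) * (\<pi> ^ m * \<pi> ^ h))"
    by (simp add: mult_ac)
  then show ?thesis by (simp add: E_def pi_mM mult.assoc)
qed

text \<open>Level \<open>M\<close> elements are central in the group of all \<open>E w\<close>: the
  bracket with a multiple of \<open>\<pi> ^ h\<close> carries
  \<open>\<pi> ^ (m + h) = \<pi> ^ M\<close> and is absorbed by \<open>E_shift\<close>.\<close>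

lemma E_add_high: "E w * E (scl (\<pi> ^ h) y) = E (w + scl (\<pi> ^ h) y)"
    "E (scl (\<pi> ^ h) y) * E w = E (w + scl (\<pi> ^ h) y)"
proof -
  have *: "hf * \<pi> ^ m * \<pi> ^ h = \<pi> ^ M * hf" by (metis mult.assoc mult.commute pi_mM(8))
  have "E w * E (scl (\<pi> ^ h) y) = E (w + scl (\<pi> ^ h) y + scl (\<pi> ^ M) (scl hf (w * y - y * w)))"
    by (simp add: E_mult scl_distribs *)
  then show "E w * E (scl (\<pi> ^ h) y) = E (w + scl (\<pi> ^ h) y)" by (simp only: E_shift)
  have "E (scl (\<pi> ^ h) y) * E w = E (w + scl (\<pi> ^ h) y + scl (\<pi> ^ M) (scl hf (y * w - w * y)))"
    by (simp add: E_mult scl_distribs * add.commute)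
  then show "E (scl (\<pi> ^ h) y) * E w = E (w + scl (\<pi> ^ h) y)" by (simp only: E_shift)
qed

lemma E_commutator: "E w * E y = E y * E w * E (scl (\<pi> ^ m) (w * y - y * w))"
proof -
  define c where "c = w * y - y * w"
  have "E y * E w * E (scl (\<pi> ^ m) c) = E (y + w + scl (hf * \<pi> ^ m) (- c)) * E (scl (\<pi> ^ h) (scl (\<pi> ^ (m - h)) c))"
    using mMh(5) by (simp add: E_mult c_def flip: power_add)
  also have "\<dots> = E (y + w + (scl (\<pi> ^ m) c - scl (hf * \<pi> ^ m) c))"
    using mMh(5) by (simp only: E_add_high) (simp add: algebra_simps flip: power_add)
  also have "scl (\<pi> ^ m) c - scl (hf * \<pi> ^ m) c = scl (hf * \<pi> ^ m) c"
    by (metis add_diff_cancel distrib_right hf mult_1 scl_distribs(2))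
  also have "E (y + w + scl (hf * \<pi> ^ m) c) = E w * E y"
    by (simp add: E_mult c_def add.commute)
  finally show ?thesis by (simp add: c_def)
qed

end

section \<open>Strictly upper triangular and companion matrices\<close>

lemma ap_eqI: "(\<And>v. ap a v = ap b v) \<Longrightarrow> a = b"
  by (metis ap_inject ext)

lemma ap_supp:
  assumes "\<And>k. k \<ge> n \<Longrightarrow> v k = 0" shows "ap a v i = (\<Sum>k<n. v k * ent a i k)"
proof -
  have "ap (JJ n) v = v" using assms by (auto simp: ap_JJ fun_eq_iff)
  then show ?thesis using ap_expand[of a n v] by metis
qed

lemma Mn_ap_supp: "a \<in> Mn n \<Longrightarrow> i \<ge> n \<Longrightarrow> ap a v i = 0"
  using Mn_JJ(1)[of a n] ap_JJ[of n "ap a v" i] by (metis ap_mult not_le)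

lemma Mn_eq_colI:
  assumes "a \<in> Mn n" "b \<in> Mn n" "\<And>j. j < n \<Longrightarrow> ap a (unitv j) = ap b (unitv j)"
  shows "a = b"
  by (rule Mn_eqI[of _ n]) (use assms in \<open>auto simp: ent_def\<close>)

lemma JJ_unitv: "j < n \<Longrightarrow> ap (JJ n) (unitv j) = unitv j"
  by (auto simp: ap_JJ unitv_def fun_eq_iff)

definition nn :: "nat \<Rightarrow> 'r::comm_ring_1 lmap set" where
  "nn n = {a \<in> Mn n. \<forall>i j. j \<le> i \<longrightarrow> ent a i j = 0}"

definition UU :: "nat \<Rightarrow> 'r::comm_ring_1 lmap set" where
  "UU n = {u. u - 1 \<in> nn n}"

lemma nn_Mn: "a \<in> nn n \<Longrightarrow> a \<in> Mn n" by (simp add: nn_def)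

lemma nn_closed [simp, intro]:
  "0 \<in> nn n"
  "a \<in> nn n \<Longrightarrow> b \<in> nn n \<Longrightarrow> a + b \<in> nn n"
  "a \<in> nn n \<Longrightarrow> b \<in> nn n \<Longrightarrow> a - b \<in> nn n"
  "a \<in> nn n \<Longrightarrow> - a \<in> nn n"
  "a \<in> nn n \<Longrightarrow> scl c a \<in> nn n"
  by (auto simp: nn_def)

lemma nn_mult [simp, intro]:
  assumes "a \<in> nn n" "b \<in> nn n" shows "a * b \<in> nn n"
proof -
  have "ent (a * b) i j = 0" if "j \<le> i" for i j
    unfolding ent_mult[OF nn_Mn[OF assms(2)]]
  proof (intro sum.neutral ballI)
    fix k
    show "ent a i k * ent b k j = 0"
      using assms that by (cases "k \<le> i") (auto simp: nn_def)
  qed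
  then show ?thesis using assms by (auto simp: nn_def)
qed

lemma UU_minus: "u \<in> UU n \<Longrightarrow> u - 1 \<in> nn n" by (simp add: UU_def)

lemma UU_nn:
  assumes "u \<in> UU n" "a \<in> nn n" shows "u * a \<in> nn n" "a * u \<in> nn n"
proof -
  have "(u - 1) * a + a \<in> nn n" "a * (u - 1) + a \<in> nn n" using assms UU_minus by blast+
  then show "u * a \<in> nn n" "a * u \<in> nn n" by (simp_all add: algebra_simps)
qed

lemma UU_mult: "u \<in> UU n \<Longrightarrow> u' \<in> UU n \<Longrightarrow> u * u' \<in> UU n"
proof -
  assume "u \<in> UU n" "u' \<in> UU n"
  then have "(u - 1) * (u' - 1) + (u - 1) + (u' - 1) \<in> nn n" using UU_minus by blast
  then show ?thesis by (simp add: UU_def algebra_simps)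
qed

lemma UU_one [simp]: "1 \<in> UU n" by (simp add: UU_def)

text \<open>Back substitution from the last row: row i of \<open>d\<close> is a combination of the
  rows below it.\<close>

lemma UU_cancel:
  assumes "u \<in> UU n" "d \<in> Mn n" "u * d = 0" shows "d = 0"
proof -
  define a where "a = u - 1"
  have a: "a \<in> nn n" using UU_minus assms a_def by blast
  have "d = - (a * d)" using assms(3) by (simp add: a_def algebra_simps)
  then have d: "ent d i j = - (\<Sum>k<n. ent a i k * ent d k j)" for i j
    using ent_mult[OF assms(2), of a] by (metis ent_simps(4))
  have "\<forall>j. ent d i j = 0" if "i \<le> n" for i
    using that
  proof (induction "n - i" arbitrary: i rule: less_induct)
    case less
    have "ent a i k * ent d k j = 0" if "k < n" for k j
    proof (cases "k \<le> i")
      case True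
      then show ?thesis using a by (auto simp: nn_def)
    next
      case False
      then show ?thesis using less(1)[of k] that by auto
    qed
    then have "(\<Sum>k<n. ent a i k * ent d k j) = 0" for j by simp
    then show ?case by (subst d) simp
  qed
  then show ?thesis using assms(2) by (intro Mn_eqI[of _ n]) auto
qed

lemma finite_UU [simp]: "finite (UU n :: 'r::{comm_ring_1,finite} lmap set)"
proof -
  have "UU n \<subseteq> (\<lambda>a. 1 + a) ` (Mn n :: 'r lmap set)"
    using UU_minus nn_Mn by (force intro: image_eqI[of _ _ "_ - 1"])
  then show ?thesis by (rule finite_subset) auto
qed

text \<open>Left multiplication by \<open>u\<close> is an injective self-map of the finite set
  \<open>UU n\<close>, hence hits 1.\<close>

lemma UU_inverse:
  fixes u :: "'r::{comm_ring_1,finite} lmap"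
  assumes "u \<in> UU n" obtains u' where "u' \<in> UU n" "u * u' = 1" "u' * u = 1"
proof -
  have MnU: "x - y \<in> Mn n" if "x \<in> UU n" "y \<in> UU n" for x y :: "'r lmap"
    using Mn_closed(3)[OF nn_Mn[OF UU_minus[OF that(1)]] nn_Mn[OF UU_minus[OF that(2)]]] by simp
  have "inj_on (\<lambda>x. u * x) (UU n)"
    using UU_cancel[OF assms MnU] by (intro inj_onI) (auto simp: algebra_simps)
  moreover have "(\<lambda>x. u * x) ` UU n \<subseteq> UU n" using assms UU_mult by auto
  ultimately have "(\<lambda>x. u * x) ` UU n = UU n" by (meson endo_inj_surj finite_UU)
  then obtain u' where u': "u' \<in> UU n" "u * u' = 1" using UU_one[of n] by (metis imageE)
  have "u * (u' * u) = u" using u'(2) by (metis mult.assoc mult_1_left)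
  then have "u * (u' * u - 1) = 0" by (simp add: right_diff_distrib)
  then have "u' * u - 1 = 0" using UU_cancel[OF assms] MnU UU_mult[OF u'(1) assms] UU_one by blast
  then show ?thesis using u' that by auto
qed

lemma UU_G [simp, intro]: "u \<in> UU n \<Longrightarrow> (u :: 'r::{comm_ring_1,finite} lmap) \<in> Gn n"
proof -
  assume u: "u \<in> UU n"
  then obtain u' where "u' \<in> UU n" "u * u' = 1" "u' * u = 1" using UU_inverse by blast
  then show "u \<in> Gn n" using u UU_minus nn_Mn unfolding Gn_def by blast
qed

lemma ginv_UU: "u \<in> UU n \<Longrightarrow> ginv (u :: 'r::{comm_ring_1,finite} lmap) \<in> UU n"
  using UU_inverse[of u n] ginv_eq by metis

text \<open>The exponent of the standard non-degenerate character, which sends \<open>u\<close> to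
  \<open>\<phi> (sd n u)\<close>.\<close>

definition sd :: "nat \<Rightarrow> 'r::comm_ring_1 lmap \<Rightarrow> 'r" where
  "sd n a = (\<Sum>i<n - 1. ent a i (Suc i))"

lemma sd_simps [simp]: "sd n 0 = 0" "sd n (a + b) = sd n a + sd n b" "sd n (a - b) = sd n a - sd n b"
  "sd n (scl c a) = c * sd n a" "sd n 1 = 0"
  by (auto simp: sd_def sum.distrib sum_subtractf sum_distrib_left ent_one)

lemma sd_nn_mult:
  assumes "a \<in> nn n" "b \<in> nn n" shows "sd n (a * b) = 0"
proof -
  have "ent a i k * ent b k (Suc i) = 0" for i k
    using assms by (cases "k \<le> i") (auto simp: nn_def)
  then show ?thesis using assms by (simp add: sd_def ent_mult[OF nn_Mn])
qed

lemma sd_mult: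
  assumes "u \<in> UU n" "u' \<in> UU n" shows "sd n (u * u') = sd n u + sd n u'"
proof -
  have "u * u' = (u - 1) * (u' - 1) + u + u' - 1" by (simp add: algebra_simps)
  moreover have "sd n ((u - 1) * (u' - 1)) = 0" using assms by (intro sd_nn_mult UU_minus)
  ultimately show ?thesis by simp
qed

text \<open>Only the shift on the first n - 1 basis vectors is prescribed; the free last column
  holds the coefficients of the characteristic polynomial.\<close>

definition companion :: "nat \<Rightarrow> 'r::comm_ring_1 lmap \<Rightarrow> bool" where
  "companion n C \<longleftrightarrow> C \<in> Mn n \<and> (\<forall>j. Suc j < n \<longrightarrow> ap C (unitv j) = unitv (Suc j))"

definition ZC :: "nat \<Rightarrow> 'r::comm_ring_1 lmap \<Rightarrow> 'r lmap set" where
  "ZC n C = {a \<in> Mn n. C * a = a * C}"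

text \<open>The polynomial of degree less than n with coefficients \<open>z\<close>, evaluated at
  \<open>X\<close>; the factor \<open>JJ n\<close> keeps the constant term inside the
  corner.\<close>

definition pz :: "nat \<Rightarrow> 'r::comm_ring_1 lmap \<Rightarrow> (nat \<Rightarrow> 'r) \<Rightarrow> 'r lmap" where
  "pz n X z = (\<Sum>i<n. scl (z i) (X ^ i * JJ n))"

lemma companion_Mn: "companion n C \<Longrightarrow> C \<in> Mn n" by (simp add: companion_def)

lemma ent_companion: "companion n C \<Longrightarrow> Suc j < n \<Longrightarrow> ent C i j = (if i = Suc j then 1 else 0)"
  by (simp add: companion_def ent_def unitv_def)

lemma pow_JJ: assumes "X \<in> Mn n" shows "X ^ i * JJ n \<in> Mn n" "JJ n * X ^ i = X ^ i * JJ n"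
proof -
  show "X ^ i * JJ n \<in> Mn n" by (induction i) (auto simp: mult.assoc assms)
  show "JJ n * X ^ i = X ^ i * JJ n"
    by (induction i) (auto simp: Mn_JJ[OF assms] mult.assoc, metis Mn_JJ assms mult.assoc)
qed

lemma pz_Mn [simp, intro]: "X \<in> Mn n \<Longrightarrow> pz n X z \<in> Mn n"
  unfolding pz_def by (intro Mn_sum Mn_closed pow_JJ)

lemma ZC_Mn: "a \<in> ZC n C \<Longrightarrow> a \<in> Mn n" by (simp add: ZC_def)

lemma ZC_closed [simp, intro]:
  "0 \<in> ZC n C"
  "a \<in> ZC n C \<Longrightarrow> b \<in> ZC n C \<Longrightarrow> a + b \<in> ZC n C"
  "a \<in> ZC n C \<Longrightarrow> b \<in> ZC n C \<Longrightarrow> a - b \<in> ZC n C"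
  "a \<in> ZC n C \<Longrightarrow> - a \<in> ZC n C"
  "a \<in> ZC n C \<Longrightarrow> scl c a \<in> ZC n C"
  by (auto simp: ZC_def algebra_simps)

lemma ZC_sum: "(\<And>i. i \<in> K \<Longrightarrow> f i \<in> ZC n C) \<Longrightarrow> (\<Sum>i\<in>K. f i) \<in> ZC n C"
  by (induction K rule: infinite_finite_induct) auto

lemma pow_ZC: "C \<in> Mn n \<Longrightarrow> C ^ i * JJ n \<in> ZC n C"
  using pow_JJ[of C n i] Mn_JJ[of C n]
  by (auto simp: ZC_def mult.assoc) (metis mult.assoc power_commutes)

lemma pz_ZC: "C \<in> Mn n \<Longrightarrow> pz n C z \<in> ZC n C"
  unfolding pz_def by (intro ZC_sum ZC_closed pow_ZC)

text \<open>The first basis vector is cyclic for \<open>C\<close>, so its image determines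
  everything that commutes with \<open>C\<close>.\<close>

lemma ZC_eq_0:
  assumes C: "companion n C" and a: "a \<in> ZC n C" and 0: "ap a (unitv 0) = (\<lambda>i. 0)"
  shows "a = 0"
proof -
  have "ap a (unitv j) = (\<lambda>i. 0)" if "j < n" for j
    using that
  proof (induction j)
    case (Suc j)
    have "ap a (unitv (Suc j)) = ap (a * C) (unitv j)"
      using C Suc by (simp add: companion_def ap_mult)
    also have "a * C = C * a" using a by (simp add: ZC_def)
    finally show ?case using Suc by (simp add: ap_mult ap_zero)
  qed (use 0 in simp)
  then show ?thesis
    by (intro Mn_eq_colI[of _ n]) (use a ZC_Mn in \<open>auto\<close>)
qed

lemma companion_pow: "companion n C \<Longrightarrow> i + j < n \<Longrightarrow> ap (C ^ i) (unitv j) = unitv (i + j)"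
  by (induction i) (auto simp: ap_mult companion_def)

lemma companion_pow_JJ: "companion n C \<Longrightarrow> i + j < n \<Longrightarrow> ap (C ^ i * JJ n) (unitv j) = unitv (i + j)"
  by (simp add: ap_mult JJ_unitv companion_pow)

lemma ap_pz: "companion n C \<Longrightarrow> ap (pz n C z) (unitv 0) = (\<lambda>k. if k < n then z k else 0)"
proof
  fix k assume C: "companion n C"
  have "ap (pz n C z) (unitv 0) k = (\<Sum>i<n. z i * unitv i k)"
    using companion_pow_JJ[OF C, of _ 0] by (simp add: pz_def sum_ap)
  also have "\<dots> = (\<Sum>i<n. if i = k then z i else 0)"
    by (rule sum.cong) (auto simp: unitv_def)
  finally show "ap (pz n C z) (unitv 0) k = (if k < n then z k else 0)" by simp
qed

lemma ZC_eq:
  assumes C: "companion n C" and a: "a \<in> ZC n C" and b: "b \<in> ZC n C" and "\<And>i. i < n \<Longrightarrow> ent a i 0 = ent b i 0"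
  shows "a = b"
proof -
  have "ap (a - b) (unitv 0) i = 0" for i
    using assms(4) Mn_ap_supp[of "a - b" n i] ZC_Mn[OF a] ZC_Mn[OF b]
    by (cases "i < n") (auto simp: ent_def)
  then have "a - b = 0" by (intro ZC_eq_0[OF C]) (use a b in auto)
  then show ?thesis by simp
qed

lemma ent_pz: "companion n C \<Longrightarrow> ent (pz n C z) i 0 = (if i < n then z i else 0)"
  by (simp add: ent_def ap_pz)

lemma ZC_pz: "companion n C \<Longrightarrow> r \<in> ZC n C \<Longrightarrow> r = pz n C (\<lambda>i. ent r i 0)"
  by (rule ZC_eq) (auto simp: ent_pz intro: pz_ZC companion_Mn)

text \<open>The centralizer consists of polynomials in \<open>C\<close>. Here \<open>b\<close> may
  lie outside the corner, as padded group elements do, which is why commutation with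
  \<open>JJ n\<close> is required separately.\<close>

lemma ZC_commute:
  assumes C: "companion n C" and r: "r \<in> ZC n C" and b: "b * C = C * b" and bJ: "b * JJ n = JJ n * b"
  shows "b * r = r * b"
proof -
  have p: "b * C ^ i = C ^ i * b" for i
    by (induction i) (simp_all add: mult.assoc, metis b mult.assoc)
  have "b * (C ^ i * JJ n) = C ^ i * JJ n * b" for i
    by (metis p bJ mult.assoc)
  then have "b * pz n C z = pz n C z * b" for z
    by (simp add: pz_def sum_distrib_left sum_distrib_right)
  then show ?thesis using ZC_pz[OF C r] by metis
qed

lemma ZC_commute': "companion n C \<Longrightarrow> r \<in> ZC n C \<Longrightarrow> r' \<in> ZC n C \<Longrightarrow> r * r' = r' * r"
  by (rule ZC_commute[of n C r' r]) (auto simp: ZC_def Mn_JJ)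

text \<open>An approximate centralizer element is approximated by an exact one, namely the
  polynomial in \<open>C\<close> with the same first column. Here and below, multiplication by
  \<open>\<kappa>\<close> encodes a congruence.\<close>

lemma companion_approx_commute:
  assumes C: "companion n C" and g: "g \<in> Mn n" and k: "scl \<kappa> (C * g - g * C) = 0"
  obtains z where "z \<in> ZC n C" "scl \<kappa> (g - z) = 0" "\<And>i. i < n \<Longrightarrow> ent z i 0 = ent g i 0"
proof -
  define z where "z = pz n C (\<lambda>i. ent g i 0)"
  have z: "z \<in> ZC n C" unfolding z_def using C companion_Mn pz_ZC by blast
  have z0: "ent z i 0 = ent g i 0" if "i < n" for i using that by (simp add: z_def ent_pz[OF C])
  have "C * (g - z) - (g - z) * C = C * g - g * C" using z by (simp add: ZC_def algebra_simps)
  then have "scl \<kappa> (g - z) \<in> ZC n C"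
    using k z g ZC_Mn[OF z] by (simp add: ZC_def algebra_simps scl_distribs)
  then have "scl \<kappa> (g - z) = 0"
    by (rule ZC_eq[OF C]) (auto simp: z0)
  then show ?thesis using that z z0 by blast
qed

lemma conj_companion:
  assumes g: "g \<in> Gn n" and X: "X \<in> Mn n"
    and *: "\<And>j. Suc j < n \<Longrightarrow> ap X (ap g (unitv j)) = ap g (unitv (Suc j))"
  shows "companion n (ginv g * X * g)"
proof -
  have "ap (ginv g * X * g) (unitv j) = unitv (Suc j)" if "Suc j < n" for j
    using *[OF that] Gn_inv(2)[OF g] by (simp add: ap_mult flip: ap_mult[of "ginv g" g])
  then show ?thesis using g X by (auto simp: companion_def)
qed

text \<open>The columns of \<open>u\<close> are the iterates of the first basis vector under
  \<open>X\<close>. The shape of \<open>X\<close> makes the j-th iterate the j-th basis vector plus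
  terms of smaller index, so \<open>u\<close> is unitriangular.\<close>

lemma Hessenberg_conj:
  fixes X :: "'r::{comm_ring_1,finite} lmap"
  assumes X: "X \<in> Mn n" and n: "n > 0" and one: "\<And>j. Suc j < n \<Longrightarrow> ent X (Suc j) j = 1"
    and zero: "\<And>i j. i < n \<Longrightarrow> Suc j < i \<Longrightarrow> ent X i j = 0"
  obtains u where "u \<in> UU n" "companion n (ginv u * X * u)"
proof -
  define c where "c j = ap (X ^ j) (unitv 0)" for j
  have c0: "c j i = 0" if "i \<ge> n" for i j
    using that n Mn_ap_supp[OF X, of i] by (cases j) (auto simp: c_def unitv_def ap_mult)
  have cS: "c (Suc j) i = (\<Sum>k<n. c j k * ent X i k)" for i j
    using ap_supp[of n "c j" X i] c0 by (simp add: c_def ap_mult)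
  have c: "(i > j \<longrightarrow> c j i = 0) \<and> (i = j \<longrightarrow> c j i = 1)" if "i < n" for i j
    using that
  proof (induction j arbitrary: i)
    case 0
    then show ?case by (simp add: c_def unitv_def)
  next
    case (Suc j)
    have *: "c j k * ent X i k = 0" if "k < n" "Suc j < i \<or> (i = Suc j \<and> k \<noteq> j)" for k
    proof (cases "k > j")
      case True then show ?thesis using Suc(1)[OF that(1)] by simp
    next
      case False then show ?thesis using zero[of i k] that Suc(2) by auto
    qed
    have "c (Suc j) i = 0" if "i > Suc j" using that * by (simp add: cS)
    moreover have "c (Suc j) i = 1" if i: "i = Suc j"
    proof -
      have "c (Suc j) i = (\<Sum>k<n. if k = j then 1 else 0)"
        unfolding cS using * i Suc(1)[of j] Suc(2) one[of j] by (intro sum.cong) auto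
      then show ?thesis using i Suc(2) by simp
    qed
    ultimately show ?case by simp
  qed
  define a where "a = mk n (\<lambda>i j. if j \<le> i then 0 else c j i)"
  define u where "u = 1 + a"
  have "a \<in> nn n" by (auto simp: nn_def a_def ent_mk)
  then have uU: "u \<in> UU n" by (simp add: UU_def u_def)
  have u: "ap u (unitv j) = c j" if "j < n" for j
  proof
    fix i
    have "ap u (unitv j) i = ent 1 i j + ent a i j" by (simp add: u_def ent_def)
    also have "\<dots> = c j i"
      using c[of i j] c0[of i j] that by (auto simp: ent_one a_def ent_mk)
    finally show "ap u (unitv j) i = c j i" .
  qed
  have "companion n (ginv u * X * u)"
    by (rule conj_companion) (use uU X in \<open>auto simp: u c_def ap_mult\<close>)
  then show ?thesis using that uU by blast
qed

text \<open>The monic polynomial of degree n with lower coefficients \<open>- c i\<close>, evaluated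
  at \<open>X\<close>. For \<open>c\<close> the last column of a companion matrix this is its
  characteristic polynomial.\<close>

definition pf :: "nat \<Rightarrow> (nat \<Rightarrow> 'r) \<Rightarrow> 'r::comm_ring_1 lmap \<Rightarrow> 'r lmap" where
  "pf n c X = X ^ n * JJ n - pz n X c"

lemma pf_companion:
  assumes C: "companion n C" and n: "n > 0" shows "pf n (\<lambda>i. ent C i (n - 1)) C = 0"
proof -
  have "C ^ n * JJ n = pz n C (\<lambda>i. ent C i (n - 1))"
  proof (rule ZC_eq[OF C])
    fix i assume "i < n"
    obtain k where k: "n = Suc k" using n by (cases n) auto
    have "ap (C ^ n * JJ n) (unitv 0) = ap C (ap (C ^ k * JJ n) (unitv 0))"
      using n by (simp add: k ap_mult)
    also have "\<dots> = ap C (unitv k)" using companion_pow_JJ[OF C, of k 0] k by simp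
    finally have "ent (C ^ n * JJ n) i 0 = ent C i k" by (simp add: ent_def)
    moreover have "n - 1 = k" using k by simp
    ultimately show "ent (C ^ n * JJ n) i 0 = ent (pz n C (\<lambda>i. ent C i (n - 1))) i 0"
      using \<open>i < n\<close> by (simp add: ent_pz[OF C])
  qed (use C companion_Mn pow_ZC pz_ZC in blast)+
  then show ?thesis by (simp add: pf_def)
qed

lemma pf_intertwine:
  assumes X: "X \<in> Mn n" and Y: "Y \<in> Mn n" and g: "g \<in> Gn n" and k: "scl \<kappa> (X * g - g * Y) = 0"
  shows "scl \<kappa> (pf n c X * g) = scl \<kappa> (g * pf n c Y)"
proof -
  have gJ: "g * JJ n = JJ n * g"
  proof -
    have "(g - 1) * JJ n = JJ n * (g - 1)" using Mn_JJ[OF Gn_minus_one[OF g]] by simp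
    then show ?thesis by (simp add: algebra_simps)
  qed
  have k': "scl \<kappa> (X * g) = scl \<kappa> (g * Y)" using k by (simp add: scl_distribs)
  have p: "scl \<kappa> (X ^ i * g) = scl \<kappa> (g * Y ^ i)" for i
  proof (induction i)
    case (Suc i)
    have "scl \<kappa> (X ^ Suc i * g) = X * scl \<kappa> (X ^ i * g)" by (simp add: mult.assoc)
    also have "\<dots> = scl \<kappa> (X * g) * Y ^ i" unfolding Suc by (simp add: mult.assoc)
    also have "\<dots> = scl \<kappa> (g * Y ^ Suc i)" unfolding k' by (simp add: mult.assoc)
    finally show ?case .
  qed simp
  have q: "scl \<kappa> (X ^ i * JJ n * g) = scl \<kappa> (g * (Y ^ i * JJ n))" for i
  proof -
    have "scl \<kappa> (X ^ i * JJ n * g) = scl \<kappa> (X ^ i * g) * JJ n" by (simp add: gJ mult.assoc)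
    then show ?thesis unfolding p by (simp add: mult.assoc)
  qed
  have "scl \<kappa> (pz n X c * g) = (\<Sum>i<n. scl (c i) (scl \<kappa> (X ^ i * JJ n * g)))"
    by (simp add: pz_def sum_distrib_right scl_sum mult.commute)
  also have "\<dots> = scl \<kappa> (g * pz n Y c)"
    unfolding q by (simp add: pz_def sum_distrib_left scl_sum mult.commute)
  finally show ?thesis using q[of n] by (simp add: pf_def left_diff_distrib right_diff_distrib scl_distribs)
qed

text \<open>The first column of the polynomial evaluated at \<open>C'\<close> is the last column of
  \<open>C'\<close> minus that of \<open>C\<close>.\<close>

lemma companion_eq_mod:
  assumes C: "companion n C" and C': "companion n C'" and n: "n > 0"
    and k: "scl \<kappa> (pf n (\<lambda>i. ent C i (n - 1)) C') = 0"
  shows "scl \<kappa> C = scl \<kappa> C'"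
proof (rule Mn_eqI[of _ n])
  fix i j assume i: "i < n" and j: "j < n"
  show "ent (scl \<kappa> C) i j = ent (scl \<kappa> C') i j"
  proof (cases "Suc j < n")
    case True
    then show ?thesis using C C' by (simp add: ent_companion)
  next
    case False
    obtain q where q: "n = Suc q" using n by (cases n) auto
    have jq: "j = q" using False j q by simp
    have "ap (C' ^ n * JJ n) (unitv 0) = ap C' (ap (C' ^ q * JJ n) (unitv 0))"
      by (simp add: q ap_mult)
    also have "\<dots> = ap C' (unitv q)" using companion_pow_JJ[OF C', of q 0] q by simp
    finally have "ent (C' ^ n * JJ n) i 0 = ent C' i q" by (simp add: ent_def)
    moreover have "ent (scl \<kappa> (pf n (\<lambda>i. ent C i (n - 1)) C')) i 0 = 0" using k by simp
    moreover have "n - 1 = q" using q by simp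
    ultimately show ?thesis using i by (simp add: pf_def ent_pz[OF C'] jq algebra_simps)
  qed
qed (use C C' companion_Mn in blast)+

text \<open>Right multiplication by \<open>C\<close> shifts columns, so the diagonal of
  \<open>a * C\<close> is the superdiagonal of \<open>a\<close>. This is the link between companion
  matrices and the standard Whittaker character.\<close>

lemma mtr_companion_nn:
  assumes C: "companion n C" and a: "a \<in> nn n" shows "mtr n (C * a) = sd n a"
proof -
  have Cm: "C \<in> Mn n" using C companion_Mn by blast
  have "mtr n (C * a) = mtr n (a * C)" using Cm a nn_Mn mtr_commute by blast
  also have "\<dots> = (\<Sum>i<n. if Suc i < n then ent a i (Suc i) else 0)"
    unfolding mtr_def
  proof (rule sum.cong)
    fix i assume i: "i \<in> {..<n}"
    show "ent (a * C) i i = (if Suc i < n then ent a i (Suc i) else 0)"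
    proof (cases "Suc i < n")
      case True
      then show ?thesis using C by (simp add: ent_def ap_mult companion_def)
    next
      case False
      then have "ent a i k = 0" if "k < n" for k using a i that by (auto simp: nn_def)
      then show ?thesis using False by (simp add: ent_mult[OF Cm])
    qed
  qed auto
  also have "\<dots> = sd n a"
    unfolding sd_def by (rule sum.mono_neutral_cong_right) auto
  finally show ?thesis .
qed

lemma ent_companion_mult:
  assumes C: "companion n C" and b: "b \<in> Mn n" and i: "0 < i" "i < n"
  shows "ent (C * b) i j = ent b (i - 1) j + ent C i (n - 1) * ent b (n - 1) j"
proof -
  obtain q where q: "n = Suc q" using i by (cases n) auto
  have "ent (C * b) i j = (\<Sum>k<q. ent C i k * ent b k j) + ent C i q * ent b q j"
    by (simp add: ent_mult[OF b] q)
  also have "(\<Sum>k<q. ent C i k * ent b k j) = (\<Sum>k<q. if k = i - 1 then ent b k j else 0)"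
    using C i by (intro sum.cong) (auto simp: ent_companion q)
  also have "\<dots> = ent b (i - 1) j" using i q by auto
  finally show ?thesis by (simp add: q)
qed

text \<open>The dual form of cyclicity: row i of \<open>C * r\<close> is row i - 1 of
  \<open>r\<close> plus a multiple of the last row, and it equals row i of \<open>r * C\<close>, so
  vanishing climbs from the bottom row to the top.\<close>

lemma ZC_last_row:
  assumes C: "companion n C" and r: "r \<in> ZC n C" and 0: "\<And>j. j < n \<Longrightarrow> ent r (n - 1) j = 0"
  shows "r = 0"
proof (rule Mn_eqI[of _ n])
  have "\<forall>j<n. ent r (n - 1 - k) j = 0" for k
  proof (induction k)
    case (Suc k)
    show ?case
    proof (cases "n - 1 - k = 0")
      case False
      then have i: "0 < n - 1 - k" "n - 1 - k < n" by auto
      show ?thesis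
      proof (intro allI impI)
        fix j assume j: "j < n"
        have "ent (C * r) (n - 1 - k) j = ent (r * C) (n - 1 - k) j" using r by (simp add: ZC_def)
        also have "\<dots> = 0" using Suc companion_Mn[OF C] by (simp add: ent_mult)
        finally show "ent r (n - 1 - Suc k) j = 0"
          using ent_companion_mult[OF C ZC_Mn[OF r] i, of j] 0 j by simp
      qed
    qed (use Suc in simp)
  qed (use 0 in simp)
  then show "ent r i j = ent 0 i j" if "i < n" "j < n" for i j
    using that by (metis Suc_diff_1 diff_diff_cancel ent_simps(1) less_Suc_eq_le less_nat_zero_code linorder_neqE_nat)
qed (use r ZC_Mn in auto)

context trunc
begin

subsection \<open>The polarization attached to a companion matrix\<close>

text \<open>For even l the last summand is already all of \<open>A\<close>; the polarization is a
  proper choice only for odd l.\<close>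

definition LL :: "'r lmap \<Rightarrow> 'r lmap set" where
  "LL C = {a + r + scl (\<pi> ^ h) y | a r y. a \<in> nn n \<and> r \<in> ZC n C \<and> y \<in> A}"

lemma LL_I: "a \<in> nn n \<Longrightarrow> r \<in> ZC n C \<Longrightarrow> y \<in> A \<Longrightarrow> a + r + scl (\<pi> ^ h) y \<in> LL C"
  unfolding LL_def by blast

lemma LL_E:
  assumes "w \<in> LL C"
  obtains a r y where "a \<in> nn n" "r \<in> ZC n C" "y \<in> A" "w = a + r + scl (\<pi> ^ h) y"
  using assms unfolding LL_def by blast

lemma LL_A: "w \<in> LL C \<Longrightarrow> w \<in> A"
  by (elim LL_E) (auto intro: nn_Mn ZC_Mn)

lemma LL_sub: "a \<in> nn n \<Longrightarrow> a \<in> LL C" "r \<in> ZC n C \<Longrightarrow> r \<in> LL C" "y \<in> A \<Longrightarrow> scl (\<pi> ^ h) y \<in> LL C"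
  using LL_I[of a 0 C 0] LL_I[of 0 r C 0] LL_I[of 0 0 C y] by auto

lemma LL_closed [simp, intro]:
  "0 \<in> LL C" "w \<in> LL C \<Longrightarrow> w' \<in> LL C \<Longrightarrow> w + w' \<in> LL C"
  "w \<in> LL C \<Longrightarrow> - w \<in> LL C"
proof -
  show "0 \<in> LL C" using LL_sub(1)[of 0] by auto
  show "w + w' \<in> LL C" if w: "w \<in> LL C" "w' \<in> LL C"
  proof -
    obtain a r y a' r' y' where "a \<in> nn n" "r \<in> ZC n C" "y \<in> A" "w = a + r + scl (\<pi> ^ h) y"
      "a' \<in> nn n" "r' \<in> ZC n C" "y' \<in> A" "w' = a' + r' + scl (\<pi> ^ h) y'"
      using w by (elim LL_E) blast
    then show ?thesis using LL_I[of "a + a'" "r + r'" C "y + y'"] by (auto simp: scl_distribs algebra_simps)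
  qed
  show "- w \<in> LL C" if w: "w \<in> LL C"
  proof -
    obtain a r y where "a \<in> nn n" "r \<in> ZC n C" "y \<in> A" "w = a + r + scl (\<pi> ^ h) y"
      using w by (elim LL_E) blast
    then show ?thesis using LL_I[of "- a" "- r" C "- y"] by (auto simp: scl_distribs algebra_simps)
  qed
qed

lemma LL_minus [simp, intro]: "w \<in> LL C \<Longrightarrow> w' \<in> LL C \<Longrightarrow> w - w' \<in> LL C"
  using LL_closed(2)[of w C "- w'"] by auto

lemma finite_LL [simp]: "finite (LL C)"
  by (rule finite_subset[of _ A]) (use LL_A in auto)

lemma LL_m: "d \<in> A \<Longrightarrow> scl (c * \<pi> ^ m) d \<in> LL C"
  using LL_sub(3)[of "scl (c * \<pi> ^ (m - h)) d" C] mMh(5)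
  by (simp add: mult.left_commute flip: power_add)

lemma LL_m': "d \<in> A \<Longrightarrow> scl (\<pi> ^ m) d \<in> LL C"
  using LL_m[of d 1] by simp

lemma mtr_bracket_ZC:
  assumes "C \<in> A" "x \<in> A" "r \<in> ZC n C" shows "mtr n (C * (x * r - r * x)) = 0"
proof -
  have "mtr n ((C * x) * r) = mtr n (r * (C * x))"
    using assms ZC_Mn by (intro mtr_commute) blast+
  also have "r * (C * x) = C * r * x" using assms by (simp add: ZC_def flip: mult.assoc)
  finally show ?thesis by (simp add: right_diff_distrib mult.assoc)
qed

text \<open>The centralizer is in the radical of the form \<open>om\<close>; products of strictly
  upper triangular matrices have no superdiagonal, so \<open>om\<close> vanishes on
  \<open>nn n\<close>; whatever involves \<open>\<pi> ^ h\<close> is killed since 2m + h =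
  l.\<close>

lemma LL_isotropic:
  assumes C: "companion n C" and w: "w \<in> LL C" "w' \<in> LL C"
  shows "\<pi> ^ m * (\<pi> ^ m * mtr n (C * (w * w' - w' * w))) = 0"
proof -
  define om where "om x x' = mtr n (C * (x * x' - x' * x))" for x x'
  have add: "om (x + z) x' = om x x' + om z x'" "om x' (x + z) = om x' x + om x' z" for x x' z
    by (simp_all add: om_def algebra_simps)
  have sc: "om (scl c x) x' = c * om x x'" "om x' (scl c x) = c * om x' x" for c x x'
    by (simp_all add: om_def algebra_simps flip: scl_distribs)
  have Cm: "C \<in> A" using C companion_Mn by blast
  have r: "om x r = 0" "om r x = 0" if "x \<in> A" "r \<in> ZC n C" for x r
    using mtr_bracket_ZC[OF Cm that] by (simp_all add: om_def right_diff_distrib)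
  have a: "om a a' = 0" if "a \<in> nn n" "a' \<in> nn n" for a a'
    using that by (simp add: om_def mtr_companion_nn[OF C] sd_nn_mult)
  obtain a r y a' r' y' where *: "a \<in> nn n" "r \<in> ZC n C" "y \<in> A" "w = a + r + scl (\<pi> ^ h) y"
      "a' \<in> nn n" "r' \<in> ZC n C" "y' \<in> A" "w' = a' + r' + scl (\<pi> ^ h) y'"
      using w by (elim LL_E) blast
  have "om w w' = \<pi> ^ h * (om a y' + om y a' + \<pi> ^ h * om y y')"
    using * nn_Mn[OF *(1)] nn_Mn[OF *(5)] ZC_Mn[OF *(2)] ZC_Mn[OF *(6)] by (simp add: add sc r a algebra_simps)
  then have "\<pi> ^ m * (\<pi> ^ m * om w w') = \<pi> ^ m * ((\<pi> ^ m * \<pi> ^ h) * (om a y' + om y a' + \<pi> ^ h * om y y'))"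
    by (simp only: mult.assoc)
  then show ?thesis by (simp only: pi_mM flip: om_def)
qed

text \<open>A congruence of \<open>C\<close> and \<open>C'\<close> modulo \<open>\<pi> ^ m\<close>
  changes polynomials in \<open>C\<close> only by multiples of \<open>\<pi> ^ m\<close>, which lie
  in the polarization because h <= m.\<close>

lemma LL_mod:
  assumes C: "companion n C" and C': "companion n C'" and eq: "scl (\<pi> ^ M) C = scl (\<pi> ^ M) C'"
  shows "LL C = LL C'"
proof -
  have *: "LL C \<subseteq> LL C'" if C: "companion n C" and C': "companion n C'"
    and eq: "scl (\<pi> ^ M) C = scl (\<pi> ^ M) C'" for C C'
  proof
    fix w assume "w \<in> LL C"
    then obtain a r y where w: "a \<in> nn n" "r \<in> ZC n C" "y \<in> A" "w = a + r + scl (\<pi> ^ h) y"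
      by (elim LL_E)
    define z where "z = (\<lambda>i. ent r i 0)"
    have r: "r = pz n C z" using ZC_pz[OF C w(2)] by (simp add: z_def)
    have p: "scl (\<pi> ^ M) (C ^ i * JJ n) = scl (\<pi> ^ M) (C' ^ i * JJ n)" for i
    proof (induction i)
      case (Suc i)
      have "scl (\<pi> ^ M) (C ^ Suc i * JJ n) = C * scl (\<pi> ^ M) (C ^ i * JJ n)" by (simp add: mult.assoc)
      also have "\<dots> = scl (\<pi> ^ M) C * (C' ^ i * JJ n)" unfolding Suc by simp
      finally show ?case unfolding eq by (simp add: mult.assoc)
    qed simp
    have "scl (\<pi> ^ M) (pz n C z) = (\<Sum>i<n. scl (z i) (scl (\<pi> ^ M) (C ^ i * JJ n)))"
      by (simp add: pz_def scl_sum mult.commute)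
    also have "\<dots> = scl (\<pi> ^ M) (pz n C' z)"
      unfolding p by (simp add: pz_def scl_sum mult.commute)
    finally have 0: "scl (\<pi> ^ M) (r - pz n C' z) = 0" by (simp add: r scl_distribs)
    have rA: "r - pz n C' z \<in> A" using w(2) C' companion_Mn ZC_Mn by blast
    have "M \<le> l" using mMh by simp
    then obtain x where x: "x \<in> A" "r - pz n C' z = scl (\<pi> ^ (l - M)) x"
      using Mn_ann[OF rA _ 0] by blast
    have lM: "l - M = m" using mMh by simp
    have "w = (a + pz n C' z + scl (\<pi> ^ h) y) + (r - pz n C' z)" by (simp add: w(4))
    also have "\<dots> = (a + pz n C' z + scl (\<pi> ^ h) y) + scl (\<pi> ^ m) x" unfolding x(2) lM ..
    also have "\<dots> \<in> LL C'"
      using LL_closed(2)[OF LL_I[OF w(1) pz_ZC[OF companion_Mn[OF C']] w(3)] LL_m'[OF x(1)]] .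
    finally show "w \<in> LL C'" .
  qed
  show ?thesis using *[OF C C' eq] *[OF C' C eq[symmetric]] by blast
qed

text \<open>The directions in which a companion matrix can vary. The trace pairs them perfectly with
  the centralizer, as the two annihilator lemmas below show.\<close>

definition BB :: "'r lmap set" where
  "BB = {b \<in> A. \<forall>i j. j \<noteq> n - 1 \<longrightarrow> ent b i j = 0}"

lemma BB_A: "b \<in> BB \<Longrightarrow> b \<in> A" by (simp add: BB_def)

lemma BB_closed [intro]: "0 \<in> BB" "b \<in> BB \<Longrightarrow> b' \<in> BB \<Longrightarrow> b + b' \<in> BB" "b \<in> BB \<Longrightarrow> b' \<in> BB \<Longrightarrow> b - b' \<in> BB"
  by (auto simp: BB_def)

lemma finite_BB [simp]: "finite BB"
  by (rule finite_subset[of _ A]) (use BB_A in auto)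

lemma companion_BB:
  assumes C: "companion n C" and b: "b \<in> BB" shows "companion n (C + scl c b)"
proof -
  have "ap b (unitv j) i = 0" if "Suc j < n" for i j using b that by (auto simp: BB_def simp flip: ent_def)
  then show ?thesis using C b by (auto simp: companion_def BB_A fun_eq_iff)
qed

lemma companion_diff_BB: "companion n C \<Longrightarrow> companion n C' \<Longrightarrow> C - C' \<in> BB"
proof -
  assume C: "companion n C" "companion n C'"
  have "ent (C - C') i j = 0" if "j \<noteq> n - 1" for i j
  proof (cases "j < n")
    case True
    then have "Suc j < n" using that by simp
    then show ?thesis using C by (simp add: ent_companion)
  next
    case False
    then show ?thesis using C companion_Mn by (intro ent_out[of _ n]) blast+
  qed
  then show ?thesis using C companion_Mn unfolding BB_def by blast
qed

text \<open>Pairing with elementary matrices of the last column reads off the last row of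
  \<open>r\<close>, which determines \<open>r\<close>.\<close>

lemma BB_sum_ann:
  assumes C: "companion n C" and r: "r \<in> ZC n C" and *: "\<And>b. b \<in> BB \<Longrightarrow> Psi (scl \<kappa> (b * r)) = 1"
  shows "scl \<kappa> r = 0"
proof (rule ZC_last_row[OF C])
  fix j assume j: "j < n"
  have "\<phi> ((\<kappa> * ent r (n - 1) j) * c) = 1" for c
  proof -
    have b: "eij n j (n - 1) c \<in> BB" by (auto simp: BB_def ent_eij)
    have "mtr n (eij n j (n - 1) c * r) = mtr n (r * eij n j (n - 1) c)"
      using r ZC_Mn by (intro mtr_commute) auto
    also have "\<dots> = c * ent r (n - 1) j" using j by (intro mtr_eij) auto
    finally show ?thesis using *[OF b] by (simp add: Psi_def mult_ac)
  qed
  then have "\<kappa> * ent r (n - 1) j = 0" by (rule phi_nondeg)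
  then show "ent (scl \<kappa> r) (n - 1) j = 0" by simp
qed (use r in auto)

text \<open>Pairing \<open>b\<close> with the powers of \<open>C\<close> gives a triangular system
  for the last column of \<open>b\<close>: the last row of \<open>C ^ k\<close> has a 1 in position
  n - 1 - k and zeros before it.\<close>

lemma BB_ZC_ann:
  assumes C: "companion n C" and b: "b \<in> BB" and *: "\<And>r. r \<in> ZC n C \<Longrightarrow> Psi (scl \<kappa> (b * r)) = 1"
  shows "scl \<kappa> b = 0"
proof (rule Mn_eqI[of _ n])
  have bA: "b \<in> A" using b BB_A by blast
  have Cm: "C \<in> A" using C companion_Mn by blast
  have z: "\<kappa> * (\<Sum>i<n. ent (C ^ k * JJ n) (n - 1) i * ent b i (n - 1)) = 0" for k
  proof -
    define X where "X = C ^ k * JJ n"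
    have XZ: "X \<in> ZC n C" unfolding X_def using Cm pow_ZC by blast
    have XA: "X \<in> A" using XZ ZC_Mn by blast
    have "mtr n (b * X) = mtr n (X * b)" using bA XA mtr_commute by blast
    also have "\<dots> = (\<Sum>i<n. if i = n - 1 then ent (X * b) i i else 0)"
      unfolding mtr_def using b by (intro sum.cong) (auto simp: ent_mult[OF bA] BB_def)
    also have "\<dots> = (\<Sum>i<n. ent X (n - 1) i * ent b i (n - 1))"
      using n0 by (simp add: ent_mult[OF bA])
    finally have t: "mtr n (b * X) = (\<Sum>i<n. ent X (n - 1) i * ent b i (n - 1))" .
    have "\<phi> ((\<kappa> * mtr n (b * X)) * c) = 1" for c
      using *[of "scl c X"] XZ by (simp add: Psi_def mult_ac)
    then have "\<kappa> * mtr n (b * X) = 0" by (rule phi_nondeg)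
    then show ?thesis unfolding t unfolding X_def .
  qed
  have k: "\<kappa> * ent b (n - 1 - k) (n - 1) = 0" if "k < n" for k
    using that
  proof (induction k rule: less_induct)
    case (less k)
    define q where "q = n - 1 - k"
    have qn: "q < n" "k + q = n - 1" using less(2) by (auto simp: q_def)
    have "\<kappa> * (ent (C ^ k * JJ n) (n - 1) i * ent b i (n - 1)) = (if i = q then \<kappa> * ent b q (n - 1) else 0)"
      if i: "i < n" for i
    proof (cases "i \<le> q")
      case True
      then have "ap (C ^ k * JJ n) (unitv i) = unitv (k + i)"
        using qn by (intro companion_pow_JJ[OF C]) auto
      then have "ent (C ^ k * JJ n) (n - 1) i = (if i = q then 1 else 0)"
        using qn True by (auto simp: ent_def unitv_def)
      then show ?thesis by simp
    next
      case False
      define k2 where "k2 = n - 1 - i"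
      have "k2 < k" "i = n - 1 - k2" using False i qn by (auto simp: k2_def q_def)
      then have "\<kappa> * ent b i (n - 1) = 0" using less by auto
      then have "\<kappa> * (ent (C ^ k * JJ n) (n - 1) i * ent b i (n - 1)) = 0"
        by (metis mult.left_commute mult_zero_right)
      then show ?thesis using False by simp
    qed
    then have "\<kappa> * (\<Sum>i<n. ent (C ^ k * JJ n) (n - 1) i * ent b i (n - 1)) = (\<Sum>i<n. if i = q then \<kappa> * ent b q (n - 1) else 0)"
      unfolding sum_distrib_left by (intro sum.cong) auto
    then show ?case using z[of k] qn by (simp add: q_def)
  qed
  show "ent (scl \<kappa> b) i j = ent 0 i j" if "i < n" "j < n" for i j
  proof (cases "j = n - 1")
    case True
    then show ?thesis using k[of "n - 1 - i"] that by simp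
  next
    case False
    then show ?thesis using b by (simp add: BB_def)
  qed
qed (use b BB_A in auto)

text \<open>Maximality of the polarization; orthogonality to \<open>nn n\<close> alone suffices. The
  hypothesis says that the commutator of \<open>C\<close> with \<open>w0\<close> vanishes strictly
  below the diagonal modulo \<open>\<pi> ^ h\<close>.\<close>

lemma LL_selfdual:
  assumes C: "companion n C" and w0: "w0 \<in> A"
    and *: "\<And>a. a \<in> nn n \<Longrightarrow> Psi (scl (\<pi> ^ (2 * m)) (C * w0 - w0 * C) * a) = 1"
  shows "w0 \<in> LL C"
proof -
  define \<kappa> where "\<kappa> = \<pi> ^ (2 * m)"
  define K where "K = C * w0 - w0 * C"
  have Cm: "C \<in> A" using C companion_Mn by blast
  have K: "\<kappa> * ent K j i = 0" if ij: "i < j" "j < n" for i j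
  proof -
    have "\<phi> (\<kappa> * ent K j i * c) = 1" for c
    proof -
      have "eij n i j c \<in> nn n" using ij by (auto simp: nn_def ent_eij)
      then have "Psi (scl \<kappa> K * eij n i j c) = 1" using * by (simp add: \<kappa>_def K_def)
      then show ?thesis using mtr_eij[of j n i "scl \<kappa> K" c] ij by (simp add: Psi_def mult_ac)
    qed
    then show ?thesis by (rule phi_nondeg)
  qed
  \<comment> \<open>\<open>r\<close> is the centralizer element with the first column of
    \<open>w0\<close>. For the difference \<open>w\<close>, the relation \<open>wK\<close> expresses
    column i + 1 through column i, so the part on and below the diagonal is annihilated column by
    column.\<close>
  define r where "r = pz n C (\<lambda>i. ent w0 i 0)"
  have r: "r \<in> ZC n C" unfolding r_def using Cm pz_ZC by blast
  define w where "w = w0 - r"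
  have wA: "w \<in> A" using w0 r ZC_Mn by (auto simp: w_def)
  have wK: "w * C = C * w - K" using r by (simp add: w_def K_def ZC_def algebra_simps)
  have w: "\<kappa> * ent w j i = 0" if "i \<le> j" "j < n" for i j
    using that
  proof (induction i arbitrary: j)
    case 0
    then show ?case by (simp add: w_def r_def ent_pz[OF C])
  next
    case (Suc i)
    have "ent w j (Suc i) = ent (w * C) j i"
      using C Suc by (simp add: ent_def ap_mult companion_def)
    also have "\<dots> = ent w (j - 1) i + ent C j (n - 1) * ent w (n - 1) i - ent K j i"
      unfolding wK using Suc by (simp add: ent_companion_mult[OF C wA])
    finally have e: "ent w j (Suc i) = ent w (j - 1) i + ent C j (n - 1) * ent w (n - 1) i - ent K j i" .
    have "\<kappa> * ent w j (Suc i) = \<kappa> * ent w (j - 1) i + ent C j (n - 1) * (\<kappa> * ent w (n - 1) i) - \<kappa> * ent K j i"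
      unfolding e by (simp add: right_diff_distrib distrib_left mult.left_commute)
    also have "\<dots> = 0" using Suc(1)[of "j - 1"] Suc(1)[of "n - 1"] K[of i j] Suc(2,3) by simp
    finally show ?case .
  qed
  define a where "a = mk n (\<lambda>i j. if j \<le> i then 0 else ent w i j)"
  have a: "a \<in> nn n" by (auto simp: nn_def a_def ent_mk)
  have "scl \<kappa> (w - a) = 0"
    by (rule Mn_eqI[of _ n]) (use w wA a nn_Mn in \<open>auto simp: a_def ent_mk\<close>)
  then have 0: "scl (\<pi> ^ (2 * m)) (w - a) = 0" by (simp only: \<kappa>_def)
  have waA: "w - a \<in> A" using wA nn_Mn[OF a] by blast
  have "2 * m \<le> l" using mMh by simp
  then obtain y where y: "y \<in> A" "w - a = scl (\<pi> ^ (l - 2 * m)) y"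
    using Mn_ann[OF waA _ 0] by blast
  have "l - 2 * m = h" using mMh by simp
  then have "w0 = a + r + scl (\<pi> ^ h) y" using y(2) by (simp add: w_def algebra_simps)
  then show ?thesis using LL_I[OF a r y(1)] by simp
qed

lemma Psi_conj: "z \<in> G \<Longrightarrow> p \<in> A \<Longrightarrow> a \<in> A \<Longrightarrow> Psi (z * p * ginv z * a) = Psi (p * (ginv z * a * z))"
  using mtr_conj[of z n "p * (ginv z * a * z)"] by (simp add: Psi_def mult.assoc)

text \<open>The orthogonal of the intersection of \<open>LL C\<close> with a conjugate is the sum of
  the two. By duality it suffices to consider \<open>x\<close> orthogonal to the sum; such an
  \<open>x\<close> is \<open>\<pi> ^ (2 * m)\<close> times a commutator of \<open>C\<close> with
  some \<open>b\<close>, and \<open>LL_selfdual\<close> places \<open>b\<close> and its conjugate in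
  \<open>LL C\<close>.\<close>

lemma LL_conj_sum:
  assumes C: "companion n C" and z: "z \<in> G" "z * C = C * z" and y: "y \<in> A"
    and *: "\<And>w. w \<in> LL C \<Longrightarrow> z * w * ginv z \<in> LL C \<Longrightarrow> Psi (scl (\<pi> ^ (2 * m)) (C * w - w * C) * y) = 1"
  obtains w1 w2 where "w1 \<in> LL C" "w2 \<in> LL C" "y = ginv z * w1 * z + w2"
proof -
  define D where "D = {ginv z * w1 * z + w2 | w1 w2. w1 \<in> LL C \<and> w2 \<in> LL C}"
  have Cm: "C \<in> A" using C companion_Mn by blast
  have DI: "ginv z * w1 * z + w2 \<in> D" if "w1 \<in> LL C" "w2 \<in> LL C" for w1 w2
    using that by (auto simp: D_def)
  have D2: "w \<in> D" "ginv z * w * z \<in> D" if "w \<in> LL C" for w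
    using DI[of 0 w] DI[of w 0] that by auto
  have lm: "l - h = 2 * m" "l - 2 * m = h" "h \<le> l" "2 * m \<le> l" using mMh by auto
  have "y \<in> D"
  proof (rule double_annihilator)
    show "D \<subseteq> A" using LL_A z by (auto simp: D_def)
    show "0 \<in> D" using D2(1)[of 0] by simp
    show "x + y \<in> D" "x - y \<in> D" if xy: "x \<in> D" "y \<in> D" for x y
    proof -
      obtain w1 w2 where w: "w1 \<in> LL C" "w2 \<in> LL C" "x = ginv z * w1 * z + w2"
        using xy(1) unfolding D_def by blast
      obtain v1 v2 where v: "v1 \<in> LL C" "v2 \<in> LL C" "y = ginv z * v1 * z + v2"
        using xy(2) unfolding D_def by blast
      have "x + y = ginv z * (w1 + v1) * z + (w2 + v2)" "x - y = ginv z * (w1 - v1) * z + (w2 - v2)"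
        unfolding v(3) w(3) by (simp_all add: algebra_simps)
      then show "x + y \<in> D" "x - y \<in> D"
        using DI[OF LL_closed(2)[OF w(1) v(1)] LL_closed(2)[OF w(2) v(2)]]
          DI[OF LL_minus[OF w(1) v(1)] LL_minus[OF w(2) v(2)]] by simp_all
    qed
    fix x assume x: "x \<in> A" "\<And>d. d \<in> D \<Longrightarrow> Psi (x * d) = 1"
    have "scl (\<pi> ^ h) x = 0"
    proof (rule Psi_nondeg)
      fix b :: "'r lmap" assume "b \<in> A"
      then show "Psi (scl (\<pi> ^ h) x * b) = 1"
        using x(2)[OF D2(1)[OF LL_sub(3)[of b]]] by simp
    qed (use x in auto)
    then obtain x0 where x0: "x0 \<in> A" "x = scl (\<pi> ^ (2 * m)) x0"
      using Mn_ann[OF x(1), of h] lm by auto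
    \<comment> \<open>\<open>x0\<close> matters only modulo \<open>\<pi> ^ h\<close>, so the
      commutators with \<open>C\<close> are enlarged accordingly. What is orthogonal to
      \<open>Q\<close> centralizes \<open>C\<close> and is divisible by
      \<open>\<pi> ^ (2 * m)\<close>, and \<open>x\<close> is orthogonal to the centralizer.\<close>
    define Q where "Q = {(C * b - b * C) + scl (\<pi> ^ h) b' | b b'. b \<in> A \<and> b' \<in> A}"
    have QI: "(C * b - b * C) + scl (\<pi> ^ h) b' \<in> Q" if "b \<in> A" "b' \<in> A" for b b'
      using that unfolding Q_def by blast
    have "x0 \<in> Q"
    proof (rule double_annihilator)
      show "Q \<subseteq> A" using Cm by (auto simp: Q_def)
      show "0 \<in> Q" using QI[of 0 0] by simp
      show "x + y \<in> Q" "x - y \<in> Q" if xy: "x \<in> Q" "y \<in> Q" for x y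
      proof -
        obtain b b' where w: "b \<in> A" "b' \<in> A" "x = (C * b - b * C) + scl (\<pi> ^ h) b'"
          using xy(1) unfolding Q_def by blast
        obtain c c' where v: "c \<in> A" "c' \<in> A" "y = (C * c - c * C) + scl (\<pi> ^ h) c'"
          using xy(2) unfolding Q_def by blast
        have "x + y = (C * (b + c) - (b + c) * C) + scl (\<pi> ^ h) (b' + c')"
          "x - y = (C * (b - c) - (b - c) * C) + scl (\<pi> ^ h) (b' - c')"
          unfolding v(3) w(3) by (simp_all add: algebra_simps scl_distribs)
        then show "x + y \<in> Q" "x - y \<in> Q"
          using QI[OF Mn_closed(2)[OF w(1) v(1)] Mn_closed(2)[OF w(2) v(2)]]
            QI[OF Mn_closed(3)[OF w(1) v(1)] Mn_closed(3)[OF w(2) v(2)]] by simp_all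
      qed
      fix x' assume x': "x' \<in> A" "\<And>d. d \<in> Q \<Longrightarrow> Psi (x' * d) = 1"
      have "x' * C - C * x' = 0"
      proof (rule Psi_nondeg)
        fix b :: "'r lmap" assume b: "b \<in> A"
        have "mtr n ((x' * b) * C) = mtr n (C * (x' * b))" using x' b Cm by (intro mtr_commute) auto
        then have "mtr n ((x' * C - C * x') * b) = mtr n (x' * (C * b - b * C))"
          by (simp add: algebra_simps)
        then show "Psi ((x' * C - C * x') * b) = 1"
          using x'(2)[OF QI[OF b Mn_closed(1)]] by (simp add: Psi_def)
      qed (use x' Cm in auto)
      then have xZ: "x' \<in> ZC n C" using x' by (simp add: ZC_def)
      have "scl (\<pi> ^ h) x' = 0"
      proof (rule Psi_nondeg)
        fix b :: "'r lmap" assume "b \<in> A"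
        then show "Psi (scl (\<pi> ^ h) x' * b) = 1"
          using x'(2)[OF QI[of 0 b]] by simp
      qed (use x' in auto)
      then obtain r0 where r0: "r0 \<in> A" "x' = scl (\<pi> ^ (2 * m)) r0"
        using Mn_ann[OF x'(1), of h] lm by auto
      \<comment> \<open>Divisibility is realized inside the centralizer by the element with the
        first column of \<open>r0\<close>.\<close>
      define r where "r = pz n C (\<lambda>i. ent r0 i 0)"
      have r: "r \<in> ZC n C" unfolding r_def using Cm pz_ZC by blast
      have "x' = scl (\<pi> ^ (2 * m)) r"
        by (rule ZC_eq[OF C xZ]) (use r r0 in \<open>auto simp: r_def ent_pz[OF C]\<close>)
      then have "Psi (x' * x0) = Psi (r * x)" by (simp add: x0)
      also have "\<dots> = Psi (x * r)" using r ZC_Mn x(1) Psi_commute by blast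
      also have "\<dots> = 1" using x(2) D2(1) LL_sub(2) r by blast
      finally show "Psi (x' * x0) = 1" .
    qed (use x0 in auto)
    then obtain b b' where b: "b \<in> A" "b' \<in> A" "x0 = (C * b - b * C) + scl (\<pi> ^ h) b'"
      unfolding Q_def by blast
    have "2 * m + h = l" using mMh by simp
    then have "\<pi> ^ (2 * m) * \<pi> ^ h = 0" using pi_l by (simp flip: power_add)
    then have xb: "x = scl (\<pi> ^ (2 * m)) (C * b - b * C)"
      by (simp add: x0(2) b(3) scl_distribs)
    have 1: "b \<in> LL C"
    proof (rule LL_selfdual[OF C b(1)])
      fix a :: "'r lmap" assume "a \<in> nn n"
      then show "Psi (scl (\<pi> ^ (2 * m)) (C * b - b * C) * a) = 1"
        unfolding xb[symmetric] using x(2) D2(1) LL_sub(1) by blast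
    qed
    have 2: "z * b * ginv z \<in> LL C"
    proof (rule LL_selfdual[OF C])
      fix a :: "'r lmap" assume a: "a \<in> nn n"
      have gC: "ginv z * C = C * ginv z"
        by (metis z(1) z(2) Gn_inv(1) Gn_inv(4) mult.assoc mult.right_neutral)
      have e: "C * (z * b * ginv z) - (z * b * ginv z) * C = z * (C * b - b * C) * ginv z"
        using z(2) gC by (simp add: algebra_simps) (metis mult.assoc)
      have "Psi (scl (\<pi> ^ (2 * m)) (C * (z * b * ginv z) - (z * b * ginv z) * C) * a)
        = Psi (z * x * ginv z * a)" unfolding e xb by simp
      also have "\<dots> = Psi (x * (ginv z * a * z))" using z(1) x(1) nn_Mn[OF a] by (rule Psi_conj)
      also have "\<dots> = 1" using x(2) D2(2) LL_sub(1) a by blast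
      finally show "Psi (scl (\<pi> ^ (2 * m)) (C * (z * b * ginv z) - (z * b * ginv z) * C) * a) = 1" .
    qed (use z b in auto)
    show "Psi (x * y) = 1" using *[OF 1 2] by (simp add: xb)
  qed (use y in auto)
  then show ?thesis using that unfolding D_def by blast
qed

subsection \<open>An anti-automorphism fixing a companion matrix\<close>

text \<open>Preservation of the trace and of \<open>nn n\<close> is what makes these maps respect
  the polarization and its character.\<close>

definition antiaut :: "('r lmap \<Rightarrow> 'r lmap) \<Rightarrow> bool" where
  "antiaut \<tau> \<longleftrightarrow> (\<forall>a\<in>A. \<tau> a \<in> A) \<and> (\<forall>a\<in>A. \<forall>b\<in>A. \<tau> (a + b) = \<tau> a + \<tau> b) \<and>
     (\<forall>a\<in>A. \<forall>b\<in>A. \<tau> (a * b) = \<tau> b * \<tau> a) \<and> (\<forall>c. \<forall>a\<in>A. \<tau> (scl c a) = scl c (\<tau> a)) \<and>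
     (\<forall>a\<in>A. mtr n (\<tau> a) = mtr n a) \<and> (\<forall>a\<in>nn n. \<tau> a \<in> nn n) \<and> \<tau> (JJ n) = JJ n \<and> inj_on \<tau> A"

text \<open>Transposition in the antidiagonal; the ordinary transpose would make \<open>nn n\<close>
  lower triangular.\<close>

definition flip :: "'r lmap \<Rightarrow> 'r lmap" where
  "flip a = mk n (\<lambda>i j. ent a (n - Suc j) (n - Suc i))"

lemma ent_flip: "i < n \<Longrightarrow> j < n \<Longrightarrow> ent (flip a) i j = ent a (n - Suc j) (n - Suc i)"
  by (simp add: flip_def ent_mk)

lemma antiaut_flip: "antiaut flip"
  unfolding antiaut_def
proof (intro conjI ballI allI)
  fix a b :: "'r lmap" assume a: "a \<in> A" and b: "b \<in> A"
  show "flip (a * b) = flip b * flip a"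
  proof (rule Mn_eqI[of _ n])
    fix i j assume ij: "i < n" "j < n"
    have "ent (flip (a * b)) i j = (\<Sum>k<n. ent a (n - Suc j) k * ent b k (n - Suc i))"
      using ij by (simp add: ent_flip ent_mult[OF b])
    also have "\<dots> = (\<Sum>k<n. ent a (n - Suc j) (n - Suc k) * ent b (n - Suc k) (n - Suc i))"
      by (rule sum.nat_diff_reindex[symmetric])
    also have "\<dots> = ent (flip b * flip a) i j"
    proof -
      have "flip a \<in> A" by (simp add: flip_def)
      then show ?thesis using ij by (simp add: ent_mult[of "flip a" n] ent_flip mult.commute)
    qed
    finally show "ent (flip (a * b)) i j = ent (flip b * flip a) i j" .
  qed (auto simp: flip_def)
next
  fix a :: "'r lmap" assume a: "a \<in> A"
  have "(\<Sum>i<n. ent (flip a) i i) = (\<Sum>i<n. ent a (n - Suc i) (n - Suc i))"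
    by (simp add: ent_flip)
  also have "\<dots> = (\<Sum>i<n. ent a i i)" by (rule sum.nat_diff_reindex)
  finally show "mtr n (flip a) = mtr n a" by (simp add: mtr_def)
next
  fix a :: "'r lmap" assume a: "a \<in> nn n"
  have "ent a (n - Suc j) (n - Suc i) = 0" if "j \<le> i" for i j
    using a that by (auto simp: nn_def)
  then show "flip a \<in> nn n" by (auto simp: nn_def flip_def ent_mk)
next
  show "inj_on flip A"
  proof (rule inj_onI, rule Mn_eqI[of _ n])
    fix a b :: "'r lmap" and i j assume *: "flip a = flip b" "i < n" "j < n"
    have "ent (flip x) (n - Suc j) (n - Suc i) = ent x i j" for x
      using *(2,3) by (simp add: ent_flip)
    then show "ent a i j = ent b i j" using *(1) by metis
  qed auto
next
  show "flip (JJ n) = JJ n"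
    by (rule Mn_eqI[of _ n]) (auto simp: flip_def ent_mk JJ_def)
qed (auto simp: flip_def intro!: Mn_eqI[of _ n] simp: ent_mk)

lemma antiautD:
  assumes "antiaut \<tau>"
  shows "a \<in> A \<Longrightarrow> \<tau> a \<in> A" "a \<in> A \<Longrightarrow> b \<in> A \<Longrightarrow> \<tau> (a + b) = \<tau> a + \<tau> b"
    "a \<in> A \<Longrightarrow> b \<in> A \<Longrightarrow> \<tau> (a * b) = \<tau> b * \<tau> a" "a \<in> A \<Longrightarrow> \<tau> (scl c a) = scl c (\<tau> a)"
    "a \<in> A \<Longrightarrow> mtr n (\<tau> a) = mtr n a" "a \<in> nn n \<Longrightarrow> \<tau> a \<in> nn n" "\<tau> (JJ n) = JJ n" "inj_on \<tau> A"
    "\<tau> 0 = 0"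
  using assms unfolding antiaut_def by (blast | metis Mn_closed(1) scl_simps(5))+

lemma antiaut_pow:
  assumes \<tau>: "antiaut \<tau>" and X: "X \<in> A" shows "\<tau> (X ^ i * JJ n) = \<tau> X ^ i * JJ n"
proof (induction i)
  case 0
  then show ?case using antiautD(7)[OF \<tau>] by simp
next
  case (Suc i)
  have "\<tau> (X ^ Suc i * JJ n) = \<tau> (X * (X ^ i * JJ n))" by (simp add: mult.assoc)
  also have "\<dots> = \<tau> X ^ i * JJ n * \<tau> X"
    using antiautD(3)[OF \<tau> X pow_JJ(1)[OF X]] Suc by simp
  also have "\<dots> = \<tau> X ^ i * \<tau> X * JJ n"
    using Mn_JJ[OF antiautD(1)[OF \<tau> X]] by (simp add: mult.assoc)
  finally show ?case by (simp add: power_commutes)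
qed

lemma antiaut_sum:
  assumes "antiaut \<tau>" and "\<And>i. i \<in> K \<Longrightarrow> f i \<in> A" shows "\<tau> (\<Sum>i\<in>K. f i) = (\<Sum>i\<in>K. \<tau> (f i))"
  using assms(2)
  by (induction K rule: infinite_finite_induct) (auto simp: antiautD[OF assms(1)] Mn_sum)

lemma antiaut_pz:
  assumes \<tau>: "antiaut \<tau>" and X: "X \<in> A" shows "\<tau> (pz n X c) = pz n (\<tau> X) c"
  unfolding pz_def using pow_JJ[OF X]
  by (subst antiaut_sum[OF \<tau>]) (auto simp: antiautD(4)[OF \<tau>] antiaut_pow[OF \<tau> X])

text \<open>The transpose in the antidiagonal turns \<open>C\<close> into a Hessenberg matrix annihilated by the same
  polynomial, hence unipotently conjugate to \<open>C\<close>.\<close>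

lemma antiaut_companion:
  assumes C: "companion n C" obtains \<tau> where "antiaut \<tau>" "\<tau> C = C"
proof -
  have Cm: "C \<in> A" using C companion_Mn by blast
  define X where "X = flip C"
  have XA: "X \<in> A" using antiautD(1)[OF antiaut_flip Cm] by (simp add: X_def)
  have entX: "ent X i j = (if n - Suc j = Suc (n - Suc i) then 1 else 0)" if "i < n" "j < n" "i \<noteq> 0" for i j
    using that ent_companion[OF C, of "n - Suc i" "n - Suc j"] by (auto simp: X_def ent_flip)
  obtain u where u: "u \<in> UU n" "companion n (ginv u * X * u)"
  proof (rule Hessenberg_conj[OF XA n0])
    show "ent X (Suc j) j = 1" if "Suc j < n" for j using that by (simp add: entX Suc_diff_Suc)
    show "ent X i j = 0" if "i < n" "Suc j < i" for i j using that by (simp add: entX)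
  qed
  define C1 where "C1 = ginv u * X * u"
  have uG: "u \<in> G" and gU: "ginv u \<in> UU n" using u ginv_UU by auto
  have C1: "companion n C1" using u by (simp add: C1_def)
  define c where "c = (\<lambda>i. ent C i (n - 1))"
  have "pf n c X = flip (pf n c C)"
  proof -
    have "flip (C ^ n * JJ n - pz n C c) = flip (C ^ n * JJ n + scl (- 1) (pz n C c))" by simp
    also have "\<dots> = flip (C ^ n * JJ n) + scl (- 1) (flip (pz n C c))"
      using Cm pow_JJ[OF Cm] by (simp only: antiautD[OF antiaut_flip] pz_Mn Mn_closed)
    finally show ?thesis
      by (simp add: pf_def X_def antiaut_pow[OF antiaut_flip Cm] antiaut_pz[OF antiaut_flip Cm])
  qed
  also have "\<dots> = 0" using pf_companion[OF C n0] antiautD(9)[OF antiaut_flip] by (simp add: c_def)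
  finally have pX: "pf n c X = 0" .
  have "scl 1 (X * u - u * C1) = 0" using uG by (simp add: C1_def mult.assoc)
  from pf_intertwine[OF XA companion_Mn[OF C1] uG this, of c]
  have "u * pf n c C1 = 0" using pX by simp
  then have "pf n c C1 = 0" using Gn_inv(4)[OF uG] by (metis mult_zero_right)
  then have "scl 1 C = scl 1 C1"
    using companion_eq_mod[OF C C1 n0, of 1] by (simp add: c_def)
  then have CC1: "C1 = C" by simp
  define \<tau> where "\<tau> a = ginv u * flip a * u" for a
  have "antiaut \<tau>"
    unfolding antiaut_def
  proof (intro conjI ballI allI)
    fix a :: "'r lmap" assume a: "a \<in> A"
    show "\<tau> a \<in> A" using uG antiautD(1)[OF antiaut_flip a] by (auto simp: \<tau>_def)
    show "\<tau> (scl c a) = scl c (\<tau> a)" for c by (simp add: \<tau>_def antiautD(4)[OF antiaut_flip a])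
    show "mtr n (\<tau> a) = mtr n a"
      using mtr_conj[OF ginv_Gn[OF uG] antiautD(1)[OF antiaut_flip a]] uG
      by (simp add: \<tau>_def antiautD(5)[OF antiaut_flip a])
    fix b :: "'r lmap" assume b: "b \<in> A"
    show "\<tau> (a + b) = \<tau> a + \<tau> b"
      by (simp add: \<tau>_def antiautD(2)[OF antiaut_flip a b] algebra_simps)
    show "\<tau> (a * b) = \<tau> b * \<tau> a"
      using uG by (simp add: \<tau>_def antiautD(3)[OF antiaut_flip a b] mult.assoc)
  next
    fix a :: "'r lmap" assume a: "a \<in> nn n"
    show "\<tau> a \<in> nn n"
      unfolding \<tau>_def by (intro UU_nn u gU antiautD(6)[OF antiaut_flip] a)
  next
    have "(u - 1) * JJ n = JJ n * (u - 1)" using Mn_JJ[OF Gn_minus_one[OF uG]] by simp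
    then have "JJ n * u = u * JJ n" by (simp add: algebra_simps)
    then show "\<tau> (JJ n) = JJ n" using uG by (simp add: \<tau>_def antiautD(7)[OF antiaut_flip] mult.assoc)
  next
    show "inj_on \<tau> A"
    proof (rule inj_onI)
      fix x y assume xy: "x \<in> A" "y \<in> A" "\<tau> x = \<tau> y"
      have "flip x = u * \<tau> x * ginv u" "flip y = u * \<tau> y * ginv u"
        using uG by (simp_all add: \<tau>_def mult.assoc)
      then have "flip x = flip y" using xy(3) by simp
      then show "x = y" using antiautD(8)[OF antiaut_flip] xy by (auto dest: inj_onD)
    qed
  qed
  moreover have "\<tau> C = C" using CC1 by (simp add: \<tau>_def C1_def X_def)
  ultimately show ?thesis using that by blast
qed

text \<open>\<open>\<tau>\<close> is controlled only on the corner, so it is transported to group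
  elements written as 1 + a.\<close>

definition hat :: "('r lmap \<Rightarrow> 'r lmap) \<Rightarrow> 'r lmap \<Rightarrow> 'r lmap" where
  "hat \<tau> g = 1 + \<tau> (g - 1)"

context
  fixes \<tau> C assumes \<tau>: "antiaut \<tau>" and C: "companion n C" and \<tau>C: "\<tau> C = C"
begin

lemma antiaut_ZC: "r \<in> ZC n C \<Longrightarrow> \<tau> r = r"
  using ZC_pz[OF C] antiaut_pz[OF \<tau> companion_Mn[OF C]] \<tau>C by metis

lemma antiaut_LL: "w \<in> LL C \<Longrightarrow> \<tau> w \<in> LL C"
proof (elim LL_E)
  fix a r y assume *: "a \<in> nn n" "r \<in> ZC n C" "y \<in> A" "w = a + r + scl (\<pi> ^ h) y"
  have "\<tau> w = \<tau> a + r + scl (\<pi> ^ h) (\<tau> y)"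
    using * nn_Mn[OF *(1)] ZC_Mn[OF *(2)] by (simp add: antiautD[OF \<tau>] antiaut_ZC)
  then show ?thesis using * antiautD[OF \<tau>] by (auto intro: LL_I)
qed

lemma antiaut_LL_image: "\<tau> ` LL C = LL C"
  by (rule endo_inj_surj) (use antiaut_LL antiautD(8)[OF \<tau>] LL_A in \<open>auto intro: inj_on_subset\<close>)

lemma Psi_antiaut: "w \<in> A \<Longrightarrow> Psi (scl c (C * \<tau> w)) = Psi (scl c (C * w))"
proof -
  assume w: "w \<in> A"
  have Cm: "C \<in> A" using C companion_Mn by blast
  have "mtr n (C * \<tau> w) = mtr n (\<tau> (w * C))" using w Cm \<tau>C by (simp add: antiautD(3)[OF \<tau>])
  also have "\<dots> = mtr n (w * C)" using w Cm by (simp add: antiautD(5)[OF \<tau>])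
  also have "\<dots> = mtr n (C * w)" using w Cm mtr_commute by blast
  finally show ?thesis by (simp add: Psi_def)
qed

lemma hat_mult: "g - 1 \<in> A \<Longrightarrow> g' - 1 \<in> A \<Longrightarrow> hat \<tau> (g * g') = hat \<tau> g' * hat \<tau> g"
proof -
  assume g: "g - 1 \<in> A" "g' - 1 \<in> A"
  have "g * g' - 1 = (g - 1) * (g' - 1) + ((g - 1) + (g' - 1))" by (simp add: algebra_simps)
  then have "\<tau> (g * g' - 1) = \<tau> (g' - 1) * \<tau> (g - 1) + (\<tau> (g - 1) + \<tau> (g' - 1))"
    using g by (simp only: antiautD[OF \<tau>] Mn_closed)
  then show ?thesis by (simp add: hat_def algebra_simps)
qed

lemma hat_G: "g \<in> G \<Longrightarrow> hat \<tau> g \<in> G"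
proof -
  assume g: "g \<in> G"
  have "hat \<tau> 1 = 1" by (simp add: hat_def antiautD(9)[OF \<tau>])
  then have "hat \<tau> g * hat \<tau> (ginv g) = 1" "hat \<tau> (ginv g) * hat \<tau> g = 1"
    using g by (simp_all flip: hat_mult add: Gn_minus_one)
  moreover have "hat \<tau> g - 1 \<in> A" "hat \<tau> (ginv g) - 1 \<in> A"
    using antiautD(1)[OF \<tau> Gn_minus_one[OF g]] antiautD(1)[OF \<tau> Gn_minus_one[OF ginv_Gn[OF g]]]
    by (simp_all add: hat_def)
  ultimately show ?thesis unfolding Gn_def by blast
qed

lemma hat_E: "w \<in> A \<Longrightarrow> hat \<tau> (E w) = E (\<tau> w)"
  by (simp add: hat_def E_def antiautD[OF \<tau>] Mn_closed add.assoc)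

lemma hat_ZC: "z \<in> G \<Longrightarrow> z * C = C * z \<Longrightarrow> hat \<tau> z = z"
proof -
  assume "z \<in> G" "z * C = C * z"
  then have "z - 1 \<in> ZC n C" using Gn_minus_one[of z n] by (simp add: ZC_def algebra_simps)
  then show ?thesis using antiaut_ZC by (simp add: hat_def)
qed

lemma hat_inj: "g \<in> G \<Longrightarrow> g' \<in> G \<Longrightarrow> hat \<tau> g = hat \<tau> g' \<Longrightarrow> g = g'"
  using antiautD(8)[OF \<tau>] Gn_minus_one[of g n] Gn_minus_one[of g' n]
  by (auto simp: hat_def dest!: inj_onD)

end

end

section \<open>Representations of the general linear group\<close>

text \<open>The action is linear on the whole type and \<open>V\<close> is a stable subspace. This
  covers matrix representations on padded vectors as well as subrepresentations of function
  spaces.\<close>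

locale lrep = trunc \<pi> l n \<phi> hf + vector_space sv
  for \<pi> :: "'r::{comm_ring_1,finite}" and l n :: nat and \<phi> :: "'r \<Rightarrow> complex" and hf :: 'r
    and sv :: "complex \<Rightarrow> 'v::ab_group_add \<Rightarrow> 'v" +
  fixes act :: "'r lmap \<Rightarrow> 'v \<Rightarrow> 'v" and V :: "'v set"
  assumes act_add: "g \<in> Gn n \<Longrightarrow> act g (v + w) = act g v + act g w"
    and act_sv: "g \<in> Gn n \<Longrightarrow> act g (sv c v) = sv c (act g v)"
    and act_mult: "g \<in> Gn n \<Longrightarrow> g' \<in> Gn n \<Longrightarrow> act (g * g') v = act g (act g' v)"
    and act_one: "act 1 v = v"
    and subV: "subspace V"
    and actV: "g \<in> Gn n \<Longrightarrow> v \<in> V \<Longrightarrow> act g v \<in> V"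
begin

lemma act_0: "g \<in> G \<Longrightarrow> act g 0 = 0"
  using act_sv[of g 0 0] by simp

lemma act_sum: "g \<in> G \<Longrightarrow> act g (\<Sum>i\<in>K. v i) = (\<Sum>i\<in>K. act g (v i))"
  by (induction K rule: infinite_finite_induct) (auto simp: act_0 act_add)

lemma act_inj: "g \<in> G \<Longrightarrow> act g v = 0 \<Longrightarrow> v = 0"
  using act_mult[of "ginv g" g v] act_0[of "ginv g"] act_one by auto

text \<open>Projections are kept as unnormalized weighted sums: only eigenvalue relations and
  nonvanishing are used, never idempotence.\<close>

definition avg :: "'i set \<Rightarrow> ('i \<Rightarrow> complex) \<Rightarrow> ('i \<Rightarrow> 'r lmap) \<Rightarrow> 'v \<Rightarrow> 'v" where
  "avg K c \<gamma> v = (\<Sum>w\<in>K. sv (c w) (act (\<gamma> w) v))"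

lemma avg_lin:
  assumes "\<And>w. w \<in> K \<Longrightarrow> \<gamma> w \<in> G"
  shows "avg K c \<gamma> (v + v') = avg K c \<gamma> v + avg K c \<gamma> v'" "avg K c \<gamma> (sv a v) = sv a (avg K c \<gamma> v)"
  using assms by (auto simp: avg_def act_add act_sv scale_right_distrib sum.distrib scale_sum_right
      scale_left_commute intro!: sum.cong)

lemma avg_act:
  assumes "\<And>w. w \<in> K \<Longrightarrow> \<gamma> w \<in> G" "g \<in> G"
  shows "act g (avg K c \<gamma> v) = avg K c (\<lambda>w. g * \<gamma> w) v" "avg K c \<gamma> (act g v) = avg K c (\<lambda>w. \<gamma> w * g) v"
  using assms by (auto simp: avg_def act_sum act_sv act_mult intro!: sum.cong)

lemma avg_V: "(\<And>w. w \<in> K \<Longrightarrow> \<gamma> w \<in> G) \<Longrightarrow> v \<in> V \<Longrightarrow> avg K c \<gamma> v \<in> V"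
  unfolding avg_def by (intro subspace_sum subspace_scale subV actV)

text \<open>If left multiplication by \<open>g\<close> permutes the family \<open>\<gamma>\<close> via \<open>\<sigma>\<close> and rescales the coefficients
  by \<open>a\<close>, then \<open>g\<close> acts on the average by the scalar \<open>a\<close>.\<close>

lemma avg_reindex:
  assumes "bij_betw \<sigma> K K" "\<And>w. w \<in> K \<Longrightarrow> \<gamma>' w = \<gamma> (\<sigma> w)" "\<And>w. w \<in> K \<Longrightarrow> c w = a * c (\<sigma> w)"
  shows "avg K c \<gamma>' v = sv a (avg K c \<gamma> v)"
proof -
  have "avg K c \<gamma>' v = (\<Sum>w\<in>K. sv (a * c (\<sigma> w)) (act (\<gamma> (\<sigma> w)) v))"
    unfolding avg_def by (rule sum.cong[OF refl]) (metis assms(2,3))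
  also have "\<dots> = (\<Sum>w\<in>K. sv (a * c w) (act (\<gamma> w) v))"
    by (rule sum.reindex_bij_betw[OF assms(1)])
  finally show ?thesis by (simp add: avg_def scale_sum_right)
qed

subsection \<open>Eigenprojections of abelian congruence subgroups\<close>

definition H :: "nat \<Rightarrow> 'r lmap \<Rightarrow> 'r lmap" where "H k y = 1 + scl (\<pi> ^ k) y"

lemma H_mult: "l \<le> 2 * k \<Longrightarrow> H k y * H k y' = H k (y + y')"
  using pi_zero[of "k + k"] by (simp add: H_def algebra_simps scl_distribs flip: power_add)

lemma H_G: assumes "l \<le> 2 * k" "y \<in> A" shows "H k y \<in> G"
proof -
  have "H k y * H k (- y) = 1" "H k (- y) * H k y = 1"
    using H_mult[OF assms(1)] by simp_all (simp_all add: H_def)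
  moreover have "H k y - 1 \<in> A" "H k (- y) - 1 \<in> A" using assms by (auto simp: H_def)
  ultimately show ?thesis unfolding Gn_def by blast
qed

lemma H_conj: "g \<in> G \<Longrightarrow> g * H k y = H k (g * y * ginv g) * g"
  by (simp add: H_def algebra_simps)

lemma H_M: "H M y = E (scl (\<pi> ^ h) y)" by (simp add: H_def E_high)

lemma lM: "l \<le> 2 * M" using mMh by simp

text \<open>Up to a scalar, the projection to the eigenspace of the level \<open>k\<close> subgroup
  for the character attached to \<open>X\<close>. Summation over all of \<open>A\<close> repeats
  every group element equally often.\<close>

definition PP :: "nat \<Rightarrow> 'r lmap \<Rightarrow> 'v \<Rightarrow> 'v" where
  "PP k X = avg A (\<lambda>y. inverse (Psi (scl (\<pi> ^ k) (X * y)))) (H k)"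

lemma PP_eig:
  assumes k: "l \<le> 2 * k" and b: "b \<in> A"
  shows "act (H k b) (PP k X v) = sv (Psi (scl (\<pi> ^ k) (X * b))) (PP k X v)"
proof -
  have "act (H k b) (PP k X v) = avg A (\<lambda>y. inverse (Psi (scl (\<pi> ^ k) (X * y)))) (\<lambda>w. H k b * H k w) v"
    unfolding PP_def by (rule avg_act(1)) (use H_G k b in auto)
  also have "\<dots> = sv (Psi (scl (\<pi> ^ k) (X * b))) (PP k X v)"
  proof -
    have "bij_betw (\<lambda>y. b + y) A A"
      by (rule bij_betw_byWitness[where f' = "\<lambda>y. y - b"]) (use b in auto)
    then show ?thesis
      unfolding PP_def by (rule avg_reindex) (use b k in \<open>auto simp: H_mult distrib_left scl_distribs Psi_simps\<close>)
  qed
  finally show ?thesis .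
qed

lemma PP_V: "l \<le> 2 * k \<Longrightarrow> v \<in> V \<Longrightarrow> PP k X v \<in> V"
  unfolding PP_def by (intro avg_V H_G)

lemma PP_cong: "scl (\<pi> ^ k) X = scl (\<pi> ^ k) X' \<Longrightarrow> PP k X = PP k X'"
  unfolding PP_def by (metis scl_simps(1))

lemma PP_conj:
  assumes k: "l \<le> 2 * k" and g: "g \<in> G" and X: "X \<in> A"
  shows "act g (PP k X v) = PP k (g * X * ginv g) (act g v)"
proof -
  have "avg A (\<lambda>y. inverse (Psi (scl (\<pi> ^ k) (X * y)))) (\<lambda>w. g * H k w) v
    = (\<Sum>y\<in>A. sv (inverse (Psi (scl (\<pi> ^ k) ((g * X * ginv g) * (g * y * ginv g))))) (act (H k (g * y * ginv g) * g) v))"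
    unfolding avg_def
  proof (rule sum.cong)
    fix y assume y: "y \<in> A"
    have "(g * X * ginv g) * (g * y * ginv g) = g * (X * y) * ginv g"
      using g by (simp add: mult.assoc)
    then have "mtr n ((g * X * ginv g) * (g * y * ginv g)) = mtr n (X * y)"
      using mtr_conj[OF g, of "X * y"] X y by simp
    then show "sv (inverse (Psi (scl (\<pi> ^ k) (X * y)))) (act (g * H k y) v) =
         sv (inverse (Psi (scl (\<pi> ^ k) ((g * X * ginv g) * (g * y * ginv g))))) (act (H k (g * y * ginv g) * g) v)"
      unfolding H_conj[OF g] by (simp add: Psi_def)
  qed simp
  also have "\<dots> = (\<Sum>y\<in>A. sv (inverse (Psi (scl (\<pi> ^ k) ((g * X * ginv g) * y)))) (act (H k y * g) v))"
    by (rule sum.reindex_bij_betw[where h = "\<lambda>y. g * y * ginv g"])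
      (rule bij_betw_byWitness[where f' = "\<lambda>y. ginv g * y * g"], use g in \<open>auto simp: mult.assoc\<close>)
  also have "\<dots> = PP k (g * X * ginv g) (act g v)"
    unfolding PP_def by (subst avg_act(2)) (use H_G k g in \<open>auto simp: avg_def\<close>)
  finally show ?thesis unfolding PP_def by (subst avg_act(1)) (use H_G k g in auto)
qed

text \<open>Fourier inversion: after summation over \<open>X\<close> only those \<open>y\<close>
  with \<open>H k y = 1\<close> survive. Hence every nonzero vector has a nonzero component for some
  \<open>X\<close>.\<close>

lemma PP_sum:
  assumes k: "l \<le> 2 * k"
  obtains N where "N \<noteq> (0::complex)" "\<And>v. (\<Sum>X\<in>A. PP k X v) = sv N v"
proof -
  define Y where "Y = {y \<in> A. scl (\<pi> ^ k) y = 0}"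
  have fY: "finite Y" "0 \<in> Y" by (auto simp: Y_def)
  have "(\<Sum>X\<in>A. PP k X v) = sv (of_nat (card A * card Y)) v" for v
  proof -
    have "(\<Sum>X\<in>A. PP k X v) = (\<Sum>y\<in>A. sv (\<Sum>X\<in>A. inverse (Psi (scl (\<pi> ^ k) (X * y)))) (act (H k y) v))"
      unfolding PP_def avg_def by (subst sum.swap) (simp add: scale_sum_left)
    also have "\<dots> = (\<Sum>y\<in>A. if y \<in> Y then sv (of_nat (card A)) v else 0)"
    proof (rule sum.cong)
      fix y assume y: "y \<in> A"
      have "(\<Sum>X\<in>A. inverse (Psi (scl (\<pi> ^ k) (X * y)))) = (\<Sum>X\<in>A. Psi (X * - scl (\<pi> ^ k) y))"
        by (simp flip: Psi_simps)
      also have "\<dots> = (if y \<in> Y then of_nat (card A) else 0)"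
        using y by (subst Psi_sum) (auto simp: Y_def)
      finally show "sv (\<Sum>X\<in>A. inverse (Psi (scl (\<pi> ^ k) (X * y)))) (act (H k y) v)
        = (if y \<in> Y then sv (of_nat (card A)) v else 0)"
        by (auto simp: Y_def H_def act_one)
    qed simp
    also have "\<dots> = (\<Sum>y\<in>Y. sv (of_nat (card A)) v)"
      by (rule sum.mono_neutral_cong_right) (auto simp: Y_def)
    finally show ?thesis by (simp add: sum_constant_scale mult.commute)
  qed
  moreover have "card A * card Y \<noteq> 0" using card_A fY by auto
  ultimately show ?thesis using that[of "of_nat (card A * card Y)"] by (metis of_nat_eq_0_iff)
qed

subsection \<open>Eigenprojections of the polarization subgroups\<close>

definition ch :: "'r lmap \<Rightarrow> 'r lmap \<Rightarrow> complex" where "ch C w = Psi (scl (\<pi> ^ m) (C * w))"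

definition F :: "'r lmap \<Rightarrow> 'v \<Rightarrow> 'v" where
  "F C = avg (LL C) (\<lambda>w. inverse (ch C w)) E"

text \<open>The group law in exponential coordinates:
  \<open>E w * E w' = E (bch w w')\<close>.\<close>

definition bch :: "'r lmap \<Rightarrow> 'r lmap \<Rightarrow> 'r lmap" where
  "bch w w' = w + w' + scl (hf * \<pi> ^ m) (w * w' - w' * w)"

lemma bch_LL: "w \<in> LL C \<Longrightarrow> w' \<in> LL C \<Longrightarrow> bch w w' \<in> LL C"
  unfolding bch_def using LL_A by (intro LL_closed LL_m) blast+

text \<open>Isotropy removes the bracket term, which makes \<open>ch C\<close> a character of the
  polarization subgroup.\<close>

lemma ch_bch:
  assumes "companion n C" "w \<in> LL C" "w' \<in> LL C" shows "ch C (bch w w') = ch C w * ch C w'"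
proof -
  have "\<pi> ^ m * (hf * (\<pi> ^ m * mtr n (C * (w * w' - w' * w)))) = 0"
    using LL_isotropic[OF assms] by (metis mult.left_commute mult_zero_right)
  then have "Psi (scl (\<pi> ^ m) (C * scl (hf * \<pi> ^ m) (w * w' - w' * w))) = 1"
    by (simp add: Psi_def phi_0 mult.assoc)
  then show ?thesis by (simp add: ch_def bch_def distrib_left scl_distribs Psi_simps)
qed

text \<open>The equation reads \<open>d = \<pi> ^ m f(d)\<close> with \<open>f\<close> linear; three
  substitutions produce the factor \<open>\<pi> ^ (3 * m) = 0\<close>. This yields injectivity of
  \<open>bch\<close> in either variable.\<close>

lemma bch_cancel:
  assumes "scl (hf * \<pi> ^ m) (w * d - d * w) = - d" shows "d = 0"
proof -
  define a where "a = \<pi> ^ m"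
  define f where "f x = scl (- hf) (w * x - x * w)" for x
  have f: "f (scl c x) = scl c (f x)" for c x by (simp add: f_def mult.commute flip: scl_distribs)
  have d: "d = scl a (f d)" using assms by (simp add: f_def a_def mult.commute)
  have "d = scl a (f (scl a (f (scl a (f d)))))" using d by metis
  also have "\<dots> = scl (a * (a * a)) (f (f (f d)))" by (simp add: f)
  finally show ?thesis by (simp add: a_def pi_mM)
qed

lemma bch_bij:
  assumes "w \<in> LL C" shows "bij_betw (bch w) (LL C) (LL C)" "bij_betw (\<lambda>x. bch x w) (LL C) (LL C)"
proof -
  have "x = y" if "bch w x = bch w y" for x y
  proof -
    have "scl (hf * \<pi> ^ m) (w * (x - y) - (x - y) * w) = - (x - y)"
      using that by (simp add: bch_def algebra_simps scl_distribs) 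
    from bch_cancel[OF this] show ?thesis by simp
  qed
  then have "inj_on (bch w) (LL C)" by (auto intro: inj_onI)
  then show "bij_betw (bch w) (LL C) (LL C)"
    using assms bch_LL by (intro bij_betw_imageI endo_inj_surj) auto
  have "x = y" if "bch x w = bch y w" for x y
  proof -
    have "scl (hf * \<pi> ^ m) ((- w) * (x - y) - (x - y) * (- w)) = - (x - y)"
      using that by (simp add: bch_def algebra_simps scl_distribs)
    from bch_cancel[OF this] show ?thesis by simp
  qed
  then have "inj_on (\<lambda>x. bch x w) (LL C)" by (auto intro: inj_onI)
  then show "bij_betw (\<lambda>x. bch x w) (LL C) (LL C)"
    using assms bch_LL by (intro bij_betw_imageI endo_inj_surj) auto
qed

lemma E_LL_G: "w \<in> LL C \<Longrightarrow> E w \<in> G" using LL_A by blast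

lemma ch_nz: "ch C w \<noteq> 0" by (simp add: ch_def Psi_simps)

lemma F_eig:
  assumes C: "companion n C" and w: "w \<in> LL C"
  shows "act (E w) (F C v) = sv (ch C w) (F C v)" "F C (act (E w) v) = sv (ch C w) (F C v)"
proof -
  have ch: "ch C (bch w x) = ch C w * ch C x" "ch C (bch x w) = ch C w * ch C x" if "x \<in> LL C" for x
    using ch_bch[OF C w that] ch_bch[OF C that w] by simp_all
  have Eb: "E x * E y = E (bch x y)" for x y by (simp add: E_mult bch_def)
  show "act (E w) (F C v) = sv (ch C w) (F C v)"
  proof -
    have "act (E w) (F C v) = avg (LL C) (\<lambda>w. inverse (ch C w)) (\<lambda>x. E w * E x) v"
      unfolding F_def by (rule avg_act(1)) (use E_LL_G w in auto)
    also have "\<dots> = sv (ch C w) (F C v)"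
      unfolding F_def by (rule avg_reindex[OF bch_bij(1)[OF w]]) (simp_all add: Eb ch ch_nz)
    finally show ?thesis .
  qed
  show "F C (act (E w) v) = sv (ch C w) (F C v)"
  proof -
    have "F C (act (E w) v) = avg (LL C) (\<lambda>w. inverse (ch C w)) (\<lambda>x. E x * E w) v"
      unfolding F_def by (rule avg_act(2)) (use E_LL_G w in auto)
    also have "\<dots> = sv (ch C w) (F C v)"
      unfolding F_def by (rule avg_reindex[OF bch_bij(2)[OF w]]) (simp_all add: Eb ch ch_nz)
    finally show ?thesis .
  qed
qed

lemma F_lin: "F C (v + v') = F C v + F C v'" "F C (sv a v) = sv a (F C v)"
  unfolding F_def by (auto intro!: avg_lin E_LL_G)

lemma F_0: "F C 0 = 0" using F_lin(2)[of C 0 0] by simp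

lemma F_sum: "F C (\<Sum>i\<in>K. v i) = (\<Sum>i\<in>K. F C (v i))"
  by (induction K rule: infinite_finite_induct) (auto simp: F_0 F_lin)

lemma F_V: "v \<in> V \<Longrightarrow> F C v \<in> V"
  unfolding F_def by (intro avg_V E_LL_G)

lemma F_cong:
  assumes "LL C = LL C'" "scl (\<pi> ^ m) C = scl (\<pi> ^ m) C'" shows "F C = F C'"
proof -
  have "ch C = ch C'" unfolding ch_def using assms(2) by (metis scl_simps(1))
  then show ?thesis by (simp add: F_def assms(1))
qed

subsection \<open>Intertwining\<close>

text \<open>Nonvanishing forces the characters on both sides of \<open>g\<close> to agree on
  whatever can be moved across \<open>g\<close>. Level \<open>M\<close> elements give congruence of
  \<open>C\<close> and \<open>C'\<close> modulo \<open>\<pi> ^ m\<close>, centralizer elements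
  improve it to \<open>\<pi> ^ M\<close>, and the rest of the polarization then locates
  \<open>g\<close>.\<close>

lemma F_intertwine:
  assumes C: "companion n C" and C': "companion n C'" and g: "g \<in> G"
    and nz: "F C (act g (F C' v)) \<noteq> 0"
  shows "F C = F C'"
    and "\<exists>z w1 w2. z \<in> G \<and> z * C = C * z \<and> w1 \<in> LL C \<and> w2 \<in> LL C \<and> g = E w1 * z * E w2"
proof -
  define u where "u = F C' v"
  define x where "x = F C (act g u)"
  have x: "x \<noteq> 0" using nz by (simp add: x_def u_def)
  have Cm: "C \<in> A" "C' \<in> A" using C C' companion_Mn by blast+
  have gJ: "g * JJ n = JJ n * g" if "g \<in> G" for g
  proof -
    have "(g - 1) * JJ n = JJ n * (g - 1)" using Mn_JJ[OF Gn_minus_one[OF that]] by simp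
    then show ?thesis by (simp add: algebra_simps)
  qed
  have conj_ch: "mtr n (C * (g * b * ginv g)) = mtr n (ginv g * C * g * b)" if "g \<in> G" "b \<in> A" for g b
  proof -
    have "C * (g * b * ginv g) = g * (ginv g * C * g * b) * ginv g" using that by (simp add: mult.assoc)
    then show ?thesis using mtr_conj[OF that(1), of "ginv g * C * g * b"] that Cm by auto
  qed
  \<comment> \<open>The level \<open>M\<close> subgroup is normal, so the comparison is possible for
    every \<open>b\<close>; it says that \<open>g\<close> conjugates \<open>C'\<close> into
    \<open>C\<close> modulo \<open>\<pi> ^ m\<close>.\<close>
  have "scl (\<pi> ^ M) (ginv g * C * g - C') = 0"
  proof (rule Psi_nondeg)
    fix b :: "'r lmap" assume b: "b \<in> A"
    define b' where "b' = g * b * ginv g"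
    have b': "b' \<in> A" using b g by (auto simp: b'_def)
    have s: "scl (\<pi> ^ h) b \<in> LL C'" "scl (\<pi> ^ h) b' \<in> LL C" using b b' LL_sub(3) by blast+
    have "g * E (scl (\<pi> ^ h) b) = E (scl (\<pi> ^ h) b') * g"
      using H_conj[OF g, of M b] by (simp add: H_M b'_def)
    then have "F C (act (E (scl (\<pi> ^ h) b')) (act g u)) = F C (act g (act (E (scl (\<pi> ^ h) b)) u))"
      using g s E_LL_G by (metis act_mult)
    then have "sv (ch C (scl (\<pi> ^ h) b')) x = sv (ch C' (scl (\<pi> ^ h) b)) x"
      using F_eig(2)[OF C s(2)] F_eig(1)[OF C' s(1)] g by (simp add: x_def u_def act_sv F_lin)
    then have "ch C (scl (\<pi> ^ h) b') = ch C' (scl (\<pi> ^ h) b)" using x by simp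
    then have "\<phi> (\<pi> ^ M * mtr n (ginv g * C * g * b)) = \<phi> (\<pi> ^ M * mtr n (C' * b))"
      using conj_ch[OF g b] by (simp add: ch_def Psi_def pi_mM b'_def)
    then show "Psi (scl (\<pi> ^ M) (ginv g * C * g - C') * b) = 1"
      by (simp add: Psi_def left_diff_distrib right_diff_distrib phi_diff phi_nz)
  qed (use Cm g in auto)
  then have "g * scl (\<pi> ^ M) (ginv g * C * g - C') = 0" by simp
  then have int: "scl (\<pi> ^ M) (C * g - g * C') = 0"
    using g by (simp add: right_diff_distrib mult.assoc)
  have CC: "scl (\<pi> ^ M) C = scl (\<pi> ^ M) C'"
  proof (rule companion_eq_mod[OF C C' n0])
    define c where "c = (\<lambda>i. ent C i (n - 1))"
    have "g * scl (\<pi> ^ M) (pf n c C') = 0"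
      using pf_intertwine[OF Cm g int, of c] pf_companion[OF C n0] by (simp add: c_def)
    then have "scl (\<pi> ^ M) (pf n c C') = 0" using Gn_inv(4)[OF g] by (metis mult_zero_right)
    then show "scl (\<pi> ^ M) (pf n (\<lambda>i. ent C i (n - 1)) C') = 0" by (simp add: c_def)
  qed
  have LLC: "LL C = LL C'" using LL_mod[OF C C' CC] .
  \<comment> \<open>\<open>g\<close> commutes with \<open>C\<close> modulo \<open>\<pi> ^ m\<close>,
    so its corner part is close to an exact centralizer element \<open>z0\<close>; the discrepancy
    is removed by a factor \<open>E q\<close>, with \<open>q\<close> given by the truncated
    logarithm.\<close>
  obtain z y where z: "z \<in> G" "z * C = C * z" and y: "y \<in> A" and gzy: "g = z * E y"
  proof -
    have e: "C * (g * JJ n) - (g * JJ n) * C = C * g - g * C"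
      by (metis gJ[OF g] Mn_JJ[OF Cm(1)] mult.assoc)
    have "scl (\<pi> ^ M) (g * C') = scl (\<pi> ^ M) (g * C)" using CC by (metis scl_simps(2))
    then have 0: "scl (\<pi> ^ M) (C * (g * JJ n) - (g * JJ n) * C) = 0"
      using int unfolding e by (simp add: scl_distribs)
    have "g * JJ n \<in> A" using g by simp
    from companion_approx_commute[OF C this 0]
    obtain z0 where z0: "z0 \<in> ZC n C" "scl (\<pi> ^ M) (g * JJ n - z0) = 0" by blast
    have zA: "g * JJ n - z0 \<in> A" by (rule Mn_closed(3)[OF Gn_Mn(1)[OF g JJ_Mn] ZC_Mn[OF z0(1)]])
    have lMm: "M \<le> l" "l - M = m" using mMh by auto
    obtain y0 where y0: "y0 \<in> A" "g * JJ n - z0 = scl (\<pi> ^ m) y0"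
      using Mn_ann[OF zA lMm(1) z0(2)] lMm by auto
    define q where "q = - (ginv g * y0) - scl (hf * \<pi> ^ m) ((ginv g * y0) * (ginv g * y0))"
    have qA: "q \<in> A" using g y0 by (auto simp: q_def)
    have Eq: "E q = 1 - scl (\<pi> ^ m) (ginv g * y0)"
      using E_surj[of "- (ginv g * y0)"] by (simp add: q_def)
    define z where "z = g * E q"
    have "z = g - (g * JJ n - z0)" unfolding z_def Eq y0(2) using g by (simp add: right_diff_distrib)
    then have "z = g - g * JJ n + z0" by simp
    moreover have "(g - g * JJ n) * C = 0" "C * (g - g * JJ n) = 0"
      unfolding left_diff_distrib right_diff_distrib
      by (metis gJ[OF g] Mn_JJ[OF Cm(1)] mult.assoc right_minus_eq)+
    ultimately have "z * C = C * z" using z0(1) by (simp add: distrib_left distrib_right ZC_def)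
    moreover have "z \<in> G" using g qA by (simp add: z_def)
    moreover have "g = z * E (- q)" by (simp add: z_def mult.assoc E_inverse)
    ultimately show ?thesis using that qA by blast
  qed
  have zr: "E r * g = g * E r * E (scl (\<pi> ^ m) (r * y - y * r))" if r: "z * r = r * z" for r
  proof -
    have "E r * z = z * E r" using z(1) r by (simp add: E_conj) (metis Gn_inv(1) mult.assoc mult.right_neutral)
    then have "E r * g = z * (E r * E y)" by (simp add: gzy) (metis mult.assoc)
    then show ?thesis by (simp add: E_commutator[of r y] gzy mult.assoc)
  qed
  \<comment> \<open>Moving \<open>E r\<close> across \<open>g\<close> costs
    \<open>E (scl (\<pi> ^ m) d)\<close>. Its character value is 1: \<open>C\<close> and
    \<open>C'\<close> agree after multiplication by \<open>\<pi> ^ (2 * m)\<close>, and the trace of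
    \<open>C * d\<close> vanishes because \<open>r\<close> centralizes \<open>C\<close>. So the
    characters agree on the centralizer, whose dual is the last column.\<close>
  have "scl (\<pi> ^ m) (C - C') = 0"
  proof (rule BB_ZC_ann[OF C companion_diff_BB[OF C C']])
    fix r assume r: "r \<in> ZC n C"
    have rA: "r \<in> A" using r ZC_Mn by blast
    define d where "d = r * y - y * r"
    have dA: "d \<in> A" using rA y by (auto simp: d_def)
    have "z * r = r * z" by (rule ZC_commute[OF C r z(2) gJ[OF z(1)]])
    then have e: "E r * g = g * E r * E (scl (\<pi> ^ m) d)" using zr by (simp add: d_def)
    have s: "r \<in> LL C" "r \<in> LL C'" "scl (\<pi> ^ m) d \<in> LL C'"
      using r dA LLC LL_sub(2) LL_m' by blast+
    have "sv (ch C r) x = F C (act (E r * g) u)"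
      using F_eig(2)[OF C s(1)] g s E_LL_G by (simp add: act_mult x_def)
    also have "\<dots> = sv (ch C' (scl (\<pi> ^ m) d)) (sv (ch C' r) x)"
      using F_eig(1)[OF C' s(2)] F_eig(1)[OF C' s(3)] g s E_LL_G
      unfolding e by (simp add: act_mult x_def u_def act_sv F_lin mult.commute)
    finally have c: "ch C r = ch C' (scl (\<pi> ^ m) d) * ch C' r" using x by simp
    have pp: "\<pi> ^ m * \<pi> ^ m = \<pi> ^ (m - h) * \<pi> ^ M"
      using mMh(2,5) by (simp flip: power_add)
    have "scl (\<pi> ^ m * \<pi> ^ m) C' = scl (\<pi> ^ (m - h)) (scl (\<pi> ^ M) C')" by (simp add: pp)
    also have "\<dots> = scl (\<pi> ^ m * \<pi> ^ m) C" unfolding CC[symmetric] by (simp add: pp)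
    finally have "scl (\<pi> ^ m * \<pi> ^ m) (C' * d) = scl (\<pi> ^ m * \<pi> ^ m) (C * d)" by (metis scl_simps(1))
    moreover have "mtr n (C * d) = 0"
      using mtr_bracket_ZC[OF Cm(1) y r] unfolding d_def
      by (simp add: right_diff_distrib)
    ultimately have "ch C' (scl (\<pi> ^ m) d) = 1" by (simp add: ch_def Psi_def phi_0)
    then show "Psi (scl (\<pi> ^ m) ((C - C') * r)) = 1"
      using c ch_nz[of C' r] by (simp add: ch_def left_diff_distrib scl_distribs Psi_simps)
  qed
  then have "scl (\<pi> ^ m) C = scl (\<pi> ^ m) C'" by (simp add: scl_distribs)
  then show FF: "F C = F C'" using F_cong LLC by blast
  have uC: "u = F C v" by (simp add: u_def FF)
  \<comment> \<open>For \<open>w\<close> in the polarization with conjugate also in it,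
    \<open>E w\<close> on the right of \<open>g\<close> can be traded for its conjugate on the left;
    equality of eigenvalues is the orthogonality that lets \<open>y\<close> be decomposed.\<close>
  obtain w1 w2 where w: "w1 \<in> LL C" "w2 \<in> LL C" "y = ginv z * w1 * z + w2"
  proof (rule LL_conj_sum[OF C z y])
    fix w assume w: "w \<in> LL C" "z * w * ginv z \<in> LL C"
    have wA: "w \<in> A" using w LL_A by blast
    define d where "d = w * y - y * w"
    have dA: "d \<in> A" using wA y by (auto simp: d_def)
    have s: "scl (\<pi> ^ m) d \<in> LL C" using dA LL_m' by blast
    have "E (z * w * ginv z) * g = z * (E w * E y)"
      using E_conj[OF z(1), of w] by (simp add: gzy mult.assoc[symmetric])
    also have "\<dots> = g * E w * E (scl (\<pi> ^ m) d)"
      by (simp add: E_commutator[of w y] gzy mult.assoc d_def)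
    finally have e: "E (z * w * ginv z) * g = g * E w * E (scl (\<pi> ^ m) d)" .
    have "sv (ch C (z * w * ginv z)) x = F C (act (E (z * w * ginv z) * g) u)"
      using F_eig(2)[OF C w(2)] g w E_LL_G by (simp add: act_mult x_def)
    also have "\<dots> = sv (ch C (scl (\<pi> ^ m) d)) (sv (ch C w) x)"
      using F_eig(1)[OF C w(1)] F_eig(1)[OF C s] g w s E_LL_G
      unfolding e by (simp add: act_mult x_def uC act_sv F_lin mult.commute)
    finally have c: "ch C (z * w * ginv z) = ch C (scl (\<pi> ^ m) d) * ch C w" using x by simp
    have "ginv z * C * z = C" using z by (metis Gn_inv(4) mult.assoc)
    then have "ch C (z * w * ginv z) = ch C w" using conj_ch[OF z(1) wA] by (simp add: ch_def Psi_def)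
    then have 1: "ch C (scl (\<pi> ^ m) d) = 1" using c ch_nz[of C w] by simp
    have "mtr n ((C * y) * w) = mtr n (w * (C * y))" using Cm y wA by (intro mtr_commute) auto
    then have "mtr n ((C * w - w * C) * y) = mtr n (C * d)"
      by (simp add: d_def algebra_simps)
    then show "Psi (scl (\<pi> ^ (2 * m)) (C * w - w * C) * y) = 1"
      using 1 by (simp add: ch_def Psi_def pi_mM)
  qed
  define p where "p = ginv z * w1 * z"
  have pA: "p \<in> A" using z w LL_A by (auto simp: p_def)
  define d where "d = p * w2 - w2 * p"
  have dA: "d \<in> A" using pA w LL_A by (auto simp: d_def)
  \<comment> \<open>A level \<open>M\<close> correction cancelling the bracket in
    \<open>E p * E w2\<close>; it remains inside the polarization.\<close>
  define e where "e = scl (- hf * \<pi> ^ (m - h)) d"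
  have he: "scl (\<pi> ^ h) e = - scl (hf * \<pi> ^ m) d"
    using mMh by (simp add: e_def mult.left_commute flip: power_add)
  have "E y = E (p + w2 + scl (hf * \<pi> ^ m) d + scl (\<pi> ^ h) e)" by (simp add: he w(3) p_def)
  also have "\<dots> = E p * E w2 * E (scl (\<pi> ^ h) e)" by (simp only: E_mult[of p w2] E_add_high(1) d_def)
  also have "\<dots> = E p * E (w2 + scl (\<pi> ^ h) e)" by (simp add: mult.assoc E_add_high(1))
  finally have "g = z * E p * E (w2 + scl (\<pi> ^ h) e)" by (simp add: gzy mult.assoc)
  also have "z * E p = E w1 * z"
  proof -
    have "z * p * ginv z = w1" using z by (simp add: p_def mult.assoc)
    then show ?thesis using E_conj[OF z(1), of p] by simp
  qed
  finally have "g = E w1 * z * E (w2 + scl (\<pi> ^ h) e)" .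
  moreover have "w2 + scl (\<pi> ^ h) e \<in> LL C"
    using w dA by (intro LL_closed LL_sub(3)) (auto simp: e_def)
  ultimately show "\<exists>z w1 w2. z \<in> G \<and> z * C = C * z \<and> w1 \<in> LL C \<and> w2 \<in> LL C \<and> g = E w1 * z * E w2"
    using z w by blast
qed

end

section \<open>Eigenvectors in finite-dimensional spaces\<close>

context vector_space
begin

text \<open>A repeated vector gives the coefficients 1 and -1; otherwise the image has more elements
  than \<open>B\<close> and is dependent.\<close>

lemma dependent_family:
  fixes f :: "nat \<Rightarrow> 'b"
  assumes "finite B" and "\<And>i. f i \<in> span B"
  obtains c where "(\<Sum>i\<le>card B. scale (c i) (f i)) = 0" "\<exists>i\<le>card B. c i \<noteq> 0"
proof (cases "inj_on f {..card B}")
  case True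
  have "dependent (f ` {..card B})"
  proof (rule ccontr)
    assume "\<not> dependent (f ` {..card B})"
    then have "card (f ` {..card B}) \<le> card B"
      using independent_span_bound[OF assms(1), of "f ` {..card B}"] assms(2) by auto
    then show False using card_image[OF True] by simp
  qed
  then obtain u v where u: "v \<in> f ` {..card B}" "u v \<noteq> 0" "(\<Sum>v\<in>f ` {..card B}. scale (u v) v) = 0"
    by (auto simp: dependent_finite)
  then show ?thesis using that[of "\<lambda>i. u (f i)"] True by (auto simp: sum.reindex)
next
  case False
  then obtain i j where ij: "i \<le> card B" "j \<le> card B" "i \<noteq> j" "f i = f j" by (auto simp: inj_on_def)
  define c :: "nat \<Rightarrow> 'a" where "c k = (if k = i then 1 else if k = j then - 1 else 0)" for k
  have "(\<Sum>k\<le>card B. scale (c k) (f k)) = (\<Sum>k\<le>card B. (if k = i then f i else 0) + (if k = j then - f j else 0))"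
    using ij(3) by (intro sum.cong) (auto simp: c_def)
  also have "\<dots> = 0" using ij by (simp add: sum.distrib)
  finally have "(\<Sum>k\<le>card B. scale (c k) (f k)) = 0" .
  moreover have "c i \<noteq> 0" by (simp add: c_def)
  ultimately show ?thesis using that[of c] ij(1) by blast
qed

end

lemma (in vector_space) peval_root_factor:
  fixes T :: "'b \<Rightarrow> 'b"
  defines "ev \<equiv> \<lambda>p w. \<Sum>i\<le>degree p. scale (coeff p i) ((T ^^ i) w)"
  assumes lin: "\<And>v w. T (v + w) = T v + T w" "\<And>c v. T (scale c v) = scale c (T v)"
  shows "ev ([:- c, 1:] * q) w = T (ev q w) - scale c (ev q w)"
proof -
  have ev: "ev p w = (\<Sum>i\<le>N. scale (coeff p i) ((T ^^ i) w))" if "degree p \<le> N" for p N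
    unfolding ev_def using that
    by (intro sum.mono_neutral_left) (auto simp: coeff_eq_0)
  have T0: "T 0 = 0" using lin(2)[of 0 0] by simp
  have Ts: "T (\<Sum>i\<in>K. f i) = (\<Sum>i\<in>K. T (f i))" for f :: "nat \<Rightarrow> 'b" and K
    by (induction K rule: infinite_finite_induct) (auto simp: T0 lin)
  let ?N = "degree q"
  have e: "[:- c, 1:] * q = pCons 0 q - Polynomial.smult c q" by (simp add: algebra_simps)
  have "degree ([:- c, 1:] * q) \<le> Suc ?N" unfolding e
    by (intro degree_diff_le) (auto simp: degree_pCons_le degree_smult_le le_SucI order_trans)
  then have "ev ([:- c, 1:] * q) w = (\<Sum>i\<le>Suc ?N. scale (coeff ([:- c, 1:] * q) i) ((T ^^ i) w))"
    by (rule ev)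
  also have "\<dots> = (\<Sum>i\<le>Suc ?N. scale (coeff (pCons 0 q) i - c * coeff q i) ((T ^^ i) w))"
    unfolding e by (simp only: coeff_diff coeff_smult)
  also have "\<dots> = (\<Sum>i\<le>Suc ?N. scale (coeff (pCons 0 q) i) ((T ^^ i) w)) - scale c (\<Sum>i\<le>Suc ?N. scale (coeff q i) ((T ^^ i) w))"
    by (simp add: scale_left_diff_distrib sum_subtractf scale_sum_right del: sum.atMost_Suc)
  also have "(\<Sum>i\<le>Suc ?N. scale (coeff q i) ((T ^^ i) w)) = ev q w" by (rule ev[symmetric]) simp
  also have "(\<Sum>i\<le>Suc ?N. scale (coeff (pCons 0 q) i) ((T ^^ i) w)) = T (ev q w)"
    unfolding ev_def sum.atMost_Suc_shift by (simp add: Ts lin)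
  finally show ?thesis .
qed

text \<open>Take a polynomial of least degree that annihilates \<open>w\<close> under
  \<open>T\<close> and split off a root: the cofactor does not annihilate \<open>w\<close>, and its
  value at \<open>w\<close> is an eigenvector.\<close>

lemma eigenvector_exists:
  fixes sv :: "complex \<Rightarrow> 'v::ab_group_add \<Rightarrow> 'v"
  assumes vs: "vector_space sv" and lin: "\<And>v w. T (v + w) = T v + T w" "\<And>c v. T (sv c v) = sv c (T v)"
    and W: "module.subspace sv W" "\<And>w. w \<in> W \<Longrightarrow> T w \<in> W" "W \<subseteq> module.span sv B" "finite B"
    and w: "w \<in> W" "w \<noteq> 0"
  obtains c y where "y \<in> W" "y \<noteq> 0" "T y = sv c y"
proof -
  interpret vector_space sv by (rule vs)
  define ev where "ev p = (\<Sum>i\<le>degree p. sv (coeff p i) ((T ^^ i) w))" for p :: "complex poly"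
  have TW: "(T ^^ i) w \<in> W" for i by (induction i) (use w W in auto)
  have evW: "ev p \<in> W" for p unfolding ev_def
    by (intro subspace_sum[OF W(1)] subspace_scale[OF W(1)] TW)
  obtain c where c: "(\<Sum>i\<le>card B. sv (c i) ((T ^^ i) w)) = 0" "\<exists>i\<le>card B. c i \<noteq> 0"
    using dependent_family[OF W(4), of "\<lambda>i. (T ^^ i) w"] TW W(3) by blast
  define p0 where "p0 = (\<Sum>i\<le>card B. monom (c i) i)"
  have cp0: "coeff p0 k = (if k \<le> card B then c k else 0)" for k
    by (auto simp: p0_def coeff_sum if_distrib cong: if_cong)
  have "p0 \<noteq> 0" using c(2) cp0 by (metis coeff_0)
  moreover have "degree p0 \<le> card B" by (rule degree_le) (auto simp: cp0)
  then have "ev p0 = (\<Sum>i\<le>card B. sv (coeff p0 i) ((T ^^ i) w))"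
    unfolding ev_def by (intro sum.mono_neutral_left) (auto simp: coeff_eq_0)
  then have "ev p0 = 0" using c(1) by (simp add: cp0)
  ultimately obtain p where p: "p \<noteq> 0" "ev p = 0" and min: "\<And>q. q \<noteq> 0 \<Longrightarrow> ev q = 0 \<Longrightarrow> degree p \<le> degree q"
    using ex_has_least_nat[of "\<lambda>p. p \<noteq> 0 \<and> ev p = 0" p0 degree] by blast
  have "degree p \<noteq> 0"
  proof
    assume d: "degree p = 0"
    then have "coeff p 0 \<noteq> 0" using p(1) by (metis leading_coeff_0_iff)
    then show False using p(2) w d by (simp add: ev_def)
  qed
  then obtain z where "poly p z = 0" using fundamental_theorem_of_algebra[of p] by (auto simp: constant_degree)
  then obtain q where q: "p = [:- z, 1:] * q" by (auto simp: poly_eq_0_iff_dvd)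
  have q0: "q \<noteq> 0" using p(1) q by auto
  have "degree p = Suc (degree q)" using q q0 by (simp add: degree_mult_eq del: mult_pCons_left)
  then have "ev q \<noteq> 0" using min[OF q0] by auto
  moreover have "T (ev q) = sv z (ev q)"
    using peval_root_factor[of T z q w] lin p(2) q by (simp add: ev_def del: mult_pCons_left)
  ultimately show ?thesis using that evW by blast
qed

context lrep
begin

section \<open>Uniqueness of Whittaker functionals\<close>

text \<open>\<open>hat \<tau>\<close> interchanges the two outer factors of
  \<open>E w1 * z * E w2\<close>, fixes \<open>z\<close> and preserves \<open>ch C\<close>, so both
  sides carry the same scalar. Off these products both sides vanish.\<close>

lemma F_antiaut:
  assumes C: "companion n C" and \<tau>: "antiaut \<tau>" "\<tau> C = C" and g: "g \<in> G"
  shows "F C (act g (F C v)) = F C (act (hat \<tau> g) (F C v))"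
proof -
  have key: "F C (act (E w1 * z * E w2) (F C v)) = sv (ch C w1 * ch C w2) (F C (act z (F C v)))"
    if "z \<in> G" "w1 \<in> LL C" "w2 \<in> LL C" for w1 w2 z
  proof -
    have "F C (act (E w1 * z * E w2) (F C v)) = F C (act (E w1) (act z (act (E w2) (F C v))))"
      using that E_LL_G by (simp add: act_mult)
    then show ?thesis using that F_eig[OF C] by (simp add: act_sv F_lin)
  qed
  have dec: "hat \<tau> (E w1 * z * E w2) = E (\<tau> w2) * z * E (\<tau> w1)" "ch C (\<tau> w1) = ch C w1" "ch C (\<tau> w2) = ch C w2"
    if "z \<in> G" "z * C = C * z" "w1 \<in> LL C" "w2 \<in> LL C" for w1 w2 z
  proof -
    have w: "w1 \<in> A" "w2 \<in> A" using that LL_A by blast+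
    have "hat \<tau> (E w1 * z * E w2) = hat \<tau> (E w2) * (hat \<tau> z * hat \<tau> (E w1))"
      using that w by (simp add: hat_mult[OF \<tau>(1) C \<tau>(2)] Gn_minus_one)
    then show "hat \<tau> (E w1 * z * E w2) = E (\<tau> w2) * z * E (\<tau> w1)"
      using that w by (simp add: hat_E[OF \<tau>(1) C \<tau>(2)] hat_ZC[OF \<tau>(1) C \<tau>(2)] mult.assoc)
    show "ch C (\<tau> w1) = ch C w1" "ch C (\<tau> w2) = ch C w2"
      using w by (simp_all add: ch_def Psi_antiaut[OF \<tau>(1) C \<tau>(2)])
  qed
  note L = antiaut_LL[OF \<tau>(1) C \<tau>(2)]
  have step: "F C (act g (F C v)) = F C (act (hat \<tau> g) (F C v))"
    if "z \<in> G" "z * C = C * z" "w1 \<in> LL C" "w2 \<in> LL C" "g = E w1 * z * E w2" for z w1 w2 g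
    using that dec[OF that(1-4)] key[OF that(1,3,4)] key[OF that(1) L[OF that(4)] L[OF that(3)]]
    by (simp add: mult.commute)
  consider "F C (act g (F C v)) \<noteq> 0" | "F C (act (hat \<tau> g) (F C v)) \<noteq> 0"
    | "F C (act g (F C v)) = 0" "F C (act (hat \<tau> g) (F C v)) = 0" by blast
  then show ?thesis
  proof cases
    case 1
    from F_intertwine(2)[OF C C g 1] show ?thesis using step by blast
  next
    case 2
    have hg: "hat \<tau> g \<in> G" by (rule hat_G[OF \<tau>(1) C \<tau>(2) g])
    from F_intertwine(2)[OF C C hg 2]
    obtain z w1 w2 where z: "z \<in> G" "z * C = C * z" "w1 \<in> LL C" "w2 \<in> LL C" "hat \<tau> g = E w1 * z * E w2"
      by blast
    \<comment> \<open>Only the image of \<open>g\<close> is known to decompose; since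
      \<open>\<tau>\<close> maps the polarization onto itself, the decomposition can be pulled back
      to \<open>g\<close>.\<close>
    obtain v1 v2 where v: "v1 \<in> LL C" "\<tau> v1 = w1" "v2 \<in> LL C" "\<tau> v2 = w2"
      using antiaut_LL_image[OF \<tau>(1) C \<tau>(2)] z by (metis imageE)
    have "hat \<tau> (E v2 * z * E v1) = hat \<tau> g" using dec(1)[OF z(1,2) v(3,1)] v z by simp
    moreover have "E v2 * z * E v1 \<in> G" using v z E_LL_G by auto
    ultimately have "g = E v2 * z * E v1" using hat_inj[OF \<tau>(1) C \<tau>(2)] g by blast
    then show ?thesis using step[OF z(1,2) v(3,1)] by blast
  qed auto
qed

text \<open>Expanding the middle \<open>F C\<close> gives a sum of single operators to which
  \<open>F_antiaut\<close> applies. Reversal of products interchanges \<open>g\<close> and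
  \<open>g'\<close>, reindexing by \<open>\<tau>\<close> restores the sum, and two more applications
  remove \<open>hat\<close>.\<close>

lemma F_commute:
  assumes C: "companion n C" and g: "g \<in> G" and g': "g' \<in> G"
  shows "F C (act g (F C (act g' (F C v)))) = F C (act g' (F C (act g (F C v))))"
proof -
  obtain \<tau> where \<tau>: "antiaut \<tau>" "\<tau> C = C" using antiaut_companion[OF C] .
  note ctx = \<tau>(1) C \<tau>(2)
  have hG: "hat \<tau> g \<in> G" "hat \<tau> g' \<in> G" using hat_G[OF ctx] g g' by auto
  have expand: "F C (act a (F C (act b (F C v)))) = (\<Sum>w\<in>LL C. sv (inverse (ch C w)) (F C (act (a * E w * b) (F C v))))"
    if "a \<in> G" "b \<in> G" for a b v
  proof -
    have "F C (act a (F C (act b (F C v)))) = F C (act a (\<Sum>w\<in>LL C. sv (inverse (ch C w)) (act (E w) (act b (F C v)))))"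
      by (subst (2) F_def) (simp add: avg_def)
    also have "\<dots> = (\<Sum>w\<in>LL C. sv (inverse (ch C w)) (F C (act (a * E w * b) (F C v))))"
      using that E_LL_G by (simp add: act_sum F_sum act_sv F_lin act_mult)
    finally show ?thesis .
  qed
  have "F C (act g (F C (act g' (F C v))))
    = (\<Sum>w\<in>LL C. sv (inverse (ch C (\<tau> w))) (F C (act (hat \<tau> g' * E (\<tau> w) * hat \<tau> g) (F C v))))"
    unfolding expand[OF g g']
  proof (rule sum.cong)
    fix w assume w: "w \<in> LL C"
    have wA: "w \<in> A" using w LL_A by blast
    have "hat \<tau> (g * E w * g') = hat \<tau> g' * E (\<tau> w) * hat \<tau> g"
      using g g' wA by (simp add: hat_mult[OF ctx] Gn_minus_one hat_E[OF ctx] mult.assoc)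
    moreover have "ch C (\<tau> w) = ch C w" using wA by (simp add: ch_def Psi_antiaut[OF ctx])
    moreover have "g * E w * g' \<in> G" using g g' wA by auto
    ultimately show "sv (inverse (ch C w)) (F C (act (g * E w * g') (F C v)))
      = sv (inverse (ch C (\<tau> w))) (F C (act (hat \<tau> g' * E (\<tau> w) * hat \<tau> g) (F C v)))"
      using F_antiaut[OF C \<tau>] by simp
  qed simp
  also have "\<dots> = (\<Sum>w\<in>LL C. sv (inverse (ch C w)) (F C (act (hat \<tau> g' * E w * hat \<tau> g) (F C v))))"
    by (rule sum.reindex_bij_betw[where h = \<tau>])
      (use antiaut_LL_image[OF ctx] antiautD(8)[OF \<tau>(1)] LL_A in \<open>auto simp: bij_betw_def intro: inj_on_subset\<close>)
  also have "\<dots> = F C (act (hat \<tau> g') (F C (act (hat \<tau> g) (F C v))))" by (rule expand[OF hG(2,1), symmetric])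
  also have "\<dots> = F C (act g' (F C (act g (F C v))))"
    by (simp flip: F_antiaut[OF C \<tau> g] F_antiaut[OF C \<tau> g'])
  finally show ?thesis .
qed

section \<open>The image of \<open>F C\<close> in an irreducible representation\<close>

definition irr :: bool where
  "irr \<longleftrightarrow> (\<forall>W. subspace W \<and> W \<subseteq> V \<and> (\<forall>g\<in>G. \<forall>w\<in>W. act g w \<in> W) \<longrightarrow> W = {0} \<or> W = V)"

lemma irr_span:
  assumes irr and x: "x \<in> V" "x \<noteq> 0" shows "V = span ((\<lambda>g. act g x) ` G)"
proof -
  let ?W = "span ((\<lambda>g. act g x) ` G)"
  have "act g w \<in> ?W" if "g \<in> G" "w \<in> ?W" for g w
    using that(2)
  proof (induction rule: span_induct_alt)
    case base
    then show ?case by (simp add: act_0 that span_zero)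
  next
    case (step c y z)
    then obtain g' where "g' \<in> G" "y = act g' x" by auto
    then have "act g y \<in> ?W" using that by (auto intro!: span_base simp flip: act_mult)
    then show ?case using step that by (simp add: act_add act_sv span_add span_scale)
  qed
  moreover have "?W \<subseteq> V" by (rule span_minimal) (use x actV subV in auto)
  moreover have "x \<in> ?W" by (rule span_base) (auto intro!: image_eqI[of _ _ 1] simp: act_one)
  ultimately show ?thesis using assms subspace_span unfolding irr_def by blast
qed

text \<open>Commutation makes each compressed operator a scalar on the image of \<open>F C\<close>.
  Since the orbit of a single vector \<open>F C v0\<close> spans \<open>V\<close>, applying
  \<open>F C\<close> to that orbit stays in one line.\<close>

lemma F_one_dim:
  assumes irr and fin: "finite B" "V \<subseteq> span B" and C: "companion n C" and v0: "v0 \<in> V" "F C v0 \<noteq> 0"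
    and v: "v \<in> V"
  shows "\<exists>c. F C v = sv c (F C v0)"
proof -
  define W where "W = F C ` V"
  have WV: "W \<subseteq> V" using F_V by (auto simp: W_def)
  have subW: "subspace W" unfolding subspace_def
  proof (intro conjI ballI allI)
    show "0 \<in> W" using F_0[of C] subspace_0[OF subV] by (force simp: W_def)
    fix x assume "x \<in> W"
    then obtain x' where x': "x' \<in> V" "x = F C x'" by (auto simp: W_def)
    show "sv c x \<in> W" for c using x' subspace_scale[OF subV x'(1), of c] by (force simp: W_def simp flip: F_lin)
    fix y assume "y \<in> W"
    then obtain y' where y': "y' \<in> V" "y = F C y'" by (auto simp: W_def)
    show "x + y \<in> W" using x' y' subspace_add[OF subV x'(1) y'(1)] by (force simp: W_def simp flip: F_lin)
  qed
  have scal: "\<exists>c. \<forall>y\<in>W. F C (act g y) = sv c y" if g: "g \<in> G" for g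
  proof -
    obtain c y where y: "y \<in> W" "y \<noteq> 0" "F C (act g y) = sv c y"
    proof (rule eigenvector_exists[OF vector_space_axioms, of "\<lambda>x. F C (act g x)" W B "F C v0"])
      show "F C (act g w) \<in> W" if "w \<in> W" for w using that WV actV[OF g] by (auto simp: W_def)
    qed (use g subW fin WV v0 in \<open>auto simp: act_add F_lin act_sv W_def\<close>)
    \<comment> \<open>By \<open>F_commute\<close> the compressed operators map the eigenvector
      \<open>y\<close> into its eigenspace; the orbit of \<open>y\<close> spans \<open>V\<close>, so
      the eigenspace is all of \<open>W\<close>.\<close>
    define K where "K = {x \<in> W. F C (act g x) = sv c x}"
    have subK: "subspace {x. F C x \<in> K}"
      unfolding K_def subspace_def using g subW
      by (auto simp: F_0 act_0 subspace_0 F_lin act_add act_sv scale_right_distrib subspace_add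
          subspace_scale scale_left_commute)
    have "F C x \<in> K" if "x \<in> V" for x
    proof -
      have "(\<lambda>g. act g y) ` G \<subseteq> {x. F C x \<in> K}"
      proof safe
        fix g' assume g': "g' \<in> G"
        obtain u where u: "u \<in> V" "y = F C u" using y(1) by (auto simp: W_def)
        have "F C (act g (F C (act g' y))) = F C (act g' (F C (act g y)))"
          unfolding u by (rule F_commute[OF C g g'])
        then have "F C (act g (F C (act g' y))) = sv c (F C (act g' y))"
          by (simp add: y(3) act_sv[OF g'] F_lin)
        then show "F C (act g' y) \<in> K" using actV[OF g'] WV y(1) by (auto simp: K_def W_def)
      qed
      then have "span ((\<lambda>g. act g y) ` G) \<subseteq> {x. F C x \<in> K}" by (rule span_minimal[OF _ subK])
      then show ?thesis using irr_span[OF assms(1), of y] y WV that by blast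
    qed
    then show ?thesis by (intro exI[of _ c]) (auto simp: W_def K_def)
  qed
  define x where "x = F C v0"
  have xW: "x \<in> W" "x \<noteq> 0" using v0 by (auto simp: x_def W_def)
  have "subspace {y. \<exists>c. F C y = sv c x}"
    unfolding subspace_def
  proof (intro conjI ballI allI)
    show "0 \<in> {y. \<exists>c. F C y = sv c x}" by (auto simp: F_0 intro: exI[of _ 0])
    fix y assume "y \<in> {y. \<exists>c. F C y = sv c x}"
    then obtain c where c: "F C y = sv c x" by blast
    show "sv a y \<in> {y. \<exists>c. F C y = sv c x}" for a by (auto simp: F_lin c)
    fix y' assume "y' \<in> {y. \<exists>c. F C y = sv c x}"
    then obtain c' where c': "F C y' = sv c' x" by blast
    show "y + y' \<in> {y. \<exists>c. F C y = sv c x}" by (auto simp: F_lin c c' simp flip: scale_left_distrib)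
  qed
  moreover have "(\<lambda>g. act g x) ` G \<subseteq> {y. \<exists>c. F C y = sv c x}" using scal xW(1) by blast
  ultimately have "span ((\<lambda>g. act g x) ` G) \<subseteq> {y. \<exists>c. F C y = sv c x}" by (intro span_minimal)
  then show ?thesis using irr_span[OF assms(1), of x] xW WV v by (auto simp: x_def)
qed

section \<open>Whittaker functionals and the companion matrices they detect\<close>

definition whit :: "('v \<Rightarrow> complex) \<Rightarrow> bool" where
  "whit \<omega> \<longleftrightarrow> (\<forall>v w. \<omega> (v + w) = \<omega> v + \<omega> w) \<and> (\<forall>c v. \<omega> (sv c v) = c * \<omega> v) \<and>
     (\<forall>u\<in>UU n. \<forall>v\<in>V. \<omega> (act u v) = \<phi> (sd n u) * \<omega> v)"

lemma whitD:
  assumes "whit \<omega>"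
  shows "\<omega> (v + w) = \<omega> v + \<omega> w" "\<omega> (sv c v) = c * \<omega> v"
    "u \<in> UU n \<Longrightarrow> v \<in> V \<Longrightarrow> \<omega> (act u v) = \<phi> (sd n u) * \<omega> v"
    "\<omega> (\<Sum>i\<in>K. f i) = (\<Sum>i\<in>K. \<omega> (f i))"
proof -
  show *: "\<omega> (v + w) = \<omega> v + \<omega> w" "\<omega> (sv c v) = c * \<omega> v"
    "u \<in> UU n \<Longrightarrow> v \<in> V \<Longrightarrow> \<omega> (act u v) = \<phi> (sd n u) * \<omega> v" for v w c u
    using assms by (auto simp: whit_def)
  have "\<omega> 0 = 0" using *(2)[of 0 0] by simp
  then show "\<omega> (\<Sum>i\<in>K. f i) = (\<Sum>i\<in>K. \<omega> (f i))"
    by (induction K rule: infinite_finite_induct) (auto simp: *)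
qed

lemma E_nn_UU: "a \<in> nn n \<Longrightarrow> E a \<in> UU n" "a \<in> nn n \<Longrightarrow> sd n (E a) = \<pi> ^ m * sd n a"
  by (auto simp: UU_def E_def sd_nn_mult)

text \<open>Strictly upper triangular elements of level \<open>M\<close> act on
  \<open>PP M X v\<close> through \<open>X\<close>, and under \<open>\<omega>\<close> through the
  standard character. Comparison makes \<open>X\<close> a Hessenberg matrix with ones below the
  diagonal, modulo \<open>\<pi> ^ m\<close>.\<close>

lemma whit_companion:
  assumes w: "whit \<omega>" and v: "v \<in> V" "\<omega> v \<noteq> 0"
  obtains C x where "companion n C" "x \<in> V" "\<omega> (PP M C x) \<noteq> 0"
proof -
  obtain N where N: "N \<noteq> 0" "\<And>v. (\<Sum>X\<in>A. PP M X v) = sv N v" by (rule PP_sum[OF lM]) blast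
  have "(\<Sum>X\<in>A. \<omega> (PP M X v)) \<noteq> 0"
    using N v whitD(2)[OF w] by (simp flip: whitD(4)[OF w])
  then obtain X where X: "X \<in> A" "\<omega> (PP M X v) \<noteq> 0" by (meson sum.neutral)
  have eq: "scl (\<pi> ^ M) X = scl (\<pi> ^ M) (mk n (\<lambda>i j. if i = Suc j then 1 else if Suc j < i then 0 else ent X i j))"
    (is "_ = scl _ ?X'")
  proof (rule Mn_eqI[of _ n])
    fix i j assume ij: "i < n" "j < n"
    show "ent (scl (\<pi> ^ M) X) i j = ent (scl (\<pi> ^ M) ?X') i j"
    proof (cases "j < i")
      case True
      define \<delta> :: 'r where "\<delta> = (if i = Suc j then 1 else 0)"
      have "\<phi> ((\<pi> ^ M * (ent X i j - \<delta>)) * c) = 1" for c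
      proof -
        define a where "a = eij n j i c"
        have a: "a \<in> nn n" using True by (auto simp: a_def nn_def ent_eij)
        have sda: "sd n a = \<delta> * c"
        proof -
          have "sd n a = (\<Sum>k<n - 1. if k = j then \<delta> * c else 0)"
            unfolding sd_def using ij by (intro sum.cong) (auto simp: a_def ent_eij \<delta>_def)
          also have "\<dots> = \<delta> * c" using ij True by auto
          finally show ?thesis .
        qed
        have HU: "H M a \<in> UU n" using a by (auto simp: H_def UU_def)
        have "\<phi> (sd n (H M a)) * \<omega> (PP M X v) = Psi (scl (\<pi> ^ M) (X * a)) * \<omega> (PP M X v)"
          using whitD(3)[OF w HU PP_V[OF lM v(1)], of X] PP_eig[OF lM nn_Mn[OF a], of X v] whitD(2)[OF w] by auto
        then have "\<phi> (\<pi> ^ M * (\<delta> * c)) = \<phi> (\<pi> ^ M * (c * ent X i j))"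
          using X(2) mtr_eij[OF ij, of X c] by (simp add: Psi_def H_def sda[unfolded a_def] a_def)
        moreover have "(\<pi> ^ M * (ent X i j - \<delta>)) * c = \<pi> ^ M * (c * ent X i j) - \<pi> ^ M * (\<delta> * c)"
          by (simp add: algebra_simps)
        ultimately show ?thesis by (simp only: phi_diff) (simp add: phi_nz)
      qed
      then have "\<pi> ^ M * (ent X i j - \<delta>) = 0" by (rule phi_nondeg)
      then show ?thesis using ij True by (auto simp: ent_mk \<delta>_def algebra_simps)
    next
      case False
      then show ?thesis using ij by (simp add: ent_mk)
    qed
  qed (use X in auto)
  obtain u where u: "u \<in> UU n" "companion n (ginv u * ?X' * u)"
    by (rule Hessenberg_conj[of ?X' n]) (use n0 in \<open>auto simp: ent_mk\<close>)
  define C where "C = ginv u * ?X' * u"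
  have uG: "u \<in> G" using u by auto
  have CA: "C \<in> A" using uG by (auto simp: C_def)
  have "u * C * ginv u = ?X'" using uG by (simp add: C_def mult.assoc)
  then have "PP M X v = act u (PP M C (act (ginv u) v))"
    using PP_conj[OF lM uG CA, of "act (ginv u) v"] PP_cong[OF eq] uG
    by (simp add: act_one flip: act_mult)
  moreover have gv: "act (ginv u) v \<in> V" using uG v actV by auto
  ultimately have "\<omega> (PP M C (act (ginv u) v)) \<noteq> 0"
    using X(2) whitD(3)[OF w u(1) PP_V[OF lM gv]] by auto
  then show ?thesis using that u(2) gv by (auto simp: C_def)
qed

text \<open>The characters of \<open>1 + \<pi>\<^sup>m ZC C\<close> extending that of the congruence subgroup are parametrized by
  changing the last column of \<open>C\<close> modulo \<open>\<pi>\<^sup>m\<close>.\<close>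

lemma whit_F:
  assumes w: "whit \<omega>" and v: "v \<in> V" "\<omega> v \<noteq> 0"
  obtains C x where "companion n C" "x \<in> V" "\<omega> (F C x) \<noteq> 0"
proof -
  obtain C x where C: "companion n C" and x: "x \<in> V" "\<omega> (PP M C x) \<noteq> 0" using whit_companion[OF assms] .
  have Cm: "C \<in> A" using C companion_Mn by blast
  define y where "y = PP M C x"
  have y: "y \<in> V" "\<omega> y \<noteq> 0" using x PP_V[OF lM] by (auto simp: y_def)
  have yH: "act (E (scl (\<pi> ^ h) b)) y = sv (ch C (scl (\<pi> ^ h) b)) y" if "b \<in> A" for b
    using PP_eig[OF lM that, of C x] by (simp add: y_def H_M ch_def pi_mM)
  \<comment> \<open>\<open>R s\<close> isolates in \<open>y\<close> the character of the centralizer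
    given by the perturbed companion matrix; all these perturbations restrict to the same character
    at level \<open>M\<close>.\<close>
  define R where "R s = avg (ZC n C) (\<lambda>r. inverse (ch (C + scl (\<pi> ^ m) s) r)) E y" for s
  \<comment> \<open>The centralizer elements on which all perturbed characters coincide. They are
    divisible by \<open>\<pi> ^ h\<close>, so they act on \<open>y\<close> by a known scalar and the
    sum of all \<open>R s\<close> is a nonzero multiple of \<open>y\<close>.\<close>
  define Y where "Y = {r \<in> ZC n C. scl (\<pi> ^ m * \<pi> ^ m) r = 0}"
  have finZ: "finite (ZC n C)" by (rule finite_subset[of _ A]) (use ZC_Mn in auto)
  have finY: "finite Y" "0 \<in> Y" using finZ by (auto simp: Y_def)
  have "(\<Sum>s\<in>BB. R s) = sv (of_nat (card BB * card Y)) y"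
  proof -
    have "(\<Sum>s\<in>BB. R s) = (\<Sum>r\<in>ZC n C. sv (\<Sum>s\<in>BB. inverse (ch (C + scl (\<pi> ^ m) s) r)) (act (E r) y))"
      unfolding R_def avg_def by (subst sum.swap) (simp add: scale_sum_left)
    also have "\<dots> = (\<Sum>r\<in>ZC n C. if r \<in> Y then sv (of_nat (card BB)) y else 0)"
    proof (rule sum.cong)
      fix r assume r: "r \<in> ZC n C"
      define \<chi> where "\<chi> s = Psi (scl (\<pi> ^ m * \<pi> ^ m) (s * - r))" for s
      have "inverse (ch (C + scl (\<pi> ^ m) s) r) = inverse (ch C r) * \<chi> s" for s
        by (simp add: ch_def \<chi>_def distrib_right scl_distribs Psi_simps)
      then have e: "(\<Sum>s\<in>BB. inverse (ch (C + scl (\<pi> ^ m) s) r)) = inverse (ch C r) * (\<Sum>s\<in>BB. \<chi> s)"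
        by (simp add: sum_distrib_left)
      show "sv (\<Sum>s\<in>BB. inverse (ch (C + scl (\<pi> ^ m) s) r)) (act (E r) y) = (if r \<in> Y then sv (of_nat (card BB)) y else 0)"
      proof (cases "r \<in> Y")
        case True
        then have r0: "scl (\<pi> ^ (2 * m)) r = 0" by (simp add: Y_def pi_mM)
        have l2m: "2 * m \<le> l" "l - 2 * m = h" using mMh by auto
        obtain b where b: "b \<in> A" "r = scl (\<pi> ^ h) b" using Mn_ann[OF ZC_Mn[OF r] l2m(1) r0] l2m by auto
        have "\<chi> s = 1" for s
          using r0 by (simp add: \<chi>_def Psi_simps pi_mM flip: scl_simps(2))
        then have "(\<Sum>s\<in>BB. inverse (ch (C + scl (\<pi> ^ m) s) r)) = inverse (ch C r) * of_nat (card BB)"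
          unfolding e by simp
        moreover have "act (E r) y = sv (ch C r) y" using yH[OF b(1)] b(2) by simp
        ultimately show ?thesis using True ch_nz[of C r] by simp
      next
        case False
        have "\<exists>s\<in>BB. \<chi> s \<noteq> 1"
        proof (rule ccontr)
          assume "\<not> (\<exists>s\<in>BB. \<chi> s \<noteq> 1)"
          then have "scl (\<pi> ^ m * \<pi> ^ m) (- r) = 0"
            using r by (intro BB_sum_ann[OF C]) (auto simp: \<chi>_def simp del: scl_simps(8) mult_minus_right)
          then show False using False r by (simp add: Y_def)
        qed
        then obtain s where "s \<in> BB" "\<chi> s \<noteq> 1" by blast
        then have "(\<Sum>s\<in>BB. \<chi> s) = 0"
          by (intro char_sum_zero[where ?d0.0 = s])
            (auto simp: \<chi>_def distrib_right scl_distribs Psi_simps)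
        then show ?thesis using False e by simp
      qed
    qed simp
    also have "\<dots> = (\<Sum>r\<in>Y. sv (of_nat (card BB)) y)"
      using finZ by (intro sum.mono_neutral_cong_right) (auto simp: Y_def)
    finally show ?thesis by (simp add: sum_constant_scale mult.commute)
  qed
  moreover have "card BB * card Y \<noteq> 0" using finY BB_closed(1) by auto
  ultimately have "(\<Sum>s\<in>BB. \<omega> (R s)) \<noteq> 0"
    using y whitD(2)[OF w] by (simp flip: whitD(4)[OF w])
  then obtain s where s: "s \<in> BB" "\<omega> (R s) \<noteq> 0" by (meson sum.neutral)
  define C' where "C' = C + scl (\<pi> ^ m) s"
  have C': "companion n C'" unfolding C'_def by (rule companion_BB[OF C s(1)])
  have "scl (\<pi> ^ M) C = scl (\<pi> ^ M) C'" by (simp add: C'_def scl_distribs pi_mM)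
  then have LLC: "LL C' = LL C" using LL_mod[OF C C'] by simp
  define x' where "x' = R s"
  have x'V: "x' \<in> V" unfolding x'_def R_def using y(1) ZC_Mn by (intro avg_V) blast+
  have EZ: "E r \<in> G" if "r \<in> ZC n C" for r using that ZC_Mn by blast
  have xr: "act (E r) x' = sv (ch C' r) x'" if r: "r \<in> ZC n C" for r
  proof -
    have com: "E r * E r' = E (r + r')" if "r' \<in> ZC n C" for r'
      using ZC_commute'[OF C r that] by (simp add: E_mult)
    have "act (E r) x' = avg (ZC n C) (\<lambda>r. inverse (ch C' r)) (\<lambda>r'. E r * E r') y"
      unfolding x'_def R_def C'_def[symmetric] by (rule avg_act(1)) (use EZ r in auto)
    also have "\<dots> = sv (ch C' r) x'"
      unfolding x'_def R_def C'_def[symmetric]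
    proof (rule avg_reindex)
      show "bij_betw (\<lambda>r'. r + r') (ZC n C) (ZC n C)"
        by (rule bij_betw_byWitness[where f' = "\<lambda>y. y - r"]) (use r in auto)
    qed (use com in \<open>auto simp: ch_def distrib_left scl_distribs Psi_simps\<close>)
    finally show ?thesis .
  qed
  have xh: "act (E (scl (\<pi> ^ h) b)) x' = sv (ch C' (scl (\<pi> ^ h) b)) x'" if b: "b \<in> A" for b
  proof -
    have "ch C' (scl (\<pi> ^ h) b) = ch C (scl (\<pi> ^ h) b)"
    proof -
      have "\<pi> ^ m * (\<pi> ^ h * \<pi> ^ m) = 0" by (metis mult.commute pi_mM(1,8))
      then show ?thesis by (simp add: ch_def C'_def pi_mM distrib_right scl_distribs)
    qed
    moreover have "act (E (scl (\<pi> ^ h) b)) x' = sv (ch C (scl (\<pi> ^ h) b)) x'"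
    proof -
      have "act (E (scl (\<pi> ^ h) b)) (act (E r) y) = act (E r) (sv (ch C (scl (\<pi> ^ h) b)) y)" if "r \<in> ZC n C" for r
        using EZ[OF that] b by (simp add: E_add_high flip: act_mult yH)
      then show ?thesis unfolding x'_def R_def avg_def
        using b EZ by (simp add: act_sum act_sv scale_sum_right mult.commute)
    qed
    ultimately show ?thesis by simp
  qed
  \<comment> \<open>Three equivariances combine: \<open>\<omega>\<close> handles the strictly upper
    triangular part, while \<open>x'\<close> is an eigenvector for the centralizer and for level
    \<open>M\<close>. Hence every term of \<open>\<omega> (F C' x')\<close> equals
    \<open>\<omega> x'\<close>.\<close>
  have "\<omega> (act (E w') x') = ch C' w' * \<omega> x'" if w': "w' \<in> LL C'" for w'
  proof -
    obtain a r b where *: "a \<in> nn n" "r \<in> ZC n C" "b \<in> A" "w' = a + r + scl (\<pi> ^ h) b"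
      using w' unfolding LLC by (elim LL_E)
    have aA: "a \<in> A" and rA: "r \<in> A" using * nn_Mn ZC_Mn by blast+
    define d where "d = a * r - r * a"
    have dA: "d \<in> A" using aA rA by (auto simp: d_def)
    \<comment> \<open>Shifting the level \<open>M\<close> part by the bracket of \<open>a\<close>
      and \<open>r\<close> makes \<open>E w'\<close> factor exactly.\<close>
    define q where "q = b - scl (hf * \<pi> ^ (m - h)) d"
    have qA: "q \<in> A" using * dA by (auto simp: q_def)
    have hq: "scl (\<pi> ^ h) q = scl (\<pi> ^ h) b - scl (hf * \<pi> ^ m) d"
      using mMh(5) by (simp add: q_def scl_distribs mult.left_commute flip: power_add)
    have e: "E w' = E a * E r * E (scl (\<pi> ^ h) q)"
    proof -
      have "E a * E r * E (scl (\<pi> ^ h) q) = E (a + r + scl (hf * \<pi> ^ m) d + scl (\<pi> ^ h) q)"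
        by (simp only: E_mult[of a r] E_add_high(1) d_def)
      then show ?thesis by (simp add: hq *(4))
    qed
    have rV: "act (E r) x' \<in> V" using x'V EZ *(2) actV by blast
    have "\<omega> (act (E w') x') = \<omega> (act (E a) (act (E r) (act (E (scl (\<pi> ^ h) q)) x')))"
      unfolding e using aA EZ[OF *(2)] qA by (simp add: act_mult)
    also have "\<dots> = ch C' (scl (\<pi> ^ h) q) * (\<phi> (\<pi> ^ m * sd n a) * (ch C' r * \<omega> x'))"
      using xh[OF qA] xr[OF *(2)] EZ[OF *(2)] aA whitD(3)[OF w E_nn_UU(1)[OF *(1)] x'V] E_nn_UU(2)[OF *(1)]
      by (simp add: act_sv whitD(2)[OF w] mult_ac)
    also have "\<phi> (\<pi> ^ m * sd n a) = ch C' a"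
      by (simp add: ch_def Psi_def mtr_companion_nn[OF C' *(1)])
    also have "ch C' (scl (\<pi> ^ h) q) * (ch C' a * (ch C' r * \<omega> x')) = ch C' (a + r + scl (\<pi> ^ h) q) * \<omega> x'"
      by (simp add: ch_def distrib_left scl_distribs Psi_simps)
    also have "ch C' (a + r + scl (\<pi> ^ h) q) = ch C' w' * inverse (ch C' (scl (hf * \<pi> ^ m) d))"
      by (simp add: hq *(4) ch_def distrib_left right_diff_distrib scl_distribs Psi_simps)
    also have "ch C' (scl (hf * \<pi> ^ m) d) = 1"
    proof -
      have "\<pi> ^ m * (\<pi> ^ m * mtr n (C' * d)) = 0"
        unfolding d_def by (rule LL_isotropic[OF C']) (use * LL_sub LLC in auto)
      then have "\<pi> ^ m * (hf * (\<pi> ^ m * mtr n (C' * d))) = 0" by (metis mult.left_commute mult_zero_right)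
      then show ?thesis by (simp add: ch_def Psi_def phi_0 mult.assoc)
    qed
    finally show ?thesis by simp
  qed
  then have "\<omega> (F C' x') = (\<Sum>w\<in>LL C'. \<omega> x')"
    by (simp add: F_def avg_def whitD[OF w] ch_nz flip: mult.assoc)
  also have "\<dots> = of_nat (card (LL C')) * \<omega> x'" by simp
  finally have "\<omega> (F C' x') \<noteq> 0"
    using s LL_closed(1)[of C'] by (auto simp: x'_def)
  then show ?thesis using that C' x'V by blast
qed

text \<open>The combination of \<open>\<omega>\<close> and \<open>\<mu>\<close> that vanishes at
  \<open>F C x\<close> is again a Whittaker functional. Were it nonzero, it would be nonzero on the
  image of some \<open>F C'\<close>; but that image is the line through
  \<open>F C x\<close>.\<close>

theorem multiplicity_one:
  assumes irr and fin: "finite B" "V \<subseteq> span B" and w: "whit \<omega>" "whit \<mu>"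
    and v: "v \<in> V" "v' \<in> V"
  shows "\<omega> v * \<mu> v' = \<omega> v' * \<mu> v"
proof (cases "\<exists>v\<in>V. \<omega> v \<noteq> 0")
  case True
  then obtain C x where C: "companion n C" and x: "x \<in> V" "\<omega> (F C x) \<noteq> 0"
    using whit_F[OF w(1)] by metis
  have "\<omega> 0 = 0" using whitD(2)[OF w(1), of 0 0] by simp
  then have Fx: "F C x \<noteq> 0" using x by auto
  \<comment> \<open>The orbit of \<open>F C x\<close> spans \<open>V\<close>, so some compressed
    operator from \<open>F C\<close> to \<open>F C'\<close> is nonzero, and intertwining identifies
    the two.\<close>
  have same: "F C' = F C" if "companion n C'" "x' \<in> V" "F C' x' \<noteq> 0" for C' x'
  proof -
    have V: "V = span ((\<lambda>g. act g (F C x)) ` G)"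
      using irr_span[OF assms(1) F_V Fx] x by blast
    have "\<exists>g\<in>G. F C' (act g (F C x)) \<noteq> 0"
    proof (rule ccontr)
      assume "\<not> ?thesis"
      then have "(\<lambda>g. act g (F C x)) ` G \<subseteq> {y. F C' y = 0}" by auto
      moreover have "subspace {y. F C' y = 0}" by (auto simp: subspace_def F_0 F_lin)
      ultimately have "V \<subseteq> {y. F C' y = 0}" unfolding V by (rule span_minimal)
      then show False using that by blast
    qed
    then show ?thesis using F_intertwine(1)[OF that(1) C] by blast
  qed
  define \<kappa> where "\<kappa> v = \<mu> (F C x) * \<omega> v - \<omega> (F C x) * \<mu> v" for v
  have \<kappa>: "whit \<kappa>"
    unfolding whit_def
  proof (intro conjI allI ballI)
    show "\<kappa> (v + w) = \<kappa> v + \<kappa> w" for v w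
      by (simp add: \<kappa>_def whitD(1)[OF w(1)] whitD(1)[OF w(2)] algebra_simps)
    show "\<kappa> (sv c v) = c * \<kappa> v" for c v
      by (simp add: \<kappa>_def whitD(2)[OF w(1)] whitD(2)[OF w(2)] algebra_simps)
    show "\<kappa> (act u v) = \<phi> (sd n u) * \<kappa> v" if "u \<in> UU n" "v \<in> V" for u v
      by (simp add: \<kappa>_def whitD(3)[OF w(1) that] whitD(3)[OF w(2) that] algebra_simps)
  qed
  have "\<kappa> v = 0" if vV: "v \<in> V" for v
  proof (rule ccontr)
    assume "\<kappa> v \<noteq> 0"
    then obtain C' y where y: "companion n C'" "y \<in> V" "\<kappa> (F C' y) \<noteq> 0" using whit_F[OF \<kappa> vV] by metis
    have "\<kappa> 0 = 0" using whitD(2)[OF \<kappa>, of 0 0] by simp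
    then have "F C' y \<noteq> 0" using y by auto
    then have "F C' = F C" using same y by blast
    moreover obtain c where "F C y = sv c (F C x)"
      using F_one_dim[OF assms(1) fin C x(1) Fx y(2)] by blast
    ultimately show False using y(3) whitD(2)[OF w(1)] whitD(2)[OF w(2)] by (simp add: \<kappa>_def)
  qed
  from this[OF v(1)] this[OF v(2)] have
    e: "\<mu> (F C x) * \<omega> v = \<omega> (F C x) * \<mu> v" "\<mu> (F C x) * \<omega> v' = \<omega> (F C x) * \<mu> v'"
    by (auto simp: \<kappa>_def)
  have "\<omega> (F C x) * (\<omega> v * \<mu> v') = \<omega> v * (\<omega> (F C x) * \<mu> v')" by (simp only: mult_ac)
  also have "\<dots> = \<omega> v' * (\<mu> (F C x) * \<omega> v)" unfolding e(2)[symmetric] by (simp only: mult_ac)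
  also have "\<dots> = \<omega> (F C x) * (\<omega> v' * \<mu> v)" unfolding e(1) by (simp only: mult_ac)
  finally have "\<omega> (F C x) * (\<omega> v * \<mu> v') = \<omega> (F C x) * (\<omega> v' * \<mu> v)" .
  then show ?thesis using x(2) by simp
qed (use v in auto)

section \<open>Existence of Whittaker functionals\<close>

lemma nn_ann:
  assumes "a \<in> nn n" "k \<le> l" "scl (\<pi> ^ k) a = 0"
  obtains y where "y \<in> nn n" "a = scl (\<pi> ^ (l - k)) y"
proof -
  obtain y where y: "y \<in> A" "a = scl (\<pi> ^ (l - k)) y" using Mn_ann[OF nn_Mn] assms by metis
  define y' where "y' = mk n (\<lambda>i j. if j \<le> i then 0 else ent y i j)"
  have "y' \<in> nn n" by (auto simp: y'_def nn_def ent_mk)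
  moreover have "a = scl (\<pi> ^ (l - k)) y'"
  proof (rule Mn_eqI[of _ n])
    fix i j assume "i < n" "j < n"
    moreover have "ent a i j = 0" if "j \<le> i" using assms(1) that by (simp add: nn_def)
    moreover have "ent a i j = \<pi> ^ (l - k) * ent y i j" by (simp add: y(2))
    ultimately show "ent a i j = ent (scl (\<pi> ^ (l - k)) y') i j" by (auto simp: y'_def ent_mk)
  qed (use assms nn_Mn in \<open>auto simp: y'_def\<close>)
  ultimately show ?thesis using that by blast
qed

text \<open>The first column of a strictly upper triangular matrix is zero, and it determines an
  element of the centralizer.\<close>

lemma nn_commute_ann:
  assumes C: "companion n C" and a: "a \<in> nn n" and k: "scl \<kappa> (C * a - a * C) = 0"
  shows "scl \<kappa> a = 0"
proof (rule ZC_eq_0[OF C])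
  show "scl \<kappa> a \<in> ZC n C" using k a nn_Mn by (auto simp: ZC_def scl_distribs)
  have "ent a i 0 = 0" for i using a by (simp add: nn_def)
  then show "ap (scl \<kappa> a) (unitv 0) = (\<lambda>i. 0)" by (simp add: fun_eq_iff flip: ent_def)
qed

text \<open>The projection of \<open>x\<close> itself may vanish, so the translates
  \<open>act (E y) x\<close> are tried together. The sum of their projections, translated back, is a
  nonzero multiple of \<open>x\<close>: only level \<open>M\<close> elements of \<open>UU n\<close>
  contribute, and there the character of \<open>C\<close> is the Whittaker character.\<close>

lemma whit_exists:
  assumes C: "companion n C" and x: "x \<noteq> 0"
    and eig: "\<And>b. b \<in> A \<Longrightarrow> act (H M b) x = sv (Psi (scl (\<pi> ^ M) (C * b))) x"
  obtains y where "y \<in> G" "avg (UU n) (\<lambda>u. inverse (\<phi> (sd n u))) (\<lambda>u. u) (act y x) \<noteq> 0"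
proof -
  have Cm: "C \<in> A" using C companion_Mn by blast
  define x' where "x' u y = act (E (- y) * u * E y) x" for u y
  define T where "T u = (\<Sum>y\<in>A. x' u y)" for u
  define S where "S = {u \<in> UU n. \<exists>a\<in>nn n. u = E (scl (\<pi> ^ h) a)}"
  have HMs: "H M b * E y = E y * H M b" for b y
    by (simp add: H_M E_add_high)
  \<comment> \<open>Shifting \<open>y\<close> by \<open>\<pi> ^ h b\<close> rescales the sum, so
    \<open>T u\<close> vanishes unless \<open>u\<close> commutes with \<open>C\<close> modulo
    \<open>\<pi> ^ m\<close>; then \<open>u = E a\<close> with \<open>a\<close> strictly upper
    triangular. A second character sum, over all \<open>y\<close>, shows that \<open>a\<close> is
    divisible by \<open>\<pi> ^ h\<close>.\<close>
  have T0: "u \<in> S" if u: "u \<in> UU n" and nz: "T u \<noteq> 0" for u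
  proof -
    have uG: "u \<in> G" using u by auto
    define K where "K = C - u * C * ginv u"
    have "scl (\<pi> ^ M) K = 0"
    proof (rule Psi_nondeg)
      show "scl (\<pi> ^ M) K \<in> A" using Cm uG by (auto simp: K_def)
      fix b :: "'r lmap" assume b: "b \<in> A"
      define b' where "b' = ginv u * (- b) * u"
      have b': "b' \<in> A" using b uG by (auto simp: b'_def)
      have step: "x' u (y + scl (\<pi> ^ h) b) = sv (Psi (scl (\<pi> ^ M) K * b)) (x' u y)" if y: "y \<in> A" for y
      proof -
        have G: "E y \<in> G" "E (- y) \<in> G" "H M (b' + b) \<in> G" using y b b' H_G[OF lM] by auto
        have "E (y + scl (\<pi> ^ h) b) = E y * H M b" "E (- (y + scl (\<pi> ^ h) b)) = E (- y) * H M (- b)"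
          using E_add_high(1)[of y b] E_add_high(1)[of "- y" "- b"] by (simp_all add: H_M)
        then have "E (- (y + scl (\<pi> ^ h) b)) * u * E (y + scl (\<pi> ^ h) b) = E (- y) * (H M (- b) * u) * (E y * H M b)"
          by (simp only: mult.assoc)
        also have "H M (- b) * u = u * H M b'"
          using H_conj[OF uG, of M b'] uG by (simp add: b'_def mult.assoc)
        also have "E (- y) * (u * H M b') * (E y * H M b) = E (- y) * u * (H M b' * E y) * H M b"
          by (simp only: mult.assoc)
        also have "\<dots> = E (- y) * u * E y * (H M b' * H M b)"
          unfolding HMs by (simp only: mult.assoc)
        also have "H M b' * H M b = H M (b' + b)" by (rule H_mult[OF lM])
        finally have "x' u (y + scl (\<pi> ^ h) b) = act (E (- y) * u * E y) (act (H M (b' + b)) x)"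
          unfolding x'_def using G uG by (simp add: act_mult)
        also have "\<dots> = sv (Psi (scl (\<pi> ^ M) (C * (b' + b)))) (x' u y)"
          using eig[of "b' + b"] b b' G uG by (simp add: act_sv x'_def)
        also have "Psi (scl (\<pi> ^ M) (C * (b' + b))) = Psi (scl (\<pi> ^ M) K * b)"
        proof -
          have "u * (C * (ginv u * b * u)) * ginv u = u * C * ginv u * b" using uG by (simp add: mult.assoc)
          then have "mtr n (C * (ginv u * b * u)) = mtr n (u * C * ginv u * b)"
            using mtr_conj[OF uG, of "C * (ginv u * b * u)"] Cm b uG by auto
          then have "mtr n (C * (b' + b)) = mtr n (K * b)"
            by (simp add: b'_def K_def left_diff_distrib right_diff_distrib)
          then show ?thesis by (simp add: Psi_def)
        qed
        finally show ?thesis .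
      qed
      have "T u = (\<Sum>y\<in>A. x' u (y + scl (\<pi> ^ h) b))"
        unfolding T_def
        by (rule sum.reindex_bij_witness[of _ "\<lambda>y. y + scl (\<pi> ^ h) b" "\<lambda>y. y - scl (\<pi> ^ h) b"]) (use b in auto)
      also have "\<dots> = sv (Psi (scl (\<pi> ^ M) K * b)) (T u)"
        by (simp only: step T_def scale_sum_right cong: sum.cong)
      finally have "sv (Psi (scl (\<pi> ^ M) K * b)) (T u) = sv 1 (T u)" by simp
      then show "Psi (scl (\<pi> ^ M) K * b) = 1" using nz scale_right_imp_eq by blast
    qed
    then have "scl (\<pi> ^ M) K * u = 0" by simp
    then have "scl (\<pi> ^ M) (C * u - u * C) = 0" using uG by (simp add: K_def left_diff_distrib mult.assoc)
    then have "scl (\<pi> ^ M) (C * (u - 1) - (u - 1) * C) = 0" by (simp add: algebra_simps)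
    then have "scl (\<pi> ^ M) (u - 1) = 0" by (rule nn_commute_ann[OF C UU_minus[OF u]])
    moreover have lm: "M \<le> l" "l - M = m" "2 * m \<le> l" "l - 2 * m = h" using mMh by auto
    ultimately obtain a1 where a1: "a1 \<in> nn n" "u - 1 = scl (\<pi> ^ m) a1"
      using nn_ann[OF UU_minus[OF u] lm(1)] by metis
    define a where "a = a1 - scl (hf * \<pi> ^ m) (a1 * a1)"
    have a: "a \<in> nn n" using a1 by (auto simp: a_def)
    have aA: "a \<in> A" using a nn_Mn by blast
    have uE: "u = E a"
    proof -
      have "u = 1 + scl (\<pi> ^ m) a1" using a1(2) by (simp add: algebra_simps)
      then show ?thesis by (simp add: E_surj a_def)
    qed
    have "x' u y = sv (Psi (y * scl (\<pi> ^ m * \<pi> ^ m) (C * a - a * C))) (act u x)" if y: "y \<in> A" for y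
    proof -
      define d where "d = a * y - y * a"
      have dA: "scl (\<pi> ^ (m - h)) d \<in> A" using aA y by (auto simp: d_def)
      have "E (scl (\<pi> ^ m) d) = H M (scl (\<pi> ^ (m - h)) d)"
        using mMh(5) by (simp add: H_M flip: power_add)
      moreover have "E (- y) * u * E y = u * E (scl (\<pi> ^ m) d)"
        using E_commutator[of a y] E_inverse(2)[of y]
        by (simp add: uE d_def mult.assoc) (simp flip: mult.assoc)
      ultimately have "x' u y = act u (act (H M (scl (\<pi> ^ (m - h)) d)) x)"
        unfolding x'_def using uG H_G[OF lM dA] by (simp add: act_mult)
      also have "\<dots> = sv (Psi (scl (\<pi> ^ M * \<pi> ^ (m - h)) (C * d))) (act u x)"
        using eig[OF dA] uG by (simp add: act_sv)
      also have "\<pi> ^ M * \<pi> ^ (m - h) = \<pi> ^ m * \<pi> ^ m"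
        using mMh(2,5) by (simp flip: power_add)
      also have "Psi (scl (\<pi> ^ m * \<pi> ^ m) (C * d)) = Psi (y * scl (\<pi> ^ m * \<pi> ^ m) (C * a - a * C))"
      proof -
        have "mtr n ((C * a) * y) = mtr n (y * (C * a))" "mtr n ((C * y) * a) = mtr n (a * (C * y))"
          "mtr n ((a * C) * y) = mtr n (y * (a * C))"
          using Cm aA y by (auto intro!: mtr_commute)
        then show ?thesis by (simp add: Psi_def d_def right_diff_distrib mult.assoc)
      qed
      finally show ?thesis .
    qed
    then have "T u = sv (\<Sum>y\<in>A. Psi (y * scl (\<pi> ^ m * \<pi> ^ m) (C * a - a * C))) (act u x)"
      by (simp add: T_def scale_sum_left)
    then have "(\<Sum>y\<in>A. Psi (y * scl (\<pi> ^ m * \<pi> ^ m) (C * a - a * C))) \<noteq> 0" using nz by auto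
    then have "scl (\<pi> ^ m * \<pi> ^ m) (C * a - a * C) = 0"
      using Psi_sum[of "scl (\<pi> ^ m * \<pi> ^ m) (C * a - a * C)"] Cm aA by (auto split: if_splits)
    then have "scl (\<pi> ^ (2 * m)) a = 0" using nn_commute_ann[OF C a] by (simp add: pi_mM)
    then obtain a3 where "a3 \<in> nn n" "a = scl (\<pi> ^ h) a3" using nn_ann[OF a lm(3)] lm(4) by metis
    then show ?thesis using u uE by (auto simp: S_def)
  qed
  have T1: "sv (inverse (\<phi> (sd n u))) (T u) = sv (of_nat (card A)) x" if u: "u \<in> S" for u
  proof -
    obtain a where a: "a \<in> nn n" "u = H M a" using u by (auto simp: S_def H_M)
    have aA: "a \<in> A" using a nn_Mn by blast
    have "x' u y = sv (\<phi> (sd n u)) x" if "y \<in> A" for y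
    proof -
      have "E (- y) * u * E y = u"
        using HMs[of a y] E_inverse(2)[of y] by (simp add: a(2) mult.assoc) (simp flip: mult.assoc)
      then have "x' u y = sv (Psi (scl (\<pi> ^ M) (C * a))) x" using eig[OF aA] by (simp add: x'_def a(2))
      also have "Psi (scl (\<pi> ^ M) (C * a)) = \<phi> (sd n u)"
        using mtr_companion_nn[OF C a(1)] by (simp add: Psi_def a(2) H_def)
      finally show ?thesis .
    qed
    then show ?thesis by (simp add: T_def phi_nz sum_constant_scale)
  qed
  have "(\<Sum>u\<in>UU n. sv (inverse (\<phi> (sd n u))) (T u)) = (\<Sum>u\<in>S. sv (of_nat (card A)) x)"
    by (rule sum.mono_neutral_cong_right) (use T0 T1 in \<open>auto simp: S_def\<close>)
  also have "\<dots> = sv (of_nat (card S * card A)) x" by (simp add: sum_constant_scale)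
  also have "\<dots> \<noteq> 0"
  proof -
    have "finite S" "1 \<in> S" by (auto simp: S_def intro!: bexI[of _ 0])
    then have "card S \<noteq> 0" by auto
    moreover have "card A \<noteq> 0" by (metis card_A less_irrefl)
    ultimately show ?thesis using x by (simp del: card_0_eq card_gt_0_iff card_eq_0_iff)
  qed
  also have "(\<Sum>u\<in>UU n. sv (inverse (\<phi> (sd n u))) (T u))
    = (\<Sum>y\<in>A. act (E (- y)) (avg (UU n) (\<lambda>u. inverse (\<phi> (sd n u))) (\<lambda>u. u) (act (E y) x)))"
  proof -
    have "act (E (- y)) (avg (UU n) (\<lambda>u. inverse (\<phi> (sd n u))) (\<lambda>u. u) (act (E y) x))
      = (\<Sum>u\<in>UU n. sv (inverse (\<phi> (sd n u))) (x' u y))" if "y \<in> A" for y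
      using that by (simp add: avg_def x'_def act_sum act_sv act_mult)
    then show ?thesis
      unfolding T_def by (simp add: scale_sum_right) (subst sum.swap, simp)
  qed
  finally obtain y where y: "y \<in> A"
    "act (E (- y)) (avg (UU n) (\<lambda>u. inverse (\<phi> (sd n u))) (\<lambda>u. u) (act (E y) x)) \<noteq> 0"
    by (meson sum.neutral)
  then have "avg (UU n) (\<lambda>u. inverse (\<phi> (sd n u))) (\<lambda>u. u) (act (E y) x) \<noteq> 0"
    using act_0[of "E (- y)"] by auto
  then show ?thesis using that y by blast
qed

end

section \<open>Matrices as linear maps\<close>

definition em :: "nat \<Rightarrow> 'r::comm_ring_1 mat \<Rightarrow> 'r lmap" where
  "em n a = mk n (\<lambda>i j. a $$ (i, j))"

definition gl :: "nat \<Rightarrow> 'r::comm_ring_1 mat \<Rightarrow> 'r lmap" where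
  "gl n a = 1 - JJ n + em n a"

definition mg :: "nat \<Rightarrow> 'r::comm_ring_1 lmap \<Rightarrow> 'r mat" where
  "mg n g = mat n n (\<lambda>(i, j). ent g i j)"

lemma em_Mn [simp]: "em n a \<in> Mn n" by (simp add: em_def)

lemma ent_em: "ent (em n a) i j = (if i < n \<and> j < n then a $$ (i, j) else 0)"
  by (simp add: em_def ent_mk)

lemma ent_JJ: "ent (JJ n) i j = (if i < n \<and> i = j then 1 else 0)"
  by (auto simp: JJ_def ent_mk)

lemma mg_carrier [simp]: "mg n g \<in> carrier_mat n n" by (simp add: mg_def)

lemma em_mult: "a \<in> carrier_mat n n \<Longrightarrow> b \<in> carrier_mat n n \<Longrightarrow> em n (a * b) = em n a * em n b"
  by (rule Mn_eqI[of _ n]) (auto simp: ent_mult[of "em n b" n] ent_em scalar_prod_def atLeast0LessThan)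

lemma em_add: "a \<in> carrier_mat n n \<Longrightarrow> b \<in> carrier_mat n n \<Longrightarrow> em n (a + b) = em n a + em n b"
  by (rule Mn_eqI[of _ n]) (auto simp: ent_em)

lemma em_smult: "a \<in> carrier_mat n n \<Longrightarrow> em n (c \<cdot>\<^sub>m a) = scl c (em n a)"
  by (rule Mn_eqI[of _ n]) (auto simp: ent_em)

lemma em_one: "em n (1\<^sub>m n) = JJ n"
  by (rule Mn_eqI[of _ n]) (auto simp: ent_em ent_JJ)

lemma em_zero: "em n (0\<^sub>m n n) = 0"
  by (rule Mn_eqI[of _ n]) (auto simp: ent_em)

lemma em_inj: "a \<in> carrier_mat n n \<Longrightarrow> b \<in> carrier_mat n n \<Longrightarrow> em n a = em n b \<Longrightarrow> a = b"
proof (rule eq_matI)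
  fix i j assume "em n a = em n b" "i < dim_row b" "j < dim_col b" "b \<in> carrier_mat n n"
  then show "a $$ (i, j) = b $$ (i, j)" using ent_em[of n a i j] ent_em[of n b i j] by auto
qed auto

lemma mtr_em: "a \<in> carrier_mat n n \<Longrightarrow> mtr n (em n a) = mat_trace a"
  by (auto simp: mtr_def mat_trace_def ent_em)

lemma gl_minus_one: "gl n a - 1 \<in> Mn n" by (simp add: gl_def)

lemma gl_mult: "a \<in> carrier_mat n n \<Longrightarrow> b \<in> carrier_mat n n \<Longrightarrow> gl n (a * b) = gl n a * gl n b"
  by (simp add: gl_def em_mult algebra_simps Mn_JJ)

lemma gl_one [simp]: "gl n (1\<^sub>m n) = 1" by (simp add: gl_def em_one)

lemma ent_gl: "i < n \<Longrightarrow> j < n \<Longrightarrow> ent (gl n a) i j = a $$ (i, j)"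
  by (auto simp: gl_def ent_one ent_JJ ent_em)

lemma mg_gl [simp]: "a \<in> carrier_mat n n \<Longrightarrow> mg n (gl n a) = a"
  by (rule eq_matI) (auto simp: mg_def ent_gl)

lemma gl_mg [simp]: "g - 1 \<in> Mn n \<Longrightarrow> gl n (mg n g) = g"
proof -
  assume "g - 1 \<in> Mn n"
  then have "gl n (mg n g) - 1 = g - 1"
    by (intro Mn_eqI[OF gl_minus_one]) (auto simp: ent_gl mg_def)
  then show ?thesis by simp
qed

lemma mg_mult: "g - 1 \<in> Mn n \<Longrightarrow> g' - 1 \<in> Mn n \<Longrightarrow> mg n (g * g') = mg n g * mg n g'"
  using gl_mult[of "mg n g" n "mg n g'"] mg_gl[OF mult_carrier_mat[OF mg_carrier mg_carrier], of n g g'] by simp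

lemma mg_one [simp]: "mg n 1 = 1\<^sub>m n"
  by (rule eq_matI) (auto simp: mg_def ent_one)

lemma mg_GL: "g \<in> Gn n \<Longrightarrow> mg n g \<in> GL_mat n"
proof -
  assume g: "g \<in> Gn n"
  then have "mg n g * mg n (ginv g) = 1\<^sub>m n"
    using Gn_minus_one[OF g] Gn_minus_one[OF ginv_Gn[OF g]] by (simp flip: mg_mult)
  then have "det (mg n g) * det (mg n (ginv g)) = 1"
    by (metis det_mult det_one mg_carrier)
  then show ?thesis by (metis (mono_tags, lifting) GL_mat_def dvdI mem_Collect_eq mg_carrier)
qed

lemma gl_Gn: "a \<in> GL_mat n \<Longrightarrow> gl n a \<in> Gn n"
proof -
  assume "a \<in> GL_mat n"
  then have a: "a \<in> carrier_mat n n" and "det a dvd 1" by (auto simp: GL_mat_def)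
  then obtain c where c: "det a * c = 1" by (auto elim: dvdE)
  define b where "b = c \<cdot>\<^sub>m adj_mat a"
  have b: "b \<in> carrier_mat n n" using adj_mat[OF a] by (simp add: b_def)
  have "a * b = c \<cdot>\<^sub>m (det a \<cdot>\<^sub>m 1\<^sub>m n)" "b * a = c \<cdot>\<^sub>m (det a \<cdot>\<^sub>m 1\<^sub>m n)"
    using adj_mat[OF a] a by (simp_all add: b_def mult_smult_distrib mult_smult_assoc_mat[of _ n n])
  moreover have "c \<cdot>\<^sub>m (det a \<cdot>\<^sub>m 1\<^sub>m n) = 1\<^sub>m n"
    using c by (intro eq_matI) (auto simp: mult.commute)
  ultimately have "gl n a * gl n b = 1" "gl n b * gl n a = 1"
    using gl_mult[OF a b] gl_mult[OF b a] by simp_all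
  then show ?thesis unfolding Gn_def using gl_minus_one by blast
qed

lemma SL_GL: "a \<in> SL_mat n \<Longrightarrow> a \<in> GL_mat n" by (auto simp: SL_mat_def GL_mat_def)

lemma U_SL: "a \<in> U_mat n \<Longrightarrow> a \<in> SL_mat n"
proof -
  assume a: "a \<in> U_mat n"
  then have "det a = prod_list (diag_mat a)"
    by (intro det_upper_triangular[of _ n]) (auto simp: U_mat_def)
  also have "\<dots> = (\<Prod>i = 0..<dim_row a. a $$ (i, i))" by (rule prod_list_diag_prod)
  also have "\<dots> = 1" using a by (intro prod.neutral) (auto simp: U_mat_def)
  finally show ?thesis using a by (auto simp: SL_mat_def U_mat_def)
qed

lemma gl_UU: "a \<in> U_mat n \<Longrightarrow> gl n a \<in> UU n"
proof -
  assume a: "a \<in> U_mat n"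
  have "ent (gl n a - 1) i j = 0" if "j \<le> i" for i j
  proof (cases "i < n \<and> j < n")
    case True
    then show ?thesis using a that by (cases "i = j") (auto simp: U_mat_def ent_gl ent_one)
  next
    case False
    then show ?thesis by (intro ent_out[OF gl_minus_one])
  qed
  then show ?thesis unfolding UU_def nn_def using gl_minus_one by blast
qed

lemma mg_U: "u \<in> UU n \<Longrightarrow> mg n u \<in> U_mat n"
proof -
  assume "u \<in> UU n"
  then have "ent u i j = ent 1 i j" if "j \<le> i" for i j
    using that UU_minus[of u n] by (auto simp: nn_def)
  then show ?thesis by (auto simp: U_mat_def mg_def ent_one)
qed

section \<open>The diagonal torus\<close>

definition dd :: "nat \<Rightarrow> (nat \<Rightarrow> 'r::comm_ring_1) \<Rightarrow> 'r lmap" where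
  "dd n t = gl n (mat n n (\<lambda>(i, j). if i = j then t i else 0))"

lemma dd_mult: "dd n t * dd n t' = dd n (\<lambda>i. t i * t' i)"
proof -
  have "mat n n (\<lambda>(i, j). if i = j then t i else 0) * mat n n (\<lambda>(i, j). if i = j then t' i else 0)
    = mat n n (\<lambda>(i, j). if i = j then t i * t' i else 0)"
  proof (rule eq_matI)
    fix i j assume "i < dim_row (mat n n (\<lambda>(i, j). if i = j then t i * t' i else 0))"
      "j < dim_col (mat n n (\<lambda>(i, j). if i = j then t i * t' i else 0))"
    then have ij: "i < n" "j < n" by auto
    have "(\<Sum>k<n. (if i = k then t i else 0) * (if k = j then t' k else 0))
      = (\<Sum>k<n. if k = i then (if i = j then t i * t' i else 0) else 0)"
      by (rule sum.cong) auto
    then show "(mat n n (\<lambda>(i, j). if i = j then t i else 0) * mat n n (\<lambda>(i, j). if i = j then t' i else 0)) $$ (i, j)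
      = mat n n (\<lambda>(i, j). if i = j then t i * t' i else 0) $$ (i, j)"
      using ij by (simp add: scalar_prod_def atLeast0LessThan)
  qed auto
  then show ?thesis unfolding dd_def by (subst gl_mult[symmetric]) auto
qed

lemma dd_one: "(\<And>i. i < n \<Longrightarrow> t i = 1) \<Longrightarrow> dd n t = 1"
proof -
  assume "\<And>i. i < n \<Longrightarrow> t i = 1"
  then have "mat n n (\<lambda>(i, j). if i = j then t i else 0) = 1\<^sub>m n" by (intro eq_matI) auto
  then show ?thesis by (simp add: dd_def)
qed

lemma dd_inv:
  assumes "\<And>i. i < n \<Longrightarrow> t i * t' i = 1"
  shows "dd n t \<in> Gn n" "ginv (dd n t) = dd n t'"
proof -
  have *: "dd n t * dd n t' = 1" "dd n t' * dd n t = 1"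
    using assms by (auto simp: dd_mult mult.commute intro!: dd_one)
  then show "ginv (dd n t) = dd n t'" by (rule ginv_eq)
  show "dd n t \<in> Gn n" using * gl_minus_one unfolding Gn_def dd_def by blast
qed

lemma det_dd: "det (mg n (dd n t)) = (\<Prod>i<n. t i)"
proof -
  let ?D = "mat n n (\<lambda>(i, j). if i = j then t i else 0)"
  have "det ?D = prod_list (diag_mat ?D)"
    by (intro det_upper_triangular[of _ n]) auto
  then show ?thesis by (simp add: dd_def prod_list_diag_prod atLeast0LessThan)
qed

lemma dd_conj:
  assumes t: "\<And>i. i < n \<Longrightarrow> t i * t' i = 1" and u: "u \<in> UU n"
  shows "dd n t * u * dd n t' \<in> UU n"
    and "Suc i < n \<Longrightarrow> ent (dd n t * u * dd n t') i (Suc i) = t i * ent u i (Suc i) * t' (Suc i)"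
proof -
  define a where "a = u - 1"
  have a: "a \<in> nn n" "a \<in> Mn n" using UU_minus[OF u] nn_Mn by (auto simp: a_def)
  define D D' where "D = em n (mat n n (\<lambda>(i, j). if i = j then t i else 0))"
    and "D' = em n (mat n n (\<lambda>(i, j). if i = j then t' i else 0))"
  have e: "dd n t * u * dd n t' = 1 + D * a * D'"
  proof -
    have u1: "u = 1 + a" by (simp add: a_def)
    have "dd n t * a = D * a" "a * dd n t' = a * D'"
      using Mn_JJ[OF a(2)] by (simp_all add: dd_def gl_def D_def D'_def algebra_simps)
    then have "dd n t * u * dd n t' = dd n t * dd n t' + D * a * D'"
      by (simp add: u1 distrib_left distrib_right mult.assoc)
    also have "dd n t * dd n t' = 1" using t by (auto simp: dd_mult intro!: dd_one)
    finally show ?thesis .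
  qed
  have ent: "ent (D * a * D') i j = t i * ent a i j * t' j" if "i < n" "j < n" for i j
  proof -
    have Da: "ent (D * a) i k = t i * ent a i k" for k
      using that by (simp add: ent_mult[OF a(2)] D_def ent_em if_distrib if_distribR cong: if_cong)
    have D': "D' \<in> Mn n" by (simp add: D'_def)
    show ?thesis
    proof -
      have "ent D' k j = (if k = j then t' j else 0)" if "k < n" for k
        using that \<open>j < n\<close> by (auto simp: D'_def ent_em)
      then have "ent (D * a * D') i j = (\<Sum>k<n. if k = j then t i * ent a i j * t' j else 0)"
        unfolding ent_mult[OF D'] Da by (intro sum.cong) auto
      then show ?thesis using that by simp
    qed
  qed
  have DaD: "D * a * D' \<in> Mn n" using a by (simp add: D_def D'_def)
  show "dd n t * u * dd n t' \<in> UU n"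
  proof -
    have "ent (D * a * D') i j = 0" if "j \<le> i" for i j
      using ent[of i j] a(1) that ent_out[OF DaD, of i j] by (cases "i < n \<and> j < n") (auto simp: nn_def)
    then show ?thesis using DaD by (simp add: e UU_def nn_def)
  qed
  show "Suc i < n \<Longrightarrow> ent (dd n t * u * dd n t') i (Suc i) = t i * ent u i (Suc i) * t' (Suc i)"
    by (simp add: e ent ent_one) (simp add: a_def ent_one)
qed

section \<open>Cyclic vectors\<close>

definition pe :: "'k::comm_ring_1 poly \<Rightarrow> 'k lmap \<Rightarrow> 'k lmap" where
  "pe p X = (\<Sum>i\<le>degree p. scl (coeff p i) (X ^ i))"

lemma pe_ext: "degree p \<le> N \<Longrightarrow> pe p X = (\<Sum>i\<le>N. scl (coeff p i) (X ^ i))"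
  unfolding pe_def by (intro sum.mono_neutral_left) (auto simp: coeff_eq_0)

lemma pe_add: "pe (p + q) X = pe p X + pe q X"
proof -
  let ?N = "max (degree p) (degree q)"
  show ?thesis
    using degree_add_le_max[of p q]
    by (simp add: pe_ext[of _ ?N] scl_distribs sum.distrib)
qed

lemma pe_smult: "pe (Polynomial.smult c p) X = scl c (pe p X)"
  using degree_smult_le[of c p] by (simp add: pe_ext[of _ "degree p"] scl_sum)

lemma pe_pCons: "pe (pCons a p) X = scl a 1 + X * pe p X"
  unfolding pe_ext[OF degree_pCons_le] pe_def[of p]
  by (simp add: sum.atMost_Suc_shift sum_distrib_left del: sum.atMost_Suc)

lemma pe_0 [simp]: "pe 0 X = 0" by (simp add: pe_def)

lemma pe_minus: "pe (p - q) X = pe p X - pe q X"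
  using pe_add[of "p - q" q X] by (simp add: algebra_simps)

lemma pe_mult: "pe (p * q) X = pe p X * pe q X"
  by (induction p) (simp_all add: pe_pCons pe_add pe_smult algebra_simps)

lemma pe_monom: "pe (monom c i) X = scl c (X ^ i)"
  by (induction i) (simp_all add: monom_0 monom_Suc pe_pCons pe_smult)

lemma pe_Mn: "X \<in> Mn n \<Longrightarrow> pe p X * JJ n \<in> Mn n"
  by (simp add: pe_def sum_distrib_right Mn_sum pow_JJ)

text \<open>An element of least degree in the ideal generated by \<open>g\<close> and
  \<open>p\<close> divides both, so irreducibility of \<open>p\<close> makes it a unit.\<close>

lemma poly_bezout:
  fixes p g :: "'k::field poly"
  assumes p: "irreducible p" and ng: "\<not> p dvd g" obtains a b where "a * g + b * p = 1"
proof -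
  define S where "S d \<longleftrightarrow> d \<noteq> 0 \<and> (\<exists>a b. d = a * g + b * p)" for d
  have "p = 0 * g + 1 * p" by simp
  then have "S p" using p unfolding S_def irreducible_def by blast
  then obtain d where d: "S d" and min: "\<And>d'. S d' \<Longrightarrow> degree d \<le> degree d'"
    using ex_has_least_nat[of S p degree] by blast
  obtain a b where ab: "d = a * g + b * p" and d0: "d \<noteq> 0" using d by (auto simp: S_def)
  have dvd: "d dvd f" if "f = a' * g + b' * p" for f a' b'
  proof (rule ccontr)
    assume nd: "\<not> d dvd f"
    have "f mod d = f - (f div d) * d" by (simp add: minus_div_mult_eq_mod)
    also have "\<dots> = (a' - (f div d) * a) * g + (b' - (f div d) * b) * p"
      unfolding that ab by (simp add: algebra_simps)
    finally have "S (f mod d)" using nd unfolding S_def by (auto simp: dvd_eq_mod_eq_0)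
    then show False using min degree_mod_less[OF d0, of f] nd by (fastforce simp: dvd_eq_mod_eq_0)
  qed
  have "d dvd g" using dvd[of g 1 0] by simp
  have "d dvd p" using dvd[of p 0 1] by simp
  then obtain e where e: "p = d * e" by (rule dvdE)
  have "\<not> e dvd 1"
  proof
    assume "e dvd 1"
    then have "p dvd d" using e by (simp add: mult_unit_dvd_iff)
    then show False using \<open>d dvd g\<close> ng dvd_trans by blast
  qed
  then have "d dvd 1" using e p irreducibleD by blast
  then obtain c where "1 = d * c" by (rule dvdE)
  then have "(c * a) * g + (c * b) * p = 1" using ab by (simp add: algebra_simps)
  then show ?thesis using that by blast
qed

lemma poly_bezout_power:
  fixes p g :: "'k::field poly"
  assumes p: "irreducible p" and ng: "\<not> p dvd g" obtains a b where "a * g + b * p ^ e = 1"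
proof -
  have "\<exists>a b. a * g + b * p ^ e = 1"
  proof (induction e)
    case 0
    show ?case by (rule exI[of _ 0], rule exI[of _ 1]) simp
  next
    case (Suc e)
    obtain a' b' where 1: "a' * g + b' * p = 1" using poly_bezout[OF assms] .
    obtain a b where 2: "a * g + b * p ^ e = 1" using Suc by blast
    have "(a * (a' * g + b' * p) + b * p ^ e * a') * g + (b * b') * p ^ Suc e
      = (a * g + b * p ^ e) * (a' * g + b' * p)" by (simp add: algebra_simps)
    also have "\<dots> = 1" by (simp add: 1 2)
    finally show ?case by blast
  qed
  then show ?thesis using that by blast
qed

text \<open>The greatest common divisor of \<open>h\<close> and \<open>p ^ Suc e\<close> is a power
  of \<open>p\<close> with exponent at most \<open>e\<close>; the induction strips one factor
  \<open>p\<close> from \<open>h\<close> at a time.\<close>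

lemma poly_bezout_prime_power:
  fixes p h :: "'k::field poly"
  assumes p: "irreducible p" and "\<not> p ^ Suc e dvd h" shows "\<exists>a b. a * h + b * p ^ Suc e = p ^ e"
  using assms(2)
proof (induction e arbitrary: h)
  case 0
  then have "\<not> p dvd h" by simp
  then obtain a b where "a * h + b * p = 1" using poly_bezout[OF p] by blast
  then show ?case by auto
next
  case (Suc e)
  show ?case
  proof (cases "p dvd h")
    case False
    then obtain a b where "a * h + b * p ^ Suc (Suc e) = 1" using poly_bezout_power[OF p] by metis
    then have "p ^ Suc e * (a * h + b * p ^ Suc (Suc e)) = p ^ Suc e" by simp
    then have "(p ^ Suc e * a) * h + (p ^ Suc e * b) * p ^ Suc (Suc e) = p ^ Suc e"
      by (simp only: distrib_left mult.assoc)
    then show ?thesis by blast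
  next
    case True
    then obtain h1 where h1: "h = p * h1" by (rule dvdE)
    then have "\<not> p ^ Suc e dvd h1" using Suc(2) by (auto simp: mult_dvd_mono)
    then obtain a b where "a * h1 + b * p ^ Suc e = p ^ e" using Suc(1) by blast
    then have "p * (a * h1 + b * p ^ Suc e) = p ^ Suc e" by simp
    then have "a * h + b * p ^ Suc (Suc e) = p ^ Suc e" by (simp add: h1 algebra_simps)
    then show ?thesis by blast
  qed
qed

lemma irreducible_factor_exists:
  fixes g :: "'k::field poly"
  assumes "degree g > 0" obtains p where "irreducible p" "p dvd g"
proof -
  obtain p where p: "p dvd g" "degree p > 0" and min: "\<And>q. q dvd g \<Longrightarrow> degree q > 0 \<Longrightarrow> degree p \<le> degree q"
    using ex_has_least_nat[of "\<lambda>p. p dvd g \<and> degree p > 0" g degree] assms by auto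
  have p0: "p \<noteq> 0" using p by auto
  have "irreducible p"
  proof (rule irreducibleI[OF p0])
    show "\<not> p dvd 1" using p p0 by (simp add: is_unit_iff_degree)
    fix a b assume ab: "p = a * b"
    then have ab0: "a \<noteq> 0" "b \<noteq> 0" using p0 by auto
    have deg: "degree p = degree a + degree b" using ab ab0 by (simp add: degree_mult_eq)
    show "a dvd 1 \<or> b dvd 1"
    proof (cases "degree a = 0")
      case True
      then show ?thesis using ab0 by (simp add: is_unit_iff_degree)
    next
      case False
      moreover have "a dvd g" using p(1) ab by (metis dvd_mult_left)
      ultimately have "degree b = 0" using min[of a] deg by simp
      then show ?thesis using ab0 by (simp add: is_unit_iff_degree)
    qed
  qed
  then show ?thesis using that p by blast
qed

lemma ap_pe_mult: "ap (pe (p * q) X) v = ap (pe p X) (ap (pe q X) v)"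
  by (simp add: pe_mult ap_mult)

lemma ap_pe_0: "ap (pe q X) v = (\<lambda>i. 0) \<Longrightarrow> ap (pe (p * q) X) v = (\<lambda>i. 0)"
  by (simp add: ap_pe_mult ap_zero)

lemma ap_pe_supp:
  assumes X: "X \<in> Mn n" and v: "\<And>i. i \<ge> n \<Longrightarrow> v i = 0" and i: "i \<ge> n" shows "ap (pe p X) v i = 0"
proof -
  have "ap (JJ n) v = v" using v by (auto simp: ap_JJ fun_eq_iff)
  then have "ap (pe p X) v = ap (pe p X * JJ n) v" by (simp add: ap_mult)
  then show ?thesis using Mn_ap_supp[OF pe_Mn[OF X] i] by simp
qed

text \<open>One vector realizes the annihilator of the whole space. The induction splits off the
  full power of an irreducible factor of \<open>g\<close>; the extra factor \<open>q\<close> allows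
  the hypothesis to be applied after that power has been absorbed into the operator.\<close>

lemma cyclic_aux:
  fixes X :: "'k::field lmap"
  assumes X: "X \<in> Mn n" and g: "g \<noteq> 0" and ann: "\<And>h. pe (h * q) X * JJ n = 0 \<longleftrightarrow> g dvd h"
  shows "\<exists>v. (\<forall>i\<ge>n. v i = 0) \<and> (\<forall>h. ap (pe (h * q) X) v = (\<lambda>i. 0) \<longleftrightarrow> g dvd h)"
  using g ann
proof (induction "degree g" arbitrary: g q rule: less_induct)
  case less
  show ?case
  proof (cases "degree g = 0")
    case True
    then have "g dvd h" for h using less(2) by (metis is_unit_iff_degree unit_imp_dvd)
    then show ?thesis by (intro exI[of _ "\<lambda>i. 0"]) (simp add: ap_zero)
  next
    case False
    then obtain p where p: "irreducible p" "p dvd g" using irreducible_factor_exists by blast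
    have dp: "degree p > 0" using p(1) by (metis irreducible_def is_unit_iff_degree not_gr_zero)
    have bd: "e \<le> degree g" if e: "p ^ e dvd g" for e
    proof -
      have "degree (p ^ e) \<le> degree g" using e less(2) by (rule dvd_imp_degree_le)
      then have "e * degree p \<le> degree g" using p(1) by (simp add: degree_power_eq irreducible_def mult.commute)
      then show ?thesis using dp by (metis One_nat_def Suc_leI le_trans mult.right_neutral mult_le_mono2)
    qed
    define E where "E = Greatest (\<lambda>e. p ^ e dvd g)"
    have E: "p ^ E dvd g" unfolding E_def by (rule GreatestI_nat[of _ 0 "degree g"]) (use bd in auto)
    have Emax: "e \<le> E" if "p ^ e dvd g" for e
      unfolding E_def by (rule Greatest_le_nat[of _ _ "degree g"]) (use that bd in auto)
    have "1 \<le> E" using Emax[of 1] p(2) by simp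
    then obtain e where e: "E = Suc e" by (cases E) auto
    obtain g' where g': "g = p ^ E * g'" using E by (rule dvdE)
    have npg: "\<not> p dvd g'"
    proof
      assume "p dvd g'"
      then have "p ^ Suc E dvd g" unfolding g' by (auto elim!: dvdE simp: mult_ac)
      then show False using Emax[of "Suc E"] by simp
    qed
    have g0: "g' \<noteq> 0" "p ^ E \<noteq> 0" using less(2) g' by auto
    obtain a b where ab: "a * g' + b * p ^ E = 1" using poly_bezout_power[OF p(1) npg] .
    have div1: "p ^ E dvd h" if "p ^ E dvd h * g'" for h
    proof -
      have "h = h * (a * g' + b * p ^ E)" using ab by simp
      also have "\<dots> = a * (h * g') + (h * b) * p ^ E" by (simp add: algebra_simps)
      finally have *: "h = a * (h * g') + (h * b) * p ^ E" .
      show ?thesis by (subst *) (use that in \<open>auto intro: dvd_add dvd_mult\<close>)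
    qed
    have div2: "g' dvd h" if "g' dvd h * p ^ E" for h
    proof -
      have "h = h * (a * g' + b * p ^ E)" using ab by simp
      also have "\<dots> = (h * a) * g' + b * (h * p ^ E)" by (simp add: algebra_simps)
      finally have *: "h = (h * a) * g' + b * (h * p ^ E)" .
      show ?thesis by (subst *) (use that in \<open>auto intro: dvd_add dvd_mult\<close>)
    qed
    have div3: "g dvd h" if h: "p ^ E dvd h" "g' dvd h" for h
    proof -
      have "h = h * (a * g' + b * p ^ E)" using ab by simp
      also have "\<dots> = a * (g' * h) + b * (p ^ E * h)" by (simp add: algebra_simps)
      finally have *: "h = a * (g' * h) + b * (p ^ E * h)" .
      have "p ^ E * g' dvd h * g'" "p ^ E * g' dvd p ^ E * h" using h by (auto intro: mult_dvd_mono)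
      then have "g dvd g' * h" "g dvd p ^ E * h" by (simp_all add: g' mult.commute)
      then show ?thesis by (subst *) (auto intro: dvd_add dvd_mult)
    qed
    have "degree g' < degree g"
      using g' g0 dp p(1) by (simp add: degree_mult_eq degree_power_eq irreducible_def e)
    moreover have "pe (h * (p ^ E * q)) X * JJ n = 0 \<longleftrightarrow> g' dvd h" for h
    proof -
      have "pe (h * (p ^ E * q)) X * JJ n = 0 \<longleftrightarrow> g dvd h * p ^ E" using less(3)[of "h * p ^ E"] by (simp add: mult_ac)
      also have "\<dots> \<longleftrightarrow> g' dvd h" using g0 by (auto simp: g' mult.commute[of _ "p ^ E"])
      finally show ?thesis .
    qed
    ultimately obtain v2 where v2: "\<And>i. i \<ge> n \<Longrightarrow> v2 i = 0"
      "\<And>h. ap (pe (h * (p ^ E * q)) X) v2 = (\<lambda>i. 0) \<longleftrightarrow> g' dvd h"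
      using less(1)[of g' "p ^ E * q"] g0 by metis
    \<comment> \<open>One factor \<open>p\<close> is missing here, so some vector \<open>v1\<close>
      survives this operator; after multiplication by \<open>g'\<close> its annihilator is exactly
      \<open>p ^ E\<close>.\<close>
    have "\<not> g dvd p ^ e * g'"
    proof
      assume "g dvd p ^ e * g'"
      then have "p ^ E dvd p ^ e" using g0(1) by (simp add: g')
      then have "degree (p ^ E) \<le> degree (p ^ e)" using p(1) by (intro dvd_imp_degree_le) (auto simp: irreducible_def)
      then show False using p(1) dp by (simp add: degree_power_eq irreducible_def e del: power_Suc)
    qed
    then have "pe (p ^ e * g' * q) X * JJ n \<noteq> 0" using less(3) by blast
    then obtain w where "ap (pe (p ^ e * g' * q) X * JJ n) w \<noteq> ap 0 w" using ap_eqI by blast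
    moreover define v1 where "v1 = ap (JJ n) w"
    moreover have "ap 0 w = (\<lambda>i. 0)" by (simp add: fun_eq_iff)
    ultimately have v1: "ap (pe (p ^ e * g' * q) X) v1 \<noteq> (\<lambda>i. 0)" by (simp add: ap_mult)
    have v1s: "v1 i = 0" if "i \<ge> n" for i using that by (simp add: v1_def ap_JJ)
    have kill: "ap (pe (h * q) X) v = (\<lambda>i. 0)" if "g dvd h" "\<And>i. i \<ge> n \<Longrightarrow> v i = 0" for h v
    proof -
      have "ap (JJ n) v = v" using that(2) by (auto simp: ap_JJ fun_eq_iff)
      then have "ap (pe (h * q) X) v = ap (pe (h * q) X * JJ n) v" by (simp add: ap_mult)
      then show ?thesis using less(3)[of h] that by (simp add: fun_eq_iff)
    qed
    have v1E: "p ^ E dvd h" if h: "ap (pe (h * g' * q) X) v1 = (\<lambda>i. 0)" for h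
    proof (rule ccontr)
      assume "\<not> p ^ E dvd h"
      then obtain a b where "a * h + b * p ^ E = p ^ e" using poly_bezout_prime_power[OF p(1)] unfolding e by blast
      then have "p ^ e * g' * q = a * (h * g' * q) + b * (p ^ E * g' * q)"
        by (metis distrib_right mult.assoc)
      moreover have "ap (pe (p ^ E * g' * q) X) v1 = (\<lambda>i. 0)"
        using kill[of g v1] v1s by (simp add: g')
      ultimately have "ap (pe (p ^ e * g' * q) X) v1 i = 0" for i
        using ap_pe_0[OF h, of a] ap_pe_0[of "p ^ E * g' * q" X v1 b] by (simp add: pe_add)
      then show False using v1 by (simp add: fun_eq_iff)
    qed
    \<comment> \<open>The two summands have the coprime annihilators \<open>p ^ E\<close> and
      \<open>g'\<close>. Multiplying by one of these kills one summand and leaves a condition on the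
      other.\<close>
    define v where "v i = ap (pe g' X) v1 i + ap (pe (p ^ E) X) v2 i" for i
    have vs: "v i = 0" if "i \<ge> n" for i using that v1s v2(1) by (simp add: v_def ap_pe_supp[OF X])
    have apv: "ap (pe (h * q) X) v = (\<lambda>i. ap (pe (h * g' * q) X) v1 i + ap (pe (h * (p ^ E * q)) X) v2 i)" for h
    proof -
      have "ap (pe (h * q) X) v = (\<lambda>i. ap (pe (h * q * g') X) v1 i + ap (pe (h * q * p ^ E) X) v2 i)"
        unfolding v_def by (subst ap_add) (simp add: ap_pe_mult)
      then show ?thesis by (simp add: mult_ac)
    qed
    have "ap (pe (h * q) X) v = (\<lambda>i. 0) \<longleftrightarrow> g dvd h" for h
    proof
      assume h: "ap (pe (h * q) X) v = (\<lambda>i. 0)"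
      have "ap (pe ((h * g') * g' * q) X) v1 = (\<lambda>i. 0)"
      proof -
        have "ap (pe (h * g' * q) X) v = (\<lambda>i. 0)" using ap_pe_0[OF h, of g'] by (simp add: mult_ac)
        moreover have "ap (pe ((h * g') * (p ^ E * q)) X) v2 = (\<lambda>i. 0)" using v2(2) by simp
        ultimately show ?thesis using apv[of "h * g'"] by (simp add: fun_eq_iff)
      qed
      then have 1: "p ^ E dvd h" using v1E div1 by blast
      have "ap (pe ((h * p ^ E) * (p ^ E * q)) X) v2 = (\<lambda>i. 0)"
      proof -
        have "ap (pe ((h * p ^ E) * q) X) v = (\<lambda>i. 0)" using ap_pe_0[OF h, of "p ^ E"] by (simp add: mult_ac)
        moreover have "ap (pe ((h * p ^ E) * g' * q) X) v1 = (\<lambda>i. 0)"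
          using kill[of "(h * p ^ E) * g'" v1] v1s by (simp add: g' mult_ac)
        ultimately show ?thesis using apv[of "h * p ^ E"] by (simp add: fun_eq_iff)
      qed
      then have "g' dvd h" using v2(2) div2 by blast
      then show "g dvd h" using div3 1 by blast
    qed (use kill vs in blast)
    then show ?thesis using vs by blast
  qed
qed

section \<open>Minimal polynomials of matrices over a finite field\<close>

lemma em_pow:
  assumes x: "x \<in> carrier_mat n n" shows "em n (x ^\<^sub>m i) = em n x ^ i * JJ n"
proof (induction i)
  case 0
  then show ?case using x em_one by auto
next
  case (Suc i)
  have "em n (x ^\<^sub>m Suc i) = em n x ^ i * JJ n * em n x"
    using x Suc by (simp add: em_mult pow_carrier_mat)
  then show ?case by (simp add: mult.assoc Mn_JJ power_Suc2 del: power_Suc)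
qed

lemma em_poly_eval:
  assumes x: "x \<in> carrier_mat n n" shows "em n (poly_eval_mat f x) = pe f (em n x) * JJ n"
    and "poly_eval_mat f x \<in> carrier_mat n n"
proof -
  let ?F = "\<lambda>is. foldr (\<lambda>i M. coeff f i \<cdot>\<^sub>m (x ^\<^sub>m i) + M) is (0\<^sub>m n n)"
  have c: "?F is \<in> carrier_mat n n" for "is"
    using x by (induction "is") (auto simp: pow_carrier_mat)
  have e: "em n (?F is) = (\<Sum>i\<leftarrow>is. scl (coeff f i) (em n x ^ i * JJ n))" for "is"
  proof (induction "is")
    case (Cons i "is")
    have "coeff f i \<cdot>\<^sub>m (x ^\<^sub>m i) \<in> carrier_mat n n" using x by (simp add: pow_carrier_mat)
    then show ?case using Cons x by (simp add: em_add[OF _ c] em_smult[OF pow_carrier_mat] em_pow)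
  qed (simp add: em_zero)
  have p: "poly_eval_mat f x = ?F [0..<Suc (degree f)]"
    using x by (simp add: poly_eval_mat_def)
  show "poly_eval_mat f x \<in> carrier_mat n n" unfolding p by (rule c)
  show "em n (poly_eval_mat f x) = pe f (em n x) * JJ n"
    unfolding p e interv_sum_list_conv_sum_set_nat
    by (simp add: pe_def sum_distrib_right atLeast0LessThan lessThan_Suc_atMost del: upt_Suc sum.lessThan_Suc)
qed

lemma poly_eval_zero_iff:
  assumes x: "x \<in> carrier_mat n n"
  shows "poly_eval_mat f x = 0\<^sub>m (dim_row x) (dim_row x) \<longleftrightarrow> pe f (em n x) * JJ n = 0"
proof -
  have "dim_row x = n" using x by simp
  then show ?thesis
    using em_inj[OF em_poly_eval(2)[OF x] zero_carrier_mat, of f] em_poly_eval(1)[OF x, of f] em_zero by metis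
qed

definition is_min_poly :: "nat \<Rightarrow> 'k::field lmap \<Rightarrow> 'k poly \<Rightarrow> bool" where
  "is_min_poly n X f \<longleftrightarrow> monic f \<and> pe f X * JJ n = 0 \<and> (\<forall>q. q \<noteq> 0 \<and> pe q X * JJ n = 0 \<longrightarrow> degree f \<le> degree q)"

lemma is_min_poly_unique:
  assumes "is_min_poly n X f" "is_min_poly n X f'" shows "f = f'"
proof (rule ccontr)
  assume ne: "f \<noteq> f'"
  have f: "monic f" "monic f'" "pe f X * JJ n = 0" "pe f' X * JJ n = 0" using assms by (auto simp: is_min_poly_def)
  have d: "degree f = degree f'"
    using assms unfolding is_min_poly_def by (metis le_antisym leading_coeff_0_iff zero_neq_one)
  have "pe (f - f') X * JJ n = 0" using f by (simp add: pe_minus left_diff_distrib)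
  then have le: "degree f \<le> degree (f - f')" using assms(1) ne by (auto simp: is_min_poly_def)
  have "degree (f - f') \<le> degree f" using d by (intro degree_diff_le) auto
  then have "degree (f - f') = degree f" using le by simp
  then have "lead_coeff (f - f') = 0" using f(1,2) d by simp
  then have "f - f' = 0" by (simp only: leading_coeff_0_iff)
  then show False using ne by simp
qed

text \<open>Finiteness of the matrix ring forces two powers of \<open>X\<close> to coincide, which
  already gives an annihilating polynomial.\<close>

lemma is_min_poly_exists:
  assumes fin: "finite (UNIV :: 'k::field set)" and X: "(X :: 'k lmap) \<in> Mn n"
  obtains f where "is_min_poly n X f"
proof -
  have "finite (range (\<lambda>i. X ^ i * JJ n))"
    by (rule finite_subset[OF _ finite_Mn_UNIV[OF fin, of n]]) (use pow_JJ(1)[OF X] in auto)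
  then have "\<not> inj (\<lambda>i::nat. X ^ i * JJ n)" using finite_imageD infinite_UNIV_nat by blast
  then obtain i j :: nat where ij: "i < j" "X ^ i * JJ n = X ^ j * JJ n"
    unfolding inj_def by (metis linorder_neqE_nat)
  define q0 :: "'k poly" where "q0 = monom 1 j - monom 1 i"
  have "coeff q0 j = 1" using ij by (simp add: q0_def)
  then have "q0 \<noteq> 0" by auto
  moreover have "pe q0 X * JJ n = 0" using ij by (simp add: q0_def pe_minus pe_monom left_diff_distrib)
  ultimately obtain q where q: "q \<noteq> 0" "pe q X * JJ n = 0"
    and min: "\<And>q'. q' \<noteq> 0 \<Longrightarrow> pe q' X * JJ n = 0 \<Longrightarrow> degree q \<le> degree q'"
    using ex_has_least_nat[of "\<lambda>q. q \<noteq> 0 \<and> pe q X * JJ n = 0" q0 degree] by blast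
  define f where "f = Polynomial.smult (inverse (lead_coeff q)) q"
  have "is_min_poly n X f" unfolding is_min_poly_def
    using q min by (auto simp: f_def pe_smult)
  then show ?thesis using that by blast
qed

lemma min_poly_is:
  assumes fin: "finite (UNIV :: 'k::field set)" and x: "(x :: 'k mat) \<in> carrier_mat n n"
  shows "is_min_poly n (em n x) (min_poly x)"
proof -
  have e: "min_poly x = (THE f. is_min_poly n (em n x) f)"
    unfolding min_poly_def is_min_poly_def poly_eval_zero_iff[OF x] ..
  obtain f where f: "is_min_poly n (em n x) f" using is_min_poly_exists[OF fin em_Mn] .
  then show ?thesis unfolding e by (rule theI) (use f is_min_poly_unique in blast)
qed

lemma pe_shift:
  fixes X :: "'k::field lmap"
  assumes X: "X \<in> Mn n"
  shows "pe (pcompose p [:- c, 1:]) (X + scl c (JJ n)) * JJ n = pe p X * JJ n"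
proof (induction p)
  case 0
  then show ?case by simp
next
  case (pCons a p)
  let ?Y = "X + scl c (JJ n)"
  have Z: "pe p X * JJ n \<in> Mn n" by (rule pe_Mn[OF X])
  have "pe [:- c, 1:] ?Y = ?Y - scl c 1" by (simp add: pe_pCons)
  then have "pe (pcompose (pCons a p) [:- c, 1:]) ?Y * JJ n = scl a (JJ n) + (?Y - scl c 1) * (pe (pcompose p [:- c, 1:]) ?Y * JJ n)"
    by (simp add: pcompose_pCons pe_add pe_mult pe_pCons distrib_right mult.assoc del: mult_pCons_left)
  also have "\<dots> = scl a (JJ n) + X * (pe p X * JJ n)"
    unfolding pCons using Mn_JJ(1)[OF Z] by (simp add: left_diff_distrib distrib_right)
  finally show ?case by (simp add: pe_pCons distrib_right mult.assoc)
qed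

lemma is_min_poly_shift:
  fixes X :: "'k::field lmap"
  assumes X: "X \<in> Mn n" and f: "is_min_poly n X f"
  shows "is_min_poly n (X + scl c (JJ n)) (pcompose f [:- c, 1:])"
  unfolding is_min_poly_def
proof (intro conjI allI impI)
  have "lead_coeff (pcompose f [:- c, 1:]) = lead_coeff f"
    by (subst lead_coeff_comp) auto
  then show "monic (pcompose f [:- c, 1:])" using f by (simp add: is_min_poly_def)
  show "pe (pcompose f [:- c, 1:]) (X + scl c (JJ n)) * JJ n = 0"
    using pe_shift[OF X] f by (simp add: is_min_poly_def)
  fix q assume q: "q \<noteq> 0 \<and> pe q (X + scl c (JJ n)) * JJ n = 0"
  have "X + scl c (JJ n) + scl (- c) (JJ n) = X" by simp
  then have "pe (pcompose q [:c, 1:]) X * JJ n = pe q (X + scl c (JJ n)) * JJ n"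
    using pe_shift[of "X + scl c (JJ n)" n q "- c"] X by simp
  then have "pe (pcompose q [:c, 1:]) X * JJ n = 0" using q by simp
  moreover have "pcompose q [:c, 1:] \<noteq> 0" using q by (simp add: pcompose_eq_0_iff)
  ultimately have "degree f \<le> degree (pcompose q [:c, 1:])"
    using f unfolding is_min_poly_def by blast
  then show "degree (pcompose f [:- c, 1:]) \<le> degree q" by (simp add: degree_pcompose)
qed

lemma char_poly_shift:
  assumes x: "(x :: 'k::field mat) \<in> carrier_mat n n"
  shows "char_poly (x + c \<cdot>\<^sub>m 1\<^sub>m n) = pcompose (char_poly x) [:- c, 1:]"
proof -
  have "char_poly_matrix (x + c \<cdot>\<^sub>m 1\<^sub>m n) = map_mat (\<lambda>p. pcompose p [:- c, 1:]) (char_poly_matrix x)"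
    using x by (intro eq_matI) (auto simp: char_poly_matrix_def pcompose_pCons pcompose_add)
  then show ?thesis unfolding char_poly_def by (simp only: comm_ring_hom.hom_det[OF pcompose_hom.comm_ring_hom_axioms])
qed

text \<open>The characteristic and the minimal polynomial undergo the same substitution of t - c for
  t.\<close>

lemma regular_mat_shift:
  assumes fin: "finite (UNIV :: 'k::field set)" and x: "(x :: 'k mat) \<in> carrier_mat n n" and reg: "regular_mat x"
  shows "regular_mat (x + c \<cdot>\<^sub>m 1\<^sub>m n)"
proof -
  have x': "x + c \<cdot>\<^sub>m 1\<^sub>m n \<in> carrier_mat n n" using x by auto
  have "em n (x + c \<cdot>\<^sub>m 1\<^sub>m n) = em n x + scl c (JJ n)" using x by (simp add: em_add em_smult em_one)
  then have "min_poly (x + c \<cdot>\<^sub>m 1\<^sub>m n) = pcompose (min_poly x) [:- c, 1:]"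
    using is_min_poly_unique[OF min_poly_is[OF fin x']] is_min_poly_shift[OF em_Mn min_poly_is[OF fin x]] by metis
  then show ?thesis using reg char_poly_shift[OF x] by (simp add: regular_mat_def)
qed

text \<open>Regularity gives the minimal polynomial degree n. A linear dependence among the first n
  iterates of the vector from \<open>cyclic_aux\<close> would be an annihilating polynomial of
  smaller degree.\<close>

lemma cyclic_vector:
  assumes fin: "finite (UNIV :: 'k::field set)" and x: "(x :: 'k mat) \<in> carrier_mat n n" and reg: "regular_mat x"
  obtains v where "\<And>i. i \<ge> n \<Longrightarrow> v i = 0"
    "det (mat n n (\<lambda>(i, j). ap (em n x ^ j) v i)) \<noteq> 0"
proof -
  define X where "X = em n x"
  have X: "X \<in> Mn n" by (simp add: X_def)
  define f where "f = min_poly x"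
  have f: "is_min_poly n X f" unfolding f_def X_def by (rule min_poly_is[OF fin x])
  have f0: "f \<noteq> 0" using f by (auto simp: is_min_poly_def)
  have deg: "degree f = n" using reg degree_monic_char_poly[OF x] by (simp add: regular_mat_def f_def)
  have "pe (h * 1) X * JJ n = 0 \<longleftrightarrow> f dvd h" for h
  proof
    assume "f dvd h"
    then obtain e where "h = e * f" by (metis dvdE mult.commute)
    then show "pe (h * 1) X * JJ n = 0" using f by (simp add: pe_mult is_min_poly_def mult.assoc)
  next
    assume h: "pe (h * 1) X * JJ n = 0"
    have "h mod f = h - (h div f) * f" by (simp add: minus_div_mult_eq_mod)
    then have "pe (h mod f) X * JJ n = 0"
      using h f by (simp add: pe_minus pe_mult left_diff_distrib is_min_poly_def mult.assoc)
    then have "h mod f = 0" using f degree_mod_less[OF f0, of h] unfolding is_min_poly_def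
      by (metis not_le)
    then show "f dvd h" by (simp add: dvd_eq_mod_eq_0)
  qed
  then obtain v where v: "\<And>i. i \<ge> n \<Longrightarrow> v i = 0" "\<And>h. ap (pe (h * 1) X) v = (\<lambda>i. 0) \<longleftrightarrow> f dvd h"
    using cyclic_aux[OF X f0, of 1] by blast
  let ?P = "mat n n (\<lambda>(i, j). ap (X ^ j) v i)"
  have "det ?P \<noteq> 0"
  proof
    assume "det ?P = 0"
    then obtain c where c: "c \<in> carrier_vec n" "c \<noteq> 0\<^sub>v n" "?P *\<^sub>v c = 0\<^sub>v n"
      using det_0_iff_vec_prod_zero_field[of ?P n] by auto
    define h where "h = (\<Sum>j<n. monom (c $ j) j)"
    have ch: "coeff h k = (if k < n then c $ k else 0)" for k
      by (auto simp: h_def coeff_sum if_distrib cong: if_cong)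
    have peh: "pe h X = (\<Sum>j<n. scl (c $ j) (X ^ j))"
    proof -
      have "pe (\<Sum>j\<in>K. monom (c $ j) j) X = (\<Sum>j\<in>K. scl (c $ j) (X ^ j))" for K
        by (induction K rule: infinite_finite_induct) (auto simp: pe_add pe_monom)
      then show ?thesis by (simp add: h_def)
    qed
    have "ap (pe h X) v i = 0" for i
    proof (cases "i < n")
      case True
      have "(?P *\<^sub>v c) $ i = 0" using c True by simp
      then show ?thesis using True c(1)
        by (simp add: peh sum_ap scalar_prod_def atLeast0LessThan mult.commute)
    next
      case False
      then show ?thesis using ap_pe_supp[OF X v(1)] by simp
    qed
    then have "f dvd h" using v(2)[of h] by (simp add: fun_eq_iff)
    moreover have "h \<noteq> 0"
    proof
      assume "h = 0"
      then have "c $ k = 0" if "k < n" for k using ch[of k] that by simp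
      then show False using c by auto
    qed
    ultimately have "n \<le> degree h" using dvd_imp_degree_le deg by blast
    moreover have "degree h < n"
    proof -
      have "n \<noteq> 0" using c by auto
      moreover have "degree h \<le> n - 1" by (rule degree_le) (auto simp: ch)
      ultimately show ?thesis by simp
    qed
    ultimately show False by simp
  qed
  then show ?thesis using that[of v] v(1) by (simp add: X_def)
qed

section \<open>Lifting cyclic vectors from the residue field\<close>

lemma residue_map_hom:
  assumes "residue_map red \<pi>" shows "comm_ring_hom red"
proof -
  have r: "red (a + b) = red a + red b" "red (a * b) = red a * red b" "red 1 = 1" for a b
    using assms by (auto simp: residue_map_def)
  have "red 0 = 0" using r(1)[of 0 0] by (metis add.right_neutral add_left_cancel)
  then show ?thesis using r by unfold_locales auto
qed

text \<open>Any lift of a residual cyclic vector works: the matrix of its iterates has nonzero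
  determinant in the residue field, hence unit determinant, and it conjugates \<open>X\<close> to a
  companion matrix.\<close>

lemma regular_companion:
  fixes red :: "'r::{comm_ring_1,finite} \<Rightarrow> 'k::field"
  assumes dvr: "trunc_dvr \<pi> l" and res: "residue_map red \<pi>" and X: "X \<in> Mn n"
    and x: "x \<in> carrier_mat n n" "\<And>i j. i < n \<Longrightarrow> j < n \<Longrightarrow> red (ent X i j) = x $$ (i, j)"
    and reg: "regular_mat x"
  obtains g where "g \<in> Gn n" "companion n (ginv g * X * g)"
proof -
  interpret comm_ring_hom red by (rule residue_map_hom[OF res])
  have surj: "surj red" using res by (simp add: residue_map_def)
  then have fin: "finite (UNIV :: 'k set)" by (metis finite_UNIV_surj_inj finite_imageI finite)
  obtain v where v: "\<And>i. i \<ge> n \<Longrightarrow> v i = 0" "det (mat n n (\<lambda>(i, j). ap (em n x ^ j) v i)) \<noteq> 0"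
    using cyclic_vector[OF fin x(1) reg] by metis
  define v' where "v' i = (if i < n then inv_into UNIV red (v i) else 0)" for i
  have v': "red (v' i) = v i" for i using v(1) surj hom_zero by (auto simp: v'_def surj_f_inv_f)
  have supp: "ap (X ^ j) v' k = 0" if "k \<ge> n" for j k
    using that Mn_ap_supp[OF X] by (cases j) (auto simp: v'_def ap_mult)
  have supp': "ap (em n x ^ j) v k = 0" if "k \<ge> n" for j k
    using that Mn_ap_supp[OF em_Mn[of n x]] v(1) by (cases j) (auto simp: ap_mult)
  have ar: "red (ap (X ^ j) v' i) = ap (em n x ^ j) v i" for i j
  proof (induction j arbitrary: i)
    case (Suc j)
    show ?case
    proof (cases "i < n")
      case True
      have "ap (X ^ Suc j) v' i = (\<Sum>k<n. ap (X ^ j) v' k * ent X i k)"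
        by (simp add: ap_mult ap_supp[OF supp])
      then have "red (ap (X ^ Suc j) v' i) = (\<Sum>k<n. ap (em n x ^ j) v k * ent (em n x) i k)"
        using True by (simp add: hom_sum hom_mult Suc x(2) ent_em)
      also have "\<dots> = ap (em n x ^ Suc j) v i" by (simp add: ap_mult ap_supp[OF supp'])
      finally show ?thesis .
    next
      case False
      then show ?thesis using supp[of i "Suc j"] supp'[of i "Suc j"] by simp
    qed
  qed (simp add: v')
  define P where "P = mat n n (\<lambda>(i, j). ap (X ^ j) v' i)"
  have "map_mat red P = mat n n (\<lambda>(i, j). ap (em n x ^ j) v i)"
    by (rule eq_matI) (auto simp: P_def ar)
  then have "red (det P) \<noteq> 0" using v(2) by (simp flip: hom_det)
  then have "det P dvd 1" using res dvr by (auto simp: residue_map_def trunc_dvr_def)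
  then have PG: "gl n P \<in> Gn n" by (intro gl_Gn) (auto simp: GL_mat_def P_def)
  have col: "ap (gl n P) (unitv j) = ap (X ^ j) v'" if "j < n" for j
  proof
    fix i
    show "ap (gl n P) (unitv j) i = ap (X ^ j) v' i"
    proof (cases "i < n")
      case True
      then show ?thesis using that ent_gl[OF True that, of P] by (simp add: ent_def P_def)
    next
      case False
      have "ent (gl n P - 1) i j = 0" using False by (intro ent_out[OF gl_minus_one]) auto
      then show ?thesis using False that supp by (simp add: ent_def[symmetric] ent_one)
    qed
  qed
  have "companion n (ginv (gl n P) * X * gl n P)"
    by (rule conj_companion[OF PG X]) (simp add: col ap_mult)
  then show ?thesis using that PG by blast
qed

section \<open>Special-regular representations admit all Whittaker models\<close>

context lrep
begin

lemma PP_sv: "l \<le> 2 * k \<Longrightarrow> PP k X (sv c v) = sv c (PP k X v)"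
  unfolding PP_def by (rule avg_lin(2)) (rule H_G)

lemma l1: "l \<le> 2 * (l - 1)" using l2 by simp

lemma H_l1: "H (l - 1) b = H M (scl (\<pi> ^ (l - 1 - M)) b)"
proof -
  have "M + (l - 1 - M) = l - 1" using mMh by simp
  then show ?thesis by (simp add: H_def flip: power_add)
qed

text \<open>Refines a character at the bottom level l - 1 to one at level \<open>M\<close>. The
  bottom level commutes with \<open>PP M X\<close>, so a nonzero component of \<open>w\<close> must
  have \<open>X\<close> congruent to \<open>X0\<close> modulo \<pi>.\<close>

lemma PP_lift:
  assumes w: "w \<noteq> 0" and X0: "X0 \<in> A"
    and eig: "\<And>b. b \<in> A \<Longrightarrow> act (H (l - 1) b) w = sv (Psi (scl (\<pi> ^ (l - 1)) (X0 * b))) w"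
  obtains X where "X \<in> A" "scl (\<pi> ^ (l - 1)) X = scl (\<pi> ^ (l - 1)) X0" "PP M X w \<noteq> 0"
proof -
  obtain N where N: "N \<noteq> 0" "\<And>v. (\<Sum>X\<in>A. PP M X v) = sv N v" by (rule PP_sum[OF lM]) blast
  have "(\<Sum>X\<in>A. PP M X w) \<noteq> 0" using N w by simp
  then obtain X where X: "X \<in> A" "PP M X w \<noteq> 0" by (meson sum.neutral)
  have "scl (\<pi> ^ (l - 1)) (X - X0) = 0"
  proof (rule Psi_nondeg)
    fix b :: "'r lmap" assume b: "b \<in> A"
    define g where "g = H (l - 1) b"
    have g: "g \<in> G" unfolding g_def by (rule H_G[OF l1 b])
    \<comment> \<open>Conjugation by \<open>g\<close> changes \<open>X\<close> by a multiple of
      \<open>\<pi> ^ (l - 1)\<close>, which is invisible at level \<open>M\<close>.\<close>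
    have "\<pi> ^ M * \<pi> ^ (l - 1) = 0" using mMh by (simp add: pi_zero flip: power_add)
    then have "scl (\<pi> ^ M) (g * X) = scl (\<pi> ^ M) (X * g)"
      by (simp add: g_def H_def distrib_left distrib_right scl_distribs)
    then have "scl (\<pi> ^ M) (g * X) * ginv g = scl (\<pi> ^ M) (X * g) * ginv g" by simp
    then have "scl (\<pi> ^ M) (g * X * ginv g) = scl (\<pi> ^ M) X" using g by (simp add: mult.assoc)
    then have "act g (PP M X w) = PP M X (act g w)"
      using PP_conj[OF lM g X(1), of w] PP_cong[of M "g * X * ginv g" X] by simp
    also have "\<dots> = sv (Psi (scl (\<pi> ^ (l - 1)) (X0 * b))) (PP M X w)"
      using eig[OF b] by (simp add: g_def PP_sv[OF lM])
    finally have 1: "act g (PP M X w) = sv (Psi (scl (\<pi> ^ (l - 1)) (X0 * b))) (PP M X w)" .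
    have "M + (l - 1 - M) = l - 1" using mMh by simp
    then have "act g (PP M X w) = sv (Psi (scl (\<pi> ^ (l - 1)) (X * b))) (PP M X w)"
      using PP_eig[OF lM, of "scl (\<pi> ^ (l - 1 - M)) b" X w] b
      unfolding g_def H_l1 by (simp flip: power_add)
    then have "Psi (scl (\<pi> ^ (l - 1)) (X0 * b)) = Psi (scl (\<pi> ^ (l - 1)) (X * b))"
      using 1 X(2) by simp
    then show "Psi (scl (\<pi> ^ (l - 1)) (X - X0) * b) = 1"
      by (simp add: left_diff_distrib scl_distribs Psi_simps)
  qed (use X X0 in auto)
  then have "scl (\<pi> ^ (l - 1)) X = scl (\<pi> ^ (l - 1)) X0" by (simp add: scl_distribs)
  then show ?thesis using that X by blast
qed

text \<open>A vector-valued Whittaker functional; its coordinates are ordinary ones.\<close>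

definition wh :: "'v \<Rightarrow> 'v" where
  "wh = avg (UU n) (\<lambda>u. inverse (\<phi> (sd n u))) (\<lambda>u. u)"

lemma wh_lin: "wh (v + v') = wh v + wh v'" "wh (sv c v) = sv c (wh v)"
  unfolding wh_def by (auto intro!: avg_lin)

lemma wh_act: assumes u: "u \<in> UU n" shows "wh (act u v) = sv (\<phi> (sd n u)) (wh v)"
proof -
  have uG: "u \<in> G" using u by auto
  have "wh (act u v) = avg (UU n) (\<lambda>u. inverse (\<phi> (sd n u))) (\<lambda>w. w * u) v"
    unfolding wh_def by (rule avg_act(2)) (use u in auto)
  also have "\<dots> = sv (\<phi> (sd n u)) (wh v)"
    unfolding wh_def
  proof (rule avg_reindex[where \<sigma> = "\<lambda>w. w * u"])
    show "bij_betw (\<lambda>w. w * u) (UU n) (UU n)"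
      by (rule bij_betw_byWitness[where f' = "\<lambda>w. w * ginv u"])
        (use u Gn_inv(1,2)[OF uG] ginv_UU[OF u] in \<open>auto simp: mult.assoc UU_mult\<close>)
  qed (use u in \<open>auto simp: sd_mult phi_add phi_nz\<close>)
  finally show ?thesis .
qed

lemma wh_exists:
  assumes g: "g \<in> G" "companion n (ginv g * X * g)" and X: "X \<in> A" "PP M X w \<noteq> 0" and w: "w \<in> V"
  obtains v where "v \<in> V" "wh v \<noteq> 0"
proof -
  define x where "x = act (ginv g) (PP M X w)"
  have x: "x = PP M (ginv g * X * g) (act (ginv g) w)"
    using PP_conj[OF lM ginv_Gn[OF g(1)] X(1), of w] g(1) by (simp add: x_def)
  have "x \<noteq> 0" using act_inj[OF ginv_Gn[OF g(1)]] X(2) by (auto simp: x_def)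
  moreover have "act (H M b) x = sv (Psi (scl (\<pi> ^ M) ((ginv g * X * g) * b))) x" if "b \<in> A" for b
    unfolding x by (rule PP_eig[OF lM that])
  ultimately obtain y where y: "y \<in> G" "wh (act y x) \<noteq> 0"
    unfolding wh_def by (rule whit_exists[OF g(2)])
  have "act y x \<in> V" unfolding x_def using y g w by (intro actV PP_V lM ginv_Gn)
  then show ?thesis using that y(2) by blast
qed

end

section \<open>The residue field, the bottom congruence subgroup and twists of the Whittaker
  character\<close>

locale rtrunc = trunc \<pi> l n \<phi> hf
  for \<pi> :: "'r::{comm_ring_1,finite}" and l n :: nat and \<phi> :: "'r \<Rightarrow> complex" and hf :: 'r +
  fixes red :: "'r \<Rightarrow> 'k::field"
  assumes res: "residue_map red \<pi>"
begin

lemma red_simps: "red (a + b) = red a + red b" "red (a * b) = red a * red b" "red 1 = 1"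
    "red a = 0 \<longleftrightarrow> \<pi> dvd a" "surj red"
  using res by (auto simp: residue_map_def)

lemma red_diff: "red (a - b) = red a - red b"
  using red_simps(1)[of "a - b" b] by simp

lemma red_lift: "red (inv_into UNIV red a) = a"
  using red_simps(5) by (rule surj_f_inv_f)

lemma red_eq_ann: "\<pi> ^ (l - 1) * a = \<pi> ^ (l - 1) * b \<Longrightarrow> red a = red b"
proof -
  assume "\<pi> ^ (l - 1) * a = \<pi> ^ (l - 1) * b"
  then have "\<pi> ^ (l - 1) * (a - b) = 0" by (simp add: right_diff_distrib)
  then have "\<pi> ^ (l - (l - 1)) dvd a - b" by (intro pi_ann) auto
  moreover have "l - (l - 1) = 1" using l2 by simp
  ultimately have "red (a - b) = 0" using red_simps(4) by simp
  then show ?thesis by (simp add: red_diff)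
qed

lemma finite_k: "finite (UNIV :: 'k set)"
  using red_simps(5) by (metis finite_imageI finite)

definition lft :: "'k mat \<Rightarrow> 'r lmap" where
  "lft x = em n (map_mat (inv_into UNIV red) x)"

lemma lft_A [simp]: "lft x \<in> A" by (simp add: lft_def)

lemma phi_x_Psi:
  assumes "x \<in> carrier_mat n n" "y \<in> carrier_mat n n"
  shows "phi_x red \<pi> l \<phi> x y = Psi (scl (\<pi> ^ (l - 1)) (lft x * em n y))"
proof -
  have c: "map_mat (inv_into UNIV red) x \<in> carrier_mat n n" using assms by auto
  have "mat_trace (map_mat (inv_into UNIV red) x * y) = mtr n (lft x * em n y)"
    using mtr_em[OF mult_carrier_mat[OF c assms(2)]] em_mult[OF c assms(2)] by (simp add: lft_def)
  then show ?thesis by (simp add: phi_x_def Psi_def)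
qed

lemma em_mg: "b \<in> A \<Longrightarrow> em n (mg n b) = b"
  by (rule Mn_eqI[of _ n]) (auto simp: ent_em mg_def)

lemma gl_H: "y \<in> carrier_mat n n \<Longrightarrow> gl n (1\<^sub>m n + (\<pi> ^ (l - 1)) \<cdot>\<^sub>m y) = 1 + scl (\<pi> ^ (l - 1)) (em n y)"
  by (simp add: gl_def em_add em_smult em_one)

lemma companion_of_regular:
  assumes x: "x \<in> carrier_mat n n" "regular_mat x" and X: "X \<in> A"
    and eq: "scl (\<pi> ^ (l - 1)) X = scl (\<pi> ^ (l - 1)) (lft x)"
  obtains g where "g \<in> G" "companion n (ginv g * X * g)"
proof (rule regular_companion[OF dvr res X x(1) _ x(2)])
  fix i j assume ij: "i < n" "j < n"
  have "ent (scl (\<pi> ^ (l - 1)) X) i j = ent (scl (\<pi> ^ (l - 1)) (lft x)) i j" using eq by simp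
  then have "red (ent X i j) = red (ent (lft x) i j)" by (intro red_eq_ann) simp
  then show "red (ent X i j) = x $$ (i, j)" using ij x(1) by (simp add: lft_def ent_em red_lift)
qed blast

text \<open>Each component is \<open>x\<close> mapped to \<open>\<phi> (a i * x)\<close>, with
  \<open>a i\<close> a unit by primitivity. Taking \<open>t i\<close> as the product of the
  \<open>a k\<close> with i <= k < n - 1 makes the quotient of consecutive entries equal to
  \<open>a i\<close>, the factor by which conjugation scales the superdiagonal.\<close>

lemma nondeg_torus:
  assumes \<theta>: "nondeg_char \<pi> l n \<theta>"
  obtains t t' where "\<And>i. i < n \<Longrightarrow> t i * t' i = (1::'r)"
    "\<And>u. u \<in> U_mat n \<Longrightarrow> \<theta> u = \<phi> (sd n (dd n t * gl n u * dd n t'))"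
proof -
  obtain \<phi>s where prim: "\<And>i. i < n - 1 \<Longrightarrow> primitive_char \<pi> l (\<phi>s i)"
    and th: "\<And>u. u \<in> U_mat n \<Longrightarrow> \<theta> u = (\<Prod>i<n - 1. \<phi>s i (u $$ (i, i + 1)))"
    using \<theta> unfolding nondeg_char_def by blast
  have "\<exists>a a'. a * a' = 1 \<and> (\<forall>x. \<phi>s i x = \<phi> (a * x))" if i: "i < n - 1" for i
  proof -
    have "add_char (\<phi>s i)" using prim[OF i] by (simp add: primitive_char_def)
    then obtain a where a: "\<And>x. \<phi>s i x = \<phi> (a * x)" using phi_dual by metis
    obtain b where "\<phi>s i (\<pi> ^ (l - 1) * b) \<noteq> 1" using prim[OF i] by (auto simp: primitive_char_def)
    then have ne: "\<phi> (a * (\<pi> ^ (l - 1) * b)) \<noteq> 1" by (simp add: a)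
    have "\<not> \<pi> dvd a"
    proof
      assume "\<pi> dvd a"
      then obtain c where c: "a = \<pi> * c" by (auto elim: dvdE)
      have "a * (\<pi> ^ (l - 1) * b) = \<pi> ^ Suc (l - 1) * (c * b)" by (simp add: c mult_ac)
      also have "\<dots> = 0" using l2 pi_l by simp
      finally show False using ne phi_0 by simp
    qed
    then have "a dvd 1" using unit_iff by blast
    then show ?thesis using a by (auto elim!: dvdE) (metis)
  qed
  then obtain a a' where a: "\<And>i. i < n - 1 \<Longrightarrow> a i * a' i = 1" "\<And>i x. i < n - 1 \<Longrightarrow> \<phi>s i x = \<phi> (a i * x)"
    by metis
  define t where "t i = (\<Prod>k\<in>{i..<n - 1}. a k)" for i
  define t' where "t' i = (\<Prod>k\<in>{i..<n - 1}. a' k)" for i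
  have tt: "t i * t' i = 1" for i
    unfolding t_def t'_def prod.distrib[symmetric] by (rule prod.neutral) (use a(1) in auto)
  have ts: "t i * t' (Suc i) = a i" if "i < n - 1" for i
  proof -
    have "t i = a i * t (Suc i)" unfolding t_def using that by (simp add: prod.atLeast_Suc_lessThan)
    then show ?thesis using tt[of "Suc i"] by (simp add: mult.assoc)
  qed
  have "\<theta> u = \<phi> (sd n (dd n t * gl n u * dd n t'))" if u: "u \<in> U_mat n" for u
  proof -
    have phs: "\<phi> (\<Sum>i\<in>K. f i) = (\<Prod>i\<in>K. \<phi> (f i))" for f and K :: "nat set"
      by (induction K rule: infinite_finite_induct) (auto simp: phi_0 phi_add)
    have "sd n (dd n t * gl n u * dd n t') = (\<Sum>i<n - 1. a i * u $$ (i, i + 1))"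
      unfolding sd_def
    proof (rule sum.cong)
      fix i assume i: "i \<in> {..<n - 1}"
      then have i': "Suc i < n" "i < n - 1" by auto
      have "ent (dd n t * gl n u * dd n t') i (Suc i) = t i * ent (gl n u) i (Suc i) * t' (Suc i)"
        by (rule dd_conj(2)[OF tt gl_UU[OF u] i'(1)])
      also have "\<dots> = (t i * t' (Suc i)) * u $$ (i, i + 1)" using i' by (simp add: ent_gl mult_ac)
      finally show "ent (dd n t * gl n u * dd n t') i (Suc i) = a i * u $$ (i, i + 1)"
        using ts[OF i'(2)] by simp
    qed simp
    then show ?thesis unfolding th[OF u] by (simp add: phs a(2))
  qed
  then show ?thesis using that tt by blast
qed

theorem special_whittaker:
  assumes \<rho>: "regular_rep_GL n d \<rho> red \<pi> l \<phi>" and P: "P \<in> carrier_mat d d" "invertible_mat P"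
    and \<delta>: "is_rep (SL_mat n) n d \<delta>" and iso: "\<And>g. g \<in> SL_mat n \<Longrightarrow> P * \<delta> g = \<rho> g * P"
    and \<theta>: "nondeg_char \<pi> l n \<theta>"
  shows "has_whittaker (SL_mat n) (U_mat n) d \<delta> \<theta>"
proof -
  have irr: "irreducible_rep (GL_mat n) n d \<rho>" using \<rho> by (simp add: regular_rep_GL_def)
  have rep: "\<And>g. g \<in> GL_mat n \<Longrightarrow> \<rho> g \<in> carrier_mat d d"
    "\<And>g h. g \<in> GL_mat n \<Longrightarrow> h \<in> GL_mat n \<Longrightarrow> \<rho> (g * h) = \<rho> g * \<rho> h" "\<rho> (1\<^sub>m n) = 1\<^sub>m d"
    using irr by (auto simp: irreducible_rep_def is_rep_def)
  define sv :: "complex \<Rightarrow> (nat \<Rightarrow> complex) \<Rightarrow> nat \<Rightarrow> complex" where "sv c v = (\<lambda>i. c * v i)" for c v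
  \<comment> \<open>Coordinates from \<open>d\<close> on are left fixed, so that the unit of the
    group acts as the identity on the whole type; the representation itself lives on
    \<open>VV\<close>.\<close>
  define act where "act g v = (\<lambda>i. if i < d then \<Sum>j<d. \<rho> (mg n g) $$ (i, j) * v j else v i)"
    for g :: "'r lmap" and v :: "nat \<Rightarrow> complex"
  define VV where "VV = {v :: nat \<Rightarrow> complex. \<forall>i\<ge>d. v i = 0}"
  interpret vs: vector_space sv
    by unfold_locales (auto simp: sv_def fun_eq_iff algebra_simps)
  interpret lrep \<pi> l n \<phi> hf sv act VV
  proof
    fix g g' :: "'r lmap" and v w c assume g: "g \<in> Gn n"
    show "act g (v + w) = act g v + act g w"
      by (auto simp: act_def fun_eq_iff algebra_simps sum.distrib)
    show "act g (sv c v) = sv c (act g v)"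
      by (auto simp: act_def sv_def fun_eq_iff sum_distrib_left mult_ac)
    show "v \<in> VV \<Longrightarrow> act g v \<in> VV" by (auto simp: act_def VV_def)
    assume g': "g' \<in> Gn n"
    have R: "\<rho> (mg n (g * g')) = \<rho> (mg n g) * \<rho> (mg n g')"
      using g g' by (simp add: mg_mult Gn_minus_one rep mg_GL)
    have c: "\<rho> (mg n g) \<in> carrier_mat d d" "\<rho> (mg n g') \<in> carrier_mat d d" using g g' rep mg_GL by blast+
    show "act (g * g') v = act g (act g' v)"
    proof
      fix i
      show "act (g * g') v i = act g (act g' v) i"
      proof (cases "i < d")
        case True
        have "act (g * g') v i = (\<Sum>j<d. (\<Sum>k<d. \<rho> (mg n g) $$ (i, k) * \<rho> (mg n g') $$ (k, j)) * v j)"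
          unfolding act_def R using True c by (simp add: scalar_prod_def atLeast0LessThan)
        also have "\<dots> = (\<Sum>k<d. \<rho> (mg n g) $$ (i, k) * (\<Sum>j<d. \<rho> (mg n g') $$ (k, j) * v j))"
          by (simp add: sum_distrib_left sum_distrib_right mult.assoc) (rule sum.swap)
        finally show ?thesis using True by (simp add: act_def)
      qed (simp add: act_def)
    qed
  next
    fix v show "act 1 v = v"
      by (auto simp: act_def rep fun_eq_iff if_distrib if_distribR cong: if_cong)
    show "vs.subspace VV" by (auto simp: vs.subspace_def VV_def sv_def)
  qed
  define fn where "fn w = (\<lambda>i. if i < d then w $ i else (0::complex))" for w
  have fnV: "fn w \<in> VV" for w by (simp add: fn_def VV_def)
  have fn_act: "fn (\<rho> a *\<^sub>v w) = act (gl n a) (fn w)" if "a \<in> GL_mat n" "w \<in> carrier_vec d" for a w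
  proof -
    have "a \<in> carrier_mat n n" using that by (simp add: GL_mat_def)
    then show ?thesis using rep(1)[OF that(1)] that(2)
      by (auto simp: fn_def act_def scalar_prod_def atLeast0LessThan fun_eq_iff intro!: sum.cong)
  qed
  have fn_lin: "fn (v + w) = fn v + fn w" "fn (c \<cdot>\<^sub>v v) = sv c (fn v)"
    if "v \<in> carrier_vec d" "w \<in> carrier_vec d" for v w c
    using that by (auto simp: fn_def sv_def fun_eq_iff)
  obtain x v0 where x: "x \<in> carrier_mat n n" "regular_mat x" and v0: "v0 \<in> carrier_vec d" "v0 \<noteq> 0\<^sub>v d"
    and eig: "\<And>y. y \<in> carrier_mat n n \<Longrightarrow> 1\<^sub>m n + (\<pi> ^ (l - 1)) \<cdot>\<^sub>m y \<in> GL_mat n \<Longrightarrow>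
        \<rho> (1\<^sub>m n + (\<pi> ^ (l - 1)) \<cdot>\<^sub>m y) *\<^sub>v v0 = phi_x red \<pi> l \<phi> x y \<cdot>\<^sub>v v0"
    using \<rho> unfolding regular_rep_GL_def contains_phi_x_def by blast
  have w0: "fn v0 \<noteq> 0"
  proof
    assume "fn v0 = 0"
    then have "v0 $ i = 0" if "i < d" for i using that by (metis fn_def zero_fun_apply)
    then show False using v0 by auto
  qed
  have eigH: "act (H (l - 1) b) (fn v0) = sv (Psi (scl (\<pi> ^ (l - 1)) (lft x * b))) (fn v0)" if b: "b \<in> A" for b
  proof -
    let ?a = "1\<^sub>m n + (\<pi> ^ (l - 1)) \<cdot>\<^sub>m mg n b"
    have ac: "?a \<in> carrier_mat n n" by auto
    have gla: "gl n ?a = H (l - 1) b" unfolding gl_H[OF mg_carrier] em_mg[OF b] H_def ..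
    then have "?a = mg n (H (l - 1) b)" using mg_gl[OF ac] by simp
    then have aGL: "?a \<in> GL_mat n" using mg_GL[OF H_G[OF l1 b]] by simp
    have "act (H (l - 1) b) (fn v0) = fn (\<rho> ?a *\<^sub>v v0)" using fn_act[OF aGL v0(1)] gla by simp
    also have "\<dots> = sv (phi_x red \<pi> l \<phi> x (mg n b)) (fn v0)" using eig[OF mg_carrier aGL] fn_lin(2)[OF v0(1) v0(1)] by simp
    finally show ?thesis using phi_x_Psi[OF x(1) mg_carrier] b by (simp add: em_mg)
  qed
  obtain X where X: "X \<in> A" "scl (\<pi> ^ (l - 1)) X = scl (\<pi> ^ (l - 1)) (lft x)" "PP M X (fn v0) \<noteq> 0"
    using PP_lift[OF w0 lft_A eigH] by blast
  obtain g where g: "g \<in> G" "companion n (ginv g * X * g)" using companion_of_regular[OF x X(1,2)] .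
  obtain y where y: "y \<in> VV" "wh y \<noteq> 0" using wh_exists[OF g X(1,3) fnV] .
  obtain i0 where i0: "wh y i0 \<noteq> 0" using y(2) by (metis ext zero_fun_apply)
  obtain t t' where t: "\<And>i. i < n \<Longrightarrow> t i * t' i = (1::'r)"
    and th: "\<And>u. u \<in> U_mat n \<Longrightarrow> \<theta> u = \<phi> (sd n (dd n t * gl n u * dd n t'))"
    using nondeg_torus[OF \<theta>] by metis
  define D where "D = dd n t"
  have D: "D \<in> G" "ginv D = dd n t'" using dd_inv[OF t] by (simp_all add: D_def)
  have svi: "sv c f i = c * f i" for c f i by (simp add: sv_def)
  \<comment> \<open>Applying \<open>D\<close> first turns the standard character into
    \<open>\<theta>\<close>; the coordinate \<open>i0\<close> is one where \<open>wh y\<close> is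
    nonzero.\<close>
  define lam where "lam v = wh (act D v) i0" for v
  have lam_lin: "lam (v + w) = lam v + lam w" "lam (sv c v) = c * lam v" for v w c
    using D by (simp_all add: lam_def act_add act_sv wh_lin svi)
  have lam_U: "lam (act (gl n u) v) = \<theta> u * lam v" if u: "u \<in> U_mat n" for u v
  proof -
    have uG: "gl n u \<in> G" using gl_UU[OF u] by auto
    have c: "D * gl n u * ginv D \<in> UU n" unfolding D(2) unfolding D_def by (rule dd_conj(1)[OF t gl_UU[OF u]])
    have "act D (act (gl n u) v) = act (D * gl n u * ginv D) (act D v)"
    proof -
      have "D * gl n u * ginv D * D = D * gl n u" using Gn_inv(2)[OF D(1)] by (simp add: mult.assoc)
      then show ?thesis using act_mult[OF D(1) uG] act_mult[OF UU_G[OF c] D(1)] by metis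
    qed
    then have "lam (act (gl n u) v) = sv (\<phi> (sd n (D * gl n u * ginv D))) (wh (act D v)) i0"
      by (simp add: lam_def wh_act[OF c])
    also have "\<phi> (sd n (D * gl n u * ginv D)) = \<theta> u" unfolding th[OF u] D(2) unfolding D_def ..
    finally show ?thesis using svi[of "\<theta> u" "wh (act D v)" i0] by (simp only: lam_def)
  qed
  \<comment> \<open>Frobenius reciprocity: a functional becomes a map into the induced space by
    evaluation along the orbit, after \<open>P\<close> has carried the vector from
    \<open>\<delta>\<close> to \<open>\<rho>\<close>.\<close>
  define T where "T v g = lam (act (gl n g) (fn (P *\<^sub>v v)))" for v g
  have SLG: "gl n g \<in> G" if "g \<in> SL_mat n" for g using that SL_GL gl_Gn by blast
  have SLc: "g \<in> carrier_mat n n" if "g \<in> SL_mat n" for g :: "'r mat" using that by (simp add: SL_mat_def)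
  have Pv: "P *\<^sub>v v \<in> carrier_vec d" if "v \<in> carrier_vec d" for v using P that by simp
  have dc: "\<delta> g \<in> carrier_mat d d" if "g \<in> SL_mat n" for g using \<delta> that by (simp add: is_rep_def)
  have "\<exists>v\<in>carrier_vec d. \<exists>g\<in>SL_mat n. T v g \<noteq> 0"
  proof -
    define z where "z = act (ginv D) y"
    have zV: "z \<in> VV" unfolding z_def by (rule actV[OF ginv_Gn[OF D(1)] y(1)])
    have "act D z = y"
      unfolding z_def using act_mult[OF D(1) ginv_Gn[OF D(1)], of y] Gn_inv(1)[OF D(1)] act_one by simp
    then have lz: "lam z \<noteq> 0" using i0 by (simp add: lam_def)
    define w where "w = vec d z"
    have fw: "fn w = z" using zV by (auto simp: fn_def w_def VV_def fun_eq_iff)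
    obtain Q where Q: "inverts_mat P Q" "inverts_mat Q P" using P(2) by (auto simp: invertible_mat_def)
    have Qc: "Q \<in> carrier_mat d d" and PQ: "P * Q = 1\<^sub>m d"
      using Q P(1) unfolding inverts_mat_def
      by (metis carrier_matD carrier_matI index_mult_mat(2,3) index_one_mat(2,3))+
    have "P *\<^sub>v (Q *\<^sub>v w) = w"
      using P(1) Qc PQ by (simp add: w_def flip: assoc_mult_mat_vec[of P d d Q d])
    then have "T (Q *\<^sub>v w) (1\<^sub>m n) \<noteq> 0" using lz by (simp add: T_def fw act_one)
    moreover have "Q *\<^sub>v w \<in> carrier_vec d" using Qc by (simp add: w_def)
    moreover have "1\<^sub>m n \<in> SL_mat n" by (simp add: SL_mat_def)
    ultimately show ?thesis by blast
  qed
  moreover have "T (v + w) g = T v g + T w g" if "v \<in> carrier_vec d" "w \<in> carrier_vec d" "g \<in> SL_mat n" for v w g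
    using that P SLG Pv by (simp add: T_def mult_add_distrib_mat_vec[of P d d] fn_lin act_add lam_lin)
  moreover have "T (c \<cdot>\<^sub>v v) g = c * T v g" if "v \<in> carrier_vec d" "g \<in> SL_mat n" for c v g
    using that P SLG Pv by (simp add: T_def mult_mat_vec[of P d d] fn_lin(2)[OF Pv Pv] act_sv lam_lin)
  moreover have "T v (u * g) = \<theta> u * T v g" if "v \<in> carrier_vec d" "u \<in> U_mat n" "g \<in> SL_mat n" for v u g
    using that SLG SLc U_SL[OF that(2)] by (simp add: T_def gl_mult act_mult lam_U)
  moreover have "T (\<delta> h *\<^sub>v v) g = T v (g * h)" if "v \<in> carrier_vec d" "h \<in> SL_mat n" "g \<in> SL_mat n" for v h g
  proof -
    have "P *\<^sub>v (\<delta> h *\<^sub>v v) = \<rho> h *\<^sub>v (P *\<^sub>v v)"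
      using that P dc[OF that(2)] rep(1)[OF SL_GL[OF that(2)]] iso[OF that(2)]
      by (metis assoc_mult_mat_vec)
    then show ?thesis using that SLG SLc fn_act[OF SL_GL[OF that(2)] Pv[OF that(1)]]
      by (simp add: T_def gl_mult act_mult)
  qed
  ultimately show ?thesis unfolding has_whittaker_def by (intro exI[of _ T]) blast
qed

end

section \<open>All Whittaker models imply special-regularity\<close>

lemma (in vector_space) dim_psubset:
  assumes W: "subspace W" "W \<subseteq> V" and V: "V \<subseteq> span B0" "finite B0" and v: "v \<in> V" "v \<notin> W"
  shows "dim W < dim V"
proof -
  obtain b where b: "b \<subseteq> W" "independent b" "W \<subseteq> span b" "card b = dim W" by (rule basis_exists)
  obtain b' where b': "b' \<subseteq> V" "independent b'" "V \<subseteq> span b'" "card b' = dim V" by (rule basis_exists)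
  have fb: "finite b" "finite b'"
    using independent_span_bound[OF V(2)] b b' W V by (meson order_trans)+
  have "span b \<subseteq> W" using b(1) W(1) by (rule span_minimal)
  then have "v \<notin> span b" using v by blast
  then have "independent (insert v b)" using b(2) by (rule independent_insertI)
  moreover have "insert v b \<subseteq> span b'" using v b W b' by blast
  ultimately have "card (insert v b) \<le> card b'" using independent_span_bound[OF fb(2)] by blast
  moreover have "v \<notin> b" using v b by blast
  ultimately show ?thesis using fb b(4) b'(4) by simp
qed

lemma sum_fun_apply: "(\<Sum>k\<in>K. f k) x = (\<Sum>k\<in>K. f k x)"
  by (induction K rule: infinite_finite_induct) auto

context rtrunc
begin

section \<open>The special linear subgroup and a torus complement\<close>

definition SLl :: "'r lmap set" where "SLl = {g \<in> G. det (mg n g) = 1}"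

lemma SLl_G: "g \<in> SLl \<Longrightarrow> g \<in> G" by (simp add: SLl_def)

lemma SLl_mg: "g \<in> SLl \<Longrightarrow> mg n g \<in> SL_mat n" by (simp add: SLl_def SL_mat_def)

lemma gl_SLl: "a \<in> SL_mat n \<Longrightarrow> gl n a \<in> SLl"
  using gl_Gn[OF SL_GL] by (auto simp: SLl_def SL_mat_def)

lemma det_mg_mult: "g \<in> G \<Longrightarrow> g' \<in> G \<Longrightarrow> det (mg n (g * g')) = det (mg n g) * det (mg n g')"
  by (simp add: mg_mult Gn_minus_one det_mult[OF mg_carrier mg_carrier])

lemma det_mg_ginv: "g \<in> G \<Longrightarrow> det (mg n g) * det (mg n (ginv g)) = 1"
  by (simp flip: det_mg_mult)

lemma SLl_closed: "1 \<in> SLl" "g \<in> SLl \<Longrightarrow> g' \<in> SLl \<Longrightarrow> g * g' \<in> SLl"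
  by (auto simp: SLl_def det_mg_mult)

lemma SLl_conj: "t \<in> G \<Longrightarrow> g \<in> SLl \<Longrightarrow> t * g * ginv t \<in> SLl" "t \<in> G \<Longrightarrow> g \<in> SLl \<Longrightarrow> ginv t * g * t \<in> SLl"
  using det_mg_ginv[of t] by (auto simp: SLl_def det_mg_mult mult.commute)

text \<open>\<open>G = SL\<^sub>n T\<close> for the torus \<open>T\<close> of matrices \<open>diag(c, 1, \<dots>, 1)\<close>.\<close>

lemma SLl_torus:
  assumes g: "g \<in> G"
  obtains s t t' where "s \<in> SLl" "g = s * dd n t" "\<And>i. i < n \<Longrightarrow> t i * t' i = (1::'r)"
proof -
  define t where "t i = (if i = 0 then det (mg n g) else 1)" for i :: nat
  define t' where "t' i = (if i = 0 then det (mg n (ginv g)) else 1)" for i :: nat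
  have tt: "t i * t' i = 1" "t' i * t i = 1" for i using det_mg_ginv[OF g] by (auto simp: t_def t'_def mult.commute)
  have D: "dd n t \<in> G" "ginv (dd n t) = dd n t'" "dd n t' \<in> G" using dd_inv[OF tt(1)] dd_inv[OF tt(2)] by auto
  have pr: "(\<Prod>i<n. t' i) = det (mg n (ginv g))"
  proof -
    have "(\<Prod>i<n. t' i) = (\<Prod>i\<in>{0}. t' i)"
      by (rule prod.mono_neutral_right) (use n0 in \<open>auto simp: t'_def\<close>)
    then show ?thesis by (simp add: t'_def)
  qed
  have "g * dd n t' \<in> SLl" using g D(3) det_mg_ginv[OF g] by (simp add: SLl_def det_mg_mult det_dd pr)
  moreover have "g = g * dd n t' * dd n t" using Gn_inv(2)[OF D(1)] by (simp add: D(2) mult.assoc)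
  ultimately show ?thesis using that tt(1) by blast
qed

text \<open>The factors \<open>a i\<close> are inverse to those by which conjugation by
  \<open>dd n t\<close> scales the superdiagonal, so this \<open>\<theta>\<close> is the standard
  character transported by the torus element.\<close>

lemma std_char:
  assumes tt: "\<And>i. i < n \<Longrightarrow> t i * t' i = (1::'r)"
  obtains \<theta> where "nondeg_char \<pi> l n \<theta>" "\<And>u. u \<in> UU n \<Longrightarrow> \<theta> (mg n (dd n t * u * dd n t')) = \<phi> (sd n u)"
proof -
  define a where "a i = t' i * t (Suc i)" for i
  define \<theta> where "\<theta> u = (\<Prod>i<n - 1. \<phi> (a i * u $$ (i, i + 1)))" for u :: "'r mat"
  have "primitive_char \<pi> l (\<lambda>x. \<phi> (a i * x))" if i: "i < n - 1" for i
  proof -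
    have "a i * (t i * t' (Suc i)) = (t i * t' i) * (t (Suc i) * t' (Suc i))" by (simp add: a_def mult_ac)
    also have "\<dots> = 1" using tt i by simp
    finally have 1: "a i * (t i * t' (Suc i)) = 1" .
    obtain b where b: "\<phi> (\<pi> ^ (l - 1) * b) \<noteq> 1" using prim by (auto simp: primitive_char_def)
    have "a i * (\<pi> ^ (l - 1) * (t i * t' (Suc i) * b)) = \<pi> ^ (l - 1) * ((a i * (t i * t' (Suc i))) * b)"
      by (simp only: mult_ac)
    then have "\<phi> (a i * (\<pi> ^ (l - 1) * (t i * t' (Suc i) * b))) \<noteq> 1" using b 1 by simp
    then show ?thesis unfolding primitive_char_def add_char_def
      by (auto simp: phi_0 distrib_left phi_add)
  qed
  then have "nondeg_char \<pi> l n \<theta>" unfolding nondeg_char_def \<theta>_def by (intro exI[of _ "\<lambda>i x. \<phi> (a i * x)"]) auto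
  moreover have "\<theta> (mg n (dd n t * u * dd n t')) = \<phi> (sd n u)" if u: "u \<in> UU n" for u
  proof -
    have phs: "\<phi> (\<Sum>i\<in>K. f i) = (\<Prod>i\<in>K. \<phi> (f i))" for f and K :: "nat set"
      by (induction K rule: infinite_finite_induct) (auto simp: phi_0 phi_add)
    have "a i * mg n (dd n t * u * dd n t') $$ (i, i + 1) = ent u i (Suc i)" if "i < n - 1" for i
    proof -
      have i: "Suc i < n" "i < n" using that by auto
      have "a i * mg n (dd n t * u * dd n t') $$ (i, i + 1) = a i * (t i * ent u i (Suc i) * t' (Suc i))"
        using i dd_conj(2)[OF tt u i(1)] by (simp add: mg_def)
      also have "\<dots> = (t i * t' i) * (t (Suc i) * t' (Suc i)) * ent u i (Suc i)" by (simp add: a_def mult_ac)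
      also have "\<dots> = ent u i (Suc i)" using tt i by simp
      finally show ?thesis .
    qed
    then show ?thesis by (simp add: \<theta>_def sd_def phs)
  qed
  ultimately show ?thesis using that by blast
qed

theorem whittaker_special:
  assumes \<delta>: "regular_rep_SL n d \<delta> red \<pi> l \<phi>"
    and all: "\<And>\<theta>. nondeg_char \<pi> l n \<theta> \<Longrightarrow> has_whittaker (SL_mat n) (U_mat n) d \<delta> \<theta>"
  obtains \<rho> where "regular_rep_GL n d \<rho> red \<pi> l \<phi>" "\<And>g. g \<in> SL_mat n \<Longrightarrow> \<rho> g = \<delta> g"
proof -
  have irr\<delta>: "irreducible_rep (SL_mat n) n d \<delta>" using \<delta> by (simp add: regular_rep_SL_def)
  have rep: "\<And>g. g \<in> SL_mat n \<Longrightarrow> \<delta> g \<in> carrier_mat d d"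
    "\<And>g h. g \<in> SL_mat n \<Longrightarrow> h \<in> SL_mat n \<Longrightarrow> \<delta> (g * h) = \<delta> g * \<delta> h" "\<delta> (1\<^sub>m n) = 1\<^sub>m d" "d > 0"
    using irr\<delta> by (auto simp: irreducible_rep_def is_rep_def)
  define sv :: "complex \<Rightarrow> ('r lmap \<Rightarrow> nat \<Rightarrow> complex) \<Rightarrow> 'r lmap \<Rightarrow> nat \<Rightarrow> complex"
    where "sv c F = (\<lambda>x i. c * F x i)" for c F
  define act :: "'r lmap \<Rightarrow> ('r lmap \<Rightarrow> nat \<Rightarrow> complex) \<Rightarrow> 'r lmap \<Rightarrow> nat \<Rightarrow> complex"
    where "act g F = (\<lambda>x. F (x * g))" for g F
  define dl where "dl s v = (\<lambda>i. if i < d then \<Sum>j<d. \<delta> (mg n s) $$ (i, j) * v j else (0::complex))" for s v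
  \<comment> \<open>The induced representation: functions on \<open>G\<close>, covariant on the left
    under the special linear group, with right translation as action. Values off \<open>G\<close>
    and coordinates from \<open>d\<close> on are set to 0 to make representatives unique.\<close>
  define I where "I = {F :: 'r lmap \<Rightarrow> nat \<Rightarrow> complex. (\<forall>x i. x \<notin> G \<or> i \<ge> d \<longrightarrow> F x i = 0) \<and>
      (\<forall>s\<in>SLl. \<forall>x\<in>G. F (s * x) = dl s (F x))}"
  interpret vs: vector_space sv
    by unfold_locales (auto simp: sv_def fun_eq_iff algebra_simps)
  have dl_lin: "dl s (v + w) = dl s v + dl s w" "dl s (\<lambda>i. c * v i) = (\<lambda>i. c * dl s v i)" for s v w c
    by (auto simp: dl_def fun_eq_iff algebra_simps sum.distrib sum_distrib_left)
  have dl_vec: "vec d (dl s v) = \<delta> (mg n s) *\<^sub>v vec d v" if "s \<in> SLl" for s v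
    using rep(1)[OF SLl_mg[OF that]]
    by (intro eq_vecI) (auto simp: dl_def scalar_prod_def atLeast0LessThan intro!: sum.cong)
  have vec_inj: "v = w" if "vec d v = vec d w" "\<And>i. i \<ge> d \<Longrightarrow> v i = 0" "\<And>i. i \<ge> d \<Longrightarrow> w i = 0"
    for v w :: "nat \<Rightarrow> complex"
  proof
    fix i show "v i = w i"
    proof (cases "i < d")
      case True
      then have "vec d v $ i = vec d w $ i" using that(1) by simp
      then show ?thesis using True by simp
    qed (use that in auto)
  qed
  have dl_supp: "dl s v i = 0" if "i \<ge> d" for s v i using that by (simp add: dl_def)
  have dl_mult: "dl (s * s') v = dl s (dl s' v)" if s: "s \<in> SLl" "s' \<in> SLl" for s s' v
  proof (rule vec_inj[OF _ dl_supp dl_supp])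
    have "vec d (dl (s * s') v) = (\<delta> (mg n s) * \<delta> (mg n s')) *\<^sub>v vec d v"
      using s SLl_closed SLl_G SLl_mg by (simp add: dl_vec mg_mult Gn_minus_one rep)
    also have "\<dots> = \<delta> (mg n s) *\<^sub>v (\<delta> (mg n s') *\<^sub>v vec d v)"
      using rep(1)[OF SLl_mg[OF s(1)]] rep(1)[OF SLl_mg[OF s(2)]] by (intro assoc_mult_mat_vec) auto
    finally show "vec d (dl (s * s') v) = vec d (dl s (dl s' v))" using s by (simp add: dl_vec)
  qed
  have I_eq: "F (s * x) = dl s (F x)" if "F \<in> I" "s \<in> SLl" "x \<in> G" for F s x
    using that by (simp add: I_def)
  have Isub: "vs.subspace I"
    unfolding vs.subspace_def
  proof (intro conjI ballI allI)
    have "dl s 0 = 0" for s using dl_lin(2)[of s 0 "\<lambda>_. 0"] by (simp add: zero_fun_def)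
    then show "0 \<in> I" by (simp add: I_def)
    show "F + F' \<in> I" if "F \<in> I" "F' \<in> I" for F F'
      using that by (auto simp: I_def dl_lin)
    show "sv c F \<in> I" if "F \<in> I" for c F
      using that by (auto simp: I_def sv_def dl_lin)
  qed
  have Iact: "act g F \<in> I" if g: "g \<in> G" and F: "F \<in> I" for g F
  proof -
    have "x \<in> G" if "x * g \<in> G" for x
    proof -
      have "x * g * ginv g \<in> G" by (rule Gn_mult[OF that ginv_Gn[OF g]])
      then show ?thesis using Gn_inv(1)[OF g] by (simp add: mult.assoc)
    qed
    then have out: "x * g \<notin> G" if "x \<notin> G" for x using that by blast
    show ?thesis
      unfolding I_def act_def mem_Collect_eq
    proof (intro conjI allI impI ballI)
      fix x i assume "x \<notin> G \<or> i \<ge> d"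
      then have "x * g \<notin> G \<or> i \<ge> d" using out by metis
      then show "F (x * g) i = 0" using F by (simp add: I_def)
    next
      fix s x assume "s \<in> SLl" "x \<in> G"
      then show "F (s * x * g) = dl s (F (x * g))" using F Gn_mult[OF _ g, of x] by (simp add: I_def mult.assoc)
    qed
  qed
  \<comment> \<open>Point masses need not lie in \<open>I\<close>; they only bound its
    dimension.\<close>
  define Bas where "Bas = (\<lambda>(x, i). (\<lambda>y j. if y = x \<and> j = i then 1 else (0::complex))) ` (G \<times> {..<d})"
  have finB: "finite Bas" by (simp add: Bas_def)
  have IB: "I \<subseteq> vs.span Bas"
  proof
    fix F assume F: "F \<in> I"
    define e where "e x i = (\<lambda>y j. if y = x \<and> j = i then 1 else (0::complex))" for x :: "'r lmap" and i :: nat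
    have "F = (\<Sum>x\<in>G. \<Sum>i<d. sv (F x i) (e x i))"
    proof (intro ext)
      fix y j
      have "(\<Sum>x\<in>G. \<Sum>i<d. sv (F x i) (e x i)) y j = (\<Sum>x\<in>G. \<Sum>i<d. F x i * e x i y j)"
        by (simp add: sum_fun_apply sv_def)
      also have "\<dots> = (\<Sum>x\<in>G. \<Sum>i<d. if i = j then (if x = y then F y j else 0) else 0)"
        by (intro sum.cong) (auto simp: e_def)
      also have "\<dots> = (\<Sum>x\<in>G. if x = y then (if j < d then F y j else 0) else 0)"
        by (intro sum.cong) auto
      also have "\<dots> = F y j" using F by (auto simp: I_def)
      finally show "F y j = (\<Sum>x\<in>G. \<Sum>i<d. sv (F x i) (e x i)) y j" ..
    qed
    also have "\<dots> \<in> vs.span Bas"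
      by (intro vs.span_sum vs.span_scale vs.span_base) (auto simp: Bas_def e_def)
    finally show "F \<in> vs.span Bas" .
  qed
  obtain x0 v0 where x0: "x0 \<in> carrier_mat n n" "regular_mat x0" and v0: "v0 \<in> carrier_vec d" "v0 \<noteq> 0\<^sub>v d"
    and eig: "\<And>y. y \<in> carrier_mat n n \<Longrightarrow> 1\<^sub>m n + (\<pi> ^ (l - 1)) \<cdot>\<^sub>m y \<in> SL_mat n \<Longrightarrow>
        \<delta> (1\<^sub>m n + (\<pi> ^ (l - 1)) \<cdot>\<^sub>m y) *\<^sub>v v0 = phi_x red \<pi> l \<phi> x0 y \<cdot>\<^sub>v v0"
    using \<delta> unfolding regular_rep_SL_def contains_phi_x_def by blast
  have Inz: "I \<noteq> {0}"
  proof -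
    define F where "F x = (if x \<in> SLl then dl x (\<lambda>i. v0 $ i) else 0)" for x
    have "F \<in> I"
    proof -
      have "x \<in> SLl" if "s * x \<in> SLl" "s \<in> SLl" "x \<in> G" for s x
        using that SLl_G[OF that(2)] by (simp add: SLl_def det_mg_mult)
      then have iff: "s * x \<in> SLl \<longleftrightarrow> x \<in> SLl" if "s \<in> SLl" "x \<in> G" for s x
        using that SLl_closed(2) by blast
      have dl0: "dl s 0 = 0" for s using dl_lin(2)[of s 0 "\<lambda>_. 0"] by (simp add: zero_fun_def)
      show ?thesis
        unfolding I_def mem_Collect_eq
      proof (intro conjI allI impI ballI)
        fix x i assume "x \<notin> G \<or> i \<ge> d"
        then show "F x i = 0" using SLl_G[of x] dl_supp[of i] by (cases "x \<in> SLl") (auto simp: F_def)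
      next
        fix s x assume s: "s \<in> SLl" "x \<in> G"
        then show "F (s * x) = dl s (F x)" using iff[OF s] dl_mult[OF s(1), of x] dl0 by (simp add: F_def)
      qed
    qed
    moreover have "F \<noteq> 0"
    proof
      assume "F = 0"
      then have "F 1 i = 0" for i by simp
      then have "vec d (dl 1 (\<lambda>i. v0 $ i)) = 0\<^sub>v d" by (intro eq_vecI) (auto simp: F_def SLl_closed)
      then have "\<delta> (mg n 1) *\<^sub>v vec d (\<lambda>i. v0 $ i) = 0\<^sub>v d" using dl_vec[OF SLl_closed(1)] by simp
      moreover have "vec d (\<lambda>i. v0 $ i) = v0" using v0 by (intro eq_vecI) auto
      ultimately show False using v0 rep(3) by simp
    qed
    ultimately show ?thesis by blast
  qed
  \<comment> \<open>A nonzero subrepresentation of least dimension is irreducible.\<close>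
  define Q where "Q W \<longleftrightarrow> vs.subspace W \<and> W \<subseteq> I \<and> W \<noteq> {0} \<and> (\<forall>g\<in>G. \<forall>F\<in>W. act g F \<in> W)" for W
  have "Q I" using Isub Inz Iact by (auto simp: Q_def)
  then obtain V where V: "Q V" and min: "\<And>W. Q W \<Longrightarrow> vs.dim V \<le> vs.dim W"
    using ex_has_least_nat[of Q I vs.dim] by blast
  interpret lrep \<pi> l n \<phi> hf sv act V
  proof
    show "vs.subspace V" using V by (simp add: Q_def)
    show "v \<in> V \<Longrightarrow> act g v \<in> V" if "g \<in> G" for g v using V that by (auto simp: Q_def)
  qed (auto simp: act_def sv_def fun_eq_iff mult.assoc)
  have VI: "V \<subseteq> I" and Vnz: "V \<noteq> {0}" using V by (auto simp: Q_def)
  have VB: "V \<subseteq> vs.span Bas" using VI IB by blast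
  have irrV: irr
    unfolding irr_def
  proof (intro allI impI)
    fix W assume W: "vs.subspace W \<and> W \<subseteq> V \<and> (\<forall>g\<in>G. \<forall>w\<in>W. act g w \<in> W)"
    show "W = {0} \<or> W = V"
    proof (rule ccontr)
      assume ne: "\<not> (W = {0} \<or> W = V)"
      then have "Q W" using W VI by (auto simp: Q_def)
      moreover obtain v where "v \<in> V" "v \<notin> W" using W ne by blast
      ultimately show False using min vs.dim_psubset[of W V Bas v] W VB finB by fastforce
    qed
  qed
  \<comment> \<open>The identity \<open>s * t = t * (ginv t * s * t)\<close> turns left covariance
    into right translation, so the values at \<open>t\<close> form an invariant subspace of
    \<open>\<delta>\<close>, which is everything once it is nonzero. Stability of \<open>W\<close>
    under the special linear group suffices, as needed for the kernel \<open>N\<close>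
    below.\<close>
  have onto: "\<exists>F\<in>W. vec d (F t) = w"
    if W: "vs.subspace W" "W \<subseteq> I" "\<And>s F. s \<in> SLl \<Longrightarrow> F \<in> W \<Longrightarrow> act s F \<in> W"
      and t: "t \<in> G" and F0: "F0 \<in> W" "F0 t \<noteq> 0" and w: "w \<in> carrier_vec d" for W t F0 w
  proof -
    define S where "S = (\<lambda>F. vec d (F t)) ` W"
    have inv: "invariant_subspace (SL_mat n) d \<delta> S"
      unfolding invariant_subspace_def
    proof (intro conjI ballI allI)
      show "S \<subseteq> carrier_vec d" by (auto simp: S_def)
      have "vec d ((0 :: 'r lmap \<Rightarrow> nat \<Rightarrow> complex) t) = 0\<^sub>v d" by (intro eq_vecI) auto
      then show "0\<^sub>v d \<in> S" using vs.subspace_0[OF W(1)] unfolding S_def by (metis imageI)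
      fix v assume "v \<in> S"
      then obtain F where F: "F \<in> W" "v = vec d (F t)" by (auto simp: S_def)
      show "c \<cdot>\<^sub>v v \<in> S" for c
      proof -
        have "c \<cdot>\<^sub>v v = vec d (sv c F t)" by (intro eq_vecI) (auto simp: F sv_def)
        then show ?thesis using vs.subspace_scale[OF W(1) F(1)] by (auto simp: S_def)
      qed
      show "\<delta> g *\<^sub>v v \<in> S" if g: "g \<in> SL_mat n" for g
      proof -
        define s where "s = gl n g"
        have s: "s \<in> SLl" "mg n s = g" using gl_SLl[OF g] g by (auto simp: s_def SL_mat_def)
        have "\<delta> g *\<^sub>v v = vec d (F (s * t))" using F W(2) s t by (auto simp: I_def dl_vec)
        also have "s * t = t * (ginv t * s * t)" using t by (simp add: mult.assoc)
        also have "F \<dots> = act (ginv t * s * t) F t" by (simp add: act_def)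
        finally show ?thesis using W(3)[OF SLl_conj(2)[OF t s(1)] F(1)] by (auto simp: S_def)
      qed
      fix v' assume "v' \<in> S"
      then obtain F' where F': "F' \<in> W" "v' = vec d (F' t)" by (auto simp: S_def)
      have "v + v' = vec d ((F + F') t)" by (intro eq_vecI) (auto simp: F F')
      then show "v + v' \<in> S" using vs.subspace_add[OF W(1) F(1) F'(1)] unfolding S_def by (metis imageI)
    qed
    have "S \<noteq> {0\<^sub>v d}"
    proof
      assume S: "S = {0\<^sub>v d}"
      have "vec d (F0 t) = 0\<^sub>v d" using F0(1) S by (auto simp: S_def)
      then have "vec d (F0 t) = vec d (\<lambda>i. 0)" by (simp add: zero_vec_def)
      then have "F0 t = (\<lambda>i. 0)" using F0(1) W(2) by (intro vec_inj) (auto simp: I_def)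
      then show False using F0(2) by (simp add: zero_fun_def)
    qed
    then have "S = carrier_vec d" using inv irr\<delta> by (auto simp: irreducible_rep_def)
    then have "w \<in> S" using w by simp
    then obtain F where "w = vec d (F t)" "F \<in> W" unfolding S_def by (rule imageE)
    then show ?thesis by (intro bexI[of _ F]) simp_all
  qed
  \<comment> \<open>For each torus element \<open>D\<close> the model of \<open>\<delta>\<close> is
    taken for the character that becomes standard after conjugation by \<open>D\<close>. Evaluations
    at different points thus give functionals for one and the same character.\<close>
  have functional: "\<exists>T. whit (\<lambda>F. T (vec d (F D))) \<and> (\<exists>w\<in>carrier_vec d. T w \<noteq> 0) \<and> T (0\<^sub>v d) = 0"
    if tt: "\<And>i. i < n \<Longrightarrow> t i * t' i = (1::'r)" and D: "D = dd n t" for t t' D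
  proof -
    have DG: "D \<in> G" "ginv D = dd n t'" using dd_inv[OF tt] by (auto simp: D)
    obtain \<theta> where \<theta>: "nondeg_char \<pi> l n \<theta>" "\<And>u. u \<in> UU n \<Longrightarrow> \<theta> (mg n (dd n t * u * dd n t')) = \<phi> (sd n u)"
      by (rule std_char[of t t']) (use tt in blast)+
    obtain T where T0: "\<forall>v\<in>carrier_vec d. \<forall>w\<in>carrier_vec d. \<forall>g\<in>SL_mat n. T (v + w) g = T v g + T w g"
      "\<forall>c. \<forall>v\<in>carrier_vec d. \<forall>g\<in>SL_mat n. T (c \<cdot>\<^sub>v v) g = c * T v g"
      "\<forall>v\<in>carrier_vec d. \<forall>u\<in>U_mat n. \<forall>g\<in>SL_mat n. T v (u * g) = \<theta> u * T v g"
      "\<forall>v\<in>carrier_vec d. \<forall>h\<in>SL_mat n. \<forall>g\<in>SL_mat n. T (\<delta> h *\<^sub>v v) g = T v (g * h)"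
      "\<exists>v\<in>carrier_vec d. \<exists>g\<in>SL_mat n. T v g \<noteq> 0"
      using all[OF \<theta>(1)] unfolding has_whittaker_def by blast
    note T = T0[rule_format]
    have one: "(1\<^sub>m n :: 'r mat) \<in> SL_mat n" by (simp add: SL_mat_def)
    have SLc: "g \<in> carrier_mat n n" if "g \<in> SL_mat n" for g :: "'r mat" using that by (simp add: SL_mat_def)
    define T1 where "T1 v = T v (1\<^sub>m n)" for v
    have "whit (\<lambda>F. T1 (vec d (F D)))"
      unfolding whit_def
    proof (intro conjI allI ballI)
      fix F F' :: "'r lmap \<Rightarrow> nat \<Rightarrow> complex"
      have "vec d ((F + F') D) = vec d (F D) + vec d (F' D)" by (intro eq_vecI) auto
      then show "T1 (vec d ((F + F') D)) = T1 (vec d (F D)) + T1 (vec d (F' D))"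
        by (simp add: T1_def T(1) one)
      have "vec d (sv c F D) = c \<cdot>\<^sub>v vec d (F D)" for c by (intro eq_vecI) (auto simp: sv_def)
      then show "T1 (vec d (sv c F D)) = c * T1 (vec d (F D))" for c
        by (simp add: T1_def T(2) one)
    next
      fix u :: "'r lmap" and F assume u: "u \<in> UU n" and F: "F \<in> V"
      define s where "s = D * u * ginv D"
      have sU: "s \<in> UU n" unfolding s_def DG(2) unfolding D by (rule dd_conj(1)[OF tt u])
      have sm: "mg n s \<in> U_mat n" by (rule mg_U[OF sU])
      have sS: "s \<in> SLl" using U_SL[OF sm] sU by (auto simp: SLl_def SL_mat_def)
      have "s * D = D * u" using Gn_inv[OF DG(1)] by (simp add: s_def mult.assoc)
      then have "act u F D = F (s * D)" by (simp add: act_def)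
      also have "\<dots> = dl s (F D)" using F VI sS DG by (auto simp: I_def)
      finally have "T1 (vec d (act u F D)) = T (\<delta> (mg n s) *\<^sub>v vec d (F D)) (1\<^sub>m n)"
        by (simp add: T1_def dl_vec[OF sS])
      also have "\<dots> = T (vec d (F D)) (mg n s * 1\<^sub>m n)"
        using T(4)[of "vec d (F D)" "mg n s" "1\<^sub>m n"] U_SL[OF sm] one SLc
        by (simp add: left_mult_one_mat[OF mg_carrier] right_mult_one_mat[OF mg_carrier])
      also have "\<dots> = \<theta> (mg n s) * T1 (vec d (F D))"
        unfolding T1_def by (rule T(3)) (use sm one in auto)
      also have "\<theta> (mg n s) = \<phi> (sd n u)" unfolding s_def DG(2) unfolding D by (rule \<theta>(2)[OF u])
      finally show "T1 (vec d (act u F D)) = \<phi> (sd n u) * T1 (vec d (F D))" .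
    qed
    moreover have "\<exists>w\<in>carrier_vec d. T1 w \<noteq> 0"
    proof -
      obtain v g where vg: "v \<in> carrier_vec d" "g \<in> SL_mat n" "T v g \<noteq> 0" using T(5) by blast
      have "T1 (\<delta> g *\<^sub>v v) = T v g" unfolding T1_def using T(4)[OF vg(1,2) one] SLc[OF vg(2)] by simp
      then show ?thesis using vg rep(1)[OF vg(2)] by (intro bexI[of _ "\<delta> g *\<^sub>v v"]) auto
    qed
    moreover have "T1 (0\<^sub>v d) = 0"
    proof -
      have "T1 (0 \<cdot>\<^sub>v 0\<^sub>v d) = 0" unfolding T1_def by (subst T(2)) (auto simp: one)
      moreover have "(0 :: complex) \<cdot>\<^sub>v 0\<^sub>v d = 0\<^sub>v d" by (intro eq_vecI) auto
      ultimately show ?thesis by simp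
    qed
    ultimately show ?thesis by blast
  qed
  have subVV: "vs.subspace V" using V by (simp add: Q_def)
  have SLact: "act s F \<in> V" if "s \<in> SLl" "F \<in> V" for s F using that SLl_G actV by blast
  obtain F1 where F1: "F1 \<in> V" "F1 1 \<noteq> 0"
  proof -
    obtain F where F: "F \<in> V" "F \<noteq> 0" using Vnz vs.subspace_0[OF subVV] by blast
    then obtain g i where gi: "F g i \<noteq> 0" by (metis ext zero_fun_apply)
    then have g: "g \<in> G" using F VI by (auto simp: I_def)
    have "act g F 1 \<noteq> 0" using gi by (auto simp: act_def fun_eq_iff)
    then show ?thesis using that actV[OF g F(1)] by blast
  qed
  have dd1: "1 = dd n (\<lambda>_. 1 :: 'r)" by (rule dd_one[symmetric]) simp
  have ker: "F = 0" if F: "F \<in> V" "F 1 = 0" for F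
  proof (rule ccontr)
    assume "F \<noteq> 0"
    then obtain g i where gi: "F g i \<noteq> 0" by (metis ext zero_fun_apply)
    then have g: "g \<in> G" using F VI by (auto simp: I_def)
    obtain s t t' where st: "s \<in> SLl" "g = s * dd n t" and tt: "\<And>i. i < n \<Longrightarrow> t i * t' i = (1::'r)"
      by (rule SLl_torus[OF g]) blast
    define D where "D = dd n t"
    have DG: "D \<in> G" using dd_inv(1)[OF tt] by (simp add: D_def)
    have "F g = dl s (F D)" using F VI st DG by (auto simp: I_def D_def)
    then have FD: "F D \<noteq> 0" using gi dl_lin(2)[of s 0 "\<lambda>_. 0"] by (auto simp: zero_fun_def)
    define N where "N = {F \<in> V. F 1 = 0}"
    have Nsub: "vs.subspace N"
      using subVV by (auto simp: N_def vs.subspace_def sv_def zero_fun_def)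
    have Nact: "act s F \<in> N" if s: "s \<in> SLl" and F: "F \<in> N" for s F
    proof -
      have "F (s * 1) = dl s (F 1)" using F s VI by (intro I_eq) (auto simp: N_def)
      then have "act s F 1 = 0" using F dl_lin(2)[of s 0 "\<lambda>_. 0"] by (auto simp: act_def N_def zero_fun_def)
      then show ?thesis using SLact s F by (auto simp: N_def)
    qed
    obtain T where T: "whit (\<lambda>F. T (vec d (F 1)))" "\<exists>w\<in>carrier_vec d. T w \<noteq> 0" "T (0\<^sub>v d) = 0"
      using functional[of "\<lambda>_. 1" "\<lambda>_. 1" 1] dd1 by auto
    obtain T' where T': "whit (\<lambda>F. T' (vec d (F D)))" "\<exists>w\<in>carrier_vec d. T' w \<noteq> 0"
      using functional[OF tt D_def] by blast
    obtain w where w: "w \<in> carrier_vec d" "T w \<noteq> 0" using T(2) by blast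
    obtain F2 where F2: "F2 \<in> V" "vec d (F2 1) = w"
      using onto[of V 1 F1 w] subVV VI SLact Gn_one F1 w(1) by blast
    obtain w' where w': "w' \<in> carrier_vec d" "T' w' \<noteq> 0" using T'(2) by blast
    have "F \<in> N" using F by (simp add: N_def)
    moreover have "N \<subseteq> I" using VI by (auto simp: N_def)
    ultimately obtain F3 where F3: "F3 \<in> N" "vec d (F3 D) = w'"
      using onto[of N D F w'] Nsub Nact DG FD w'(1) by blast
    have F3V: "F3 \<in> V" and F31: "vec d (F3 1) = 0\<^sub>v d" using F3(1) by (auto simp: N_def)
    \<comment> \<open>\<open>F3\<close> vanishes at 1, which kills the right-hand side, while both
      factors on the left are nonzero by choice.\<close>
    have "T (vec d (F2 1)) * T' (vec d (F3 D)) = T (vec d (F3 1)) * T' (vec d (F2 D))"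
      by (rule multiplicity_one[OF irrV finB VB T(1) T'(1) F2(1) F3V])
    then show False using w(2) w'(2) F2 F3 F31 T(3) by simp
  qed
  have inj: "F = F'" if "F \<in> V" "F' \<in> V" "vec d (F 1) = vec d (F' 1)" for F F'
  proof -
    have "F 1 = F' 1" using that VI by (intro vec_inj) (auto simp: I_def)
    then have "(F - F') 1 = 0" by simp
    then have "F - F' = 0" using ker[OF vs.subspace_diff[OF subVV that(1,2)]] by simp
    then show ?thesis by simp
  qed
  have "\<exists>F\<in>V. vec d (F 1) = unit_vec d j" for j
    by (rule onto[of V 1 F1]) (use subVV VI SLact F1 in auto)
  then obtain b where b: "\<And>j. b j \<in> V" "\<And>j. vec d (b j 1) = unit_vec d j" by metis
  have b1: "b j 1 i = (if i = j then 1 else 0)" if "i < d" "j < d" for i j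
  proof -
    have "vec d (b j 1) $ i = unit_vec d j $ i" using b by simp
    then show ?thesis using that by auto
  qed
  \<comment> \<open>The linear inverse of evaluation at 1, built from preimages of the unit vectors;
    \<open>\<rho>\<close> is translation on \<open>V\<close> carried over by it.\<close>
  define Fw where "Fw w = (\<Sum>j<d. sv (w $ j) (b j))" for w
  have FwV: "Fw w \<in> V" for w unfolding Fw_def by (intro vs.subspace_sum[OF subVV] vs.subspace_scale[OF subVV] b)
  have Fw1: "vec d (Fw w 1) = w" if "w \<in> carrier_vec d" for w
  proof (rule eq_vecI)
    fix i assume i: "i < dim_vec w"
    then have id: "i < d" using that by simp
    have "Fw w 1 i = (\<Sum>j<d. w $ j * b j 1 i)" by (simp add: Fw_def sum_fun_apply sv_def)
    also have "\<dots> = (\<Sum>j<d. if j = i then w $ i else 0)" using b1[OF id] by (intro sum.cong) auto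
    finally show "vec d (Fw w 1) $ i = w $ i" using id by simp
  qed (use that in auto)
  have Fw_ev: "Fw (vec d (F 1)) = F" if "F \<in> V" for F
    by (rule inj[OF FwV that]) (simp add: Fw1)
  define \<rho> where "\<rho> a = mat d d (\<lambda>(i, j). b j (gl n a) i)" for a
  have \<rho>v: "\<rho> a *\<^sub>v w = vec d (Fw w (gl n a))" if "w \<in> carrier_vec d" for a w
    using that by (intro eq_vecI)
      (auto simp: \<rho>_def Fw_def sum_fun_apply sv_def scalar_prod_def atLeast0LessThan mult.commute)
  have \<rho>c: "\<rho> a \<in> carrier_mat d d" for a by (simp add: \<rho>_def)
  have act1: "act g F 1 = F g" for g F by (simp add: act_def)
  have Fw\<rho>: "Fw (\<rho> a *\<^sub>v w) = act (gl n a) (Fw w)" if a: "a \<in> GL_mat n" and w: "w \<in> carrier_vec d" for a w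
  proof -
    have "Fw (vec d (act (gl n a) (Fw w) 1)) = act (gl n a) (Fw w)"
      by (rule Fw_ev[OF actV[OF gl_Gn[OF a] FwV]])
    then show ?thesis by (simp add: \<rho>v[OF w] act1)
  qed
  have mat_eqI: "M1 = M2" if "M1 \<in> carrier_mat d d" "M2 \<in> carrier_mat d d"
      "\<And>w. w \<in> carrier_vec d \<Longrightarrow> M1 *\<^sub>v w = M2 *\<^sub>v w" for M1 M2 :: "complex mat"
  proof (rule eq_matI)
    fix i j assume ij: "i < dim_row M2" "j < dim_col M2"
    have "M1 *\<^sub>v unit_vec d j = M2 *\<^sub>v unit_vec d j" using that(3) by simp
    then have "row M1 i \<bullet> unit_vec d j = row M2 i \<bullet> unit_vec d j"
      using that(1,2) ij by (metis carrier_matD(1) index_mult_mat_vec)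
    then show "M1 $$ (i, j) = M2 $$ (i, j)" using that(1,2) ij by simp
  qed (use that in auto)
  have GLc: "a \<in> carrier_mat n n" if "a \<in> GL_mat n" for a :: "'r mat" using that by (simp add: GL_mat_def)
  have rep\<rho>: "is_rep (GL_mat n) n d \<rho>"
    unfolding is_rep_def
  proof (intro conjI ballI)
    fix g h :: "'r mat" assume g: "g \<in> GL_mat n" and h: "h \<in> GL_mat n"
    show "\<rho> g \<in> carrier_mat d d" by (rule \<rho>c)
    show "\<rho> (g * h) = \<rho> g * \<rho> h"
    proof (rule mat_eqI)
      fix w :: "complex vec" assume w: "w \<in> carrier_vec d"
      have "\<rho> g *\<^sub>v (\<rho> h *\<^sub>v w) = vec d (act (gl n h) (Fw w) (gl n g))"
        using \<rho>v[of "\<rho> h *\<^sub>v w" g] \<rho>c[of h] w Fw\<rho>[OF h w] by simp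
      also have "\<dots> = \<rho> (g * h) *\<^sub>v w"
        using gl_mult[OF GLc[OF g] GLc[OF h]] by (simp add: \<rho>v[OF w] act_def)
      finally show "\<rho> (g * h) *\<^sub>v w = \<rho> g * \<rho> h *\<^sub>v w" using w \<rho>c by (simp add: assoc_mult_mat_vec[of _ d d _ d])
    qed (use \<rho>c mult_carrier_mat in blast)+
  next
    show "\<rho> (1\<^sub>m n) = 1\<^sub>m d" by (rule mat_eqI) (auto simp: \<rho>c \<rho>v Fw1)
  qed
  have irr\<rho>: "irreducible_rep (GL_mat n) n d \<rho>"
    unfolding irreducible_rep_def
  proof (intro conjI allI impI rep\<rho> rep(4))
    fix S assume S: "invariant_subspace (GL_mat n) d \<rho> S"
    define W where "W = {F \<in> V. vec d (F 1) \<in> S}"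
    have W: "vs.subspace W"
      unfolding vs.subspace_def
    proof (intro conjI ballI allI)
      have "vec d ((0 :: 'r lmap \<Rightarrow> nat \<Rightarrow> complex) 1) = 0\<^sub>v d" by (intro eq_vecI) auto
      then show "0 \<in> W" using S vs.subspace_0[OF subVV] by (simp add: W_def invariant_subspace_def del: zero_fun_apply)
      fix F assume F: "F \<in> W"
      have "vec d (sv c F 1) = c \<cdot>\<^sub>v vec d (F 1)" for c by (intro eq_vecI) (auto simp: sv_def)
      then show "sv c F \<in> W" for c
        using S F vs.subspace_scale[OF subVV, of F c] by (simp add: W_def invariant_subspace_def)
      fix F' assume F': "F' \<in> W"
      have "vec d ((F + F') 1) = vec d (F 1) + vec d (F' 1)" by (intro eq_vecI) auto
      then show "F + F' \<in> W"
        using S F F' vs.subspace_add[OF subVV, of F F'] by (simp add: W_def invariant_subspace_def del: plus_fun_apply)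
    qed
    have "act g F \<in> W" if g: "g \<in> G" and F: "F \<in> W" for g F
    proof -
      have FV: "F \<in> V" and FS: "vec d (F 1) \<in> S" using F by (auto simp: W_def)
      have "\<rho> (mg n g) *\<^sub>v vec d (F 1) = vec d (F g)"
        using g by (simp add: \<rho>v Fw_ev[OF FV] Gn_minus_one)
      moreover have "\<rho> (mg n g) *\<^sub>v vec d (F 1) \<in> S" using S mg_GL[OF g] FS by (auto simp: invariant_subspace_def)
      ultimately show ?thesis using actV[OF g FV] by (simp add: W_def act1)
    qed
    then have "W = {0} \<or> W = V" using irrV W unfolding irr_def W_def by blast
    then show "S = {0\<^sub>v d} \<or> S = carrier_vec d"
    proof
      assume W0: "W = {0}"
      have "s = 0\<^sub>v d" if s: "s \<in> S" for s
      proof -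
        have sc: "s \<in> carrier_vec d" using s S by (auto simp: invariant_subspace_def)
        then have "Fw s \<in> W" using s FwV Fw1 by (simp add: W_def)
        then have "Fw s = 0" using W0 by blast
        then have "s = vec d ((0 :: 'r lmap \<Rightarrow> nat \<Rightarrow> complex) 1)" using Fw1[OF sc] by metis
        then show ?thesis by (auto intro: eq_vecI)
      qed
      then show ?thesis using S by (auto simp: invariant_subspace_def)
    next
      assume WV: "W = V"
      have "s \<in> S" if s: "s \<in> carrier_vec d" for s
      proof -
        have "Fw s \<in> W" using FwV WV by simp
        then show ?thesis using Fw1[OF s] by (simp add: W_def)
      qed
      then show ?thesis using S by (auto simp: invariant_subspace_def)
    qed
  qed
  have \<rho>\<delta>: "\<rho> g = \<delta> g" if g: "g \<in> SL_mat n" for g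
  proof (rule mat_eqI[OF \<rho>c rep(1)[OF g]])
    fix w :: "complex vec" assume w: "w \<in> carrier_vec d"
    have "Fw w (gl n g * 1) = dl (gl n g) (Fw w 1)"
      by (rule I_eq) (use FwV[of w] VI gl_SLl[OF g] in auto)
    then have "\<rho> g *\<^sub>v w = vec d (dl (gl n g) (Fw w 1))" by (simp add: \<rho>v[OF w])
    also have "\<dots> = \<delta> g *\<^sub>v w"
      using dl_vec[OF gl_SLl[OF g]] g by (simp add: Fw1[OF w] SL_mat_def)
    finally show "\<rho> g *\<^sub>v w = \<delta> g *\<^sub>v w" .
  qed
  have reg\<rho>: "\<exists>x\<in>carrier_mat n n. regular_mat x \<and> contains_phi_x (GL_mat n) n d \<rho> red \<pi> l \<phi> x"
  proof -
    define F0 where "F0 = Fw v0"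
    have F0V: "F0 \<in> V" by (simp add: F0_def FwV)
    have F0nz: "F0 \<noteq> 0"
    proof
      assume "F0 = 0"
      then have "v0 = vec d ((0 :: 'r lmap \<Rightarrow> nat \<Rightarrow> complex) 1)" using Fw1[OF v0(1)] by (metis F0_def)
      then show False using v0(2) by (auto intro: eq_vecI)
    qed
    obtain N where N: "N \<noteq> 0" "\<And>v. (\<Sum>X\<in>A. PP (l - 1) X v) = sv N v" by (rule PP_sum[OF l1]) blast
    have "(\<Sum>X\<in>A. PP (l - 1) X F0) \<noteq> 0" using N F0nz by simp
    then obtain X where X: "X \<in> A" "PP (l - 1) X F0 \<noteq> 0" by (meson sum.neutral)
    define w where "w = PP (l - 1) X F0"
    have wV: "w \<in> V" unfolding w_def by (rule PP_V[OF l1 F0V])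
    \<comment> \<open>\<open>F0\<close> is an eigenvector of the bottom level of the special linear
      group with the character of \<open>x0\<close>, and \<open>PP\<close> commutes with the bottom
      level. So its nonzero component \<open>w\<close> has this character as well as that of
      \<open>X\<close>.\<close>
    have HSL: "Psi (scl (\<pi> ^ (l - 1)) (X * y)) = Psi (scl (\<pi> ^ (l - 1)) (lft x0 * y))"
      if y: "y \<in> A" and HS: "H (l - 1) y \<in> SLl" for y
    proof -
      let ?a = "1\<^sub>m n + (\<pi> ^ (l - 1)) \<cdot>\<^sub>m mg n y"
      have ac: "?a \<in> carrier_mat n n" by auto
      have gla: "gl n ?a = H (l - 1) y" unfolding gl_H[OF mg_carrier] em_mg[OF y] H_def ..
      then have am: "?a = mg n (H (l - 1) y)" using mg_gl[OF ac] by simp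
      then have aSL: "?a \<in> SL_mat n" using SLl_mg[OF HS] by simp
      have HG: "H (l - 1) y \<in> G" using H_G[OF l1 y] .
      have "act (H (l - 1) y) F0 = Fw (\<rho> ?a *\<^sub>v v0)"
        using Fw\<rho>[OF SL_GL[OF aSL] v0(1)] gla by (simp add: F0_def)
      also have "\<dots> = Fw (phi_x red \<pi> l \<phi> x0 (mg n y) \<cdot>\<^sub>v v0)"
        using eig[OF mg_carrier aSL] \<rho>\<delta>[OF aSL] by simp
      also have "\<dots> = sv (phi_x red \<pi> l \<phi> x0 (mg n y)) F0"
        using v0(1) by (simp add: Fw_def F0_def vs.scale_sum_right)
      also have "phi_x red \<pi> l \<phi> x0 (mg n y) = Psi (scl (\<pi> ^ (l - 1)) (lft x0 * y))"
        using phi_x_Psi[OF x0(1) mg_carrier] by (simp add: em_mg[OF y])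
      finally have e: "act (H (l - 1) y) F0 = sv (Psi (scl (\<pi> ^ (l - 1)) (lft x0 * y))) F0" .
      have "\<pi> ^ (l - 1) * \<pi> ^ (l - 1) = 0" using l2 by (simp add: pi_zero flip: power_add)
      then have "scl (\<pi> ^ (l - 1)) (H (l - 1) y * X) = scl (\<pi> ^ (l - 1)) (X * H (l - 1) y)"
        by (simp add: H_def distrib_left distrib_right scl_distribs)
      then have "scl (\<pi> ^ (l - 1)) (H (l - 1) y * X) * ginv (H (l - 1) y) = scl (\<pi> ^ (l - 1)) (X * H (l - 1) y) * ginv (H (l - 1) y)"
        by simp
      then have "scl (\<pi> ^ (l - 1)) (H (l - 1) y * X * ginv (H (l - 1) y)) = scl (\<pi> ^ (l - 1)) X"
        using Gn_inv(1)[OF HG] by (simp add: mult.assoc)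
      then have "act (H (l - 1) y) w = PP (l - 1) X (act (H (l - 1) y) F0)"
        unfolding w_def using PP_conj[OF l1 HG X(1), of F0] PP_cong by metis
      then have "act (H (l - 1) y) w = sv (Psi (scl (\<pi> ^ (l - 1)) (lft x0 * y))) w"
        unfolding e PP_sv[OF l1] w_def .
      moreover have "act (H (l - 1) y) w = sv (Psi (scl (\<pi> ^ (l - 1)) (X * y))) w"
        unfolding w_def by (rule PP_eig[OF l1 y])
      ultimately show ?thesis using X(2) by (metis vs.scale_cancel_right w_def)
    qed
    define Z where "Z = X - lft x0"
    have ZA: "Z \<in> A" using X by (auto simp: Z_def)
    have Z1: "Psi (scl (\<pi> ^ (l - 1)) (Z * y)) = 1" if "y \<in> A" "H (l - 1) y \<in> SLl" for y
      using HSL[OF that] by (simp add: Z_def left_diff_distrib scl_distribs Psi_simps)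
    have detdiag: "H (l - 1) y \<in> SLl" if y: "y \<in> A" and low: "\<And>i j. i < n \<Longrightarrow> j < n \<Longrightarrow> j < i \<Longrightarrow> ent y i j = 0"
        and pr: "(\<Prod>i<n. 1 + \<pi> ^ (l - 1) * ent y i i) = 1" for y
    proof -
      have "det (mg n (H (l - 1) y)) = prod_list (diag_mat (mg n (H (l - 1) y)))"
        by (rule det_upper_triangular[OF _ mg_carrier]) (use low in \<open>auto simp: mg_def H_def ent_one\<close>)
      also have "\<dots> = (\<Prod>i<n. 1 + \<pi> ^ (l - 1) * ent y i i)"
        by (simp add: prod_list_diag_prod mg_def H_def ent_one atLeast0LessThan)
      finally show ?thesis using H_G[OF l1 y] pr by (simp add: SLl_def)
    qed
    have detlow: "H (l - 1) y \<in> SLl" if y: "y \<in> A" and up: "\<And>i j. i < n \<Longrightarrow> j < n \<Longrightarrow> i \<le> j \<Longrightarrow> ent y i j = 0" for y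
    proof -
      have "det (mg n (H (l - 1) y)) = prod_list (diag_mat (mg n (H (l - 1) y)))"
        by (rule det_lower_triangular[OF _ mg_carrier]) (use up in \<open>auto simp: mg_def H_def ent_one\<close>)
      also have "\<dots> = (\<Prod>i<n. 1 + \<pi> ^ (l - 1) * ent y i i)"
        by (simp add: prod_list_diag_prod mg_def H_def ent_one atLeast0LessThan)
      also have "\<dots> = 1" by (rule prod.neutral) (simp add: up)
      finally show ?thesis using H_G[OF l1 y] by (simp add: SLl_def)
    qed
    \<comment> \<open>Off-diagonal elementary matrices give triangular matrices of determinant 1, so
      every off-diagonal entry can be tested.\<close>
    have off: "\<pi> ^ (l - 1) * ent Z i j = 0" if ij: "i < n" "j < n" "i \<noteq> j" for i j
    proof (rule phi_nondeg)
      fix r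
      have "H (l - 1) (eij n j i r) \<in> SLl"
      proof (cases "j < i")
        case True
        then show ?thesis using ij by (intro detdiag) (auto simp: ent_eij intro!: prod.neutral)
      next
        case False
        then show ?thesis using ij by (intro detlow) (auto simp: ent_eij)
      qed
      from Z1[OF eij_Mn this] show "\<phi> (\<pi> ^ (l - 1) * ent Z i j * r) = 1"
        using mtr_eij[OF ij(1,2), of Z r] by (simp add: Psi_def mult_ac)
    qed
    \<comment> \<open>On the diagonal only differences can be tested: opposite entries at i and 0
      give determinant 1 because \<open>\<pi> ^ (l - 1)\<close> squares to 0.\<close>
    have diag: "\<pi> ^ (l - 1) * (ent Z i i - ent Z 0 0) = 0" if i: "i < n" for i
    proof (cases "i = 0")
      case False
      show ?thesis
      proof (rule phi_nondeg)
        fix r :: 'r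
        define y :: "'r lmap" where "y = eij n i i r - eij n 0 0 r"
        have yA: "y \<in> A" by (simp add: y_def)
        have ey: "ent y k k = (if k = i then r else if k = 0 then - r else 0)" if "k < n" for k
          using that i False by (auto simp: y_def ent_eij)
        have "\<pi> ^ (l - 1) * \<pi> ^ (l - 1) = 0" using l2 by (simp add: pi_zero flip: power_add)
        moreover have "(1 + a * r) * (1 + a * - r) = 1 - a * a * (r * r)" for a
          by (simp add: algebra_simps)
        ultimately have p0: "(1 + \<pi> ^ (l - 1) * r) * (1 + \<pi> ^ (l - 1) * - r) = 1" by simp
        have "(\<Prod>k<n. 1 + \<pi> ^ (l - 1) * ent y k k) = (\<Prod>k\<in>{i, 0}. 1 + \<pi> ^ (l - 1) * ent y k k)"
          by (rule prod.mono_neutral_right) (use i n0 ey in auto)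
        also have "\<dots> = 1" using False i n0 p0 by (simp add: ey)
        finally have "H (l - 1) y \<in> SLl"
          by (intro detdiag[OF yA]) (auto simp: y_def ent_eij)
        from Z1[OF yA this] show "\<phi> (\<pi> ^ (l - 1) * (ent Z i i - ent Z 0 0) * r) = 1"
          using mtr_eij[OF i i, of Z r] mtr_eij[OF n0 n0, of Z r]
          by (simp add: Psi_def y_def right_diff_distrib left_diff_distrib mult_ac)
      qed
    qed simp
    \<comment> \<open>Hence \<open>X\<close> reduces to \<open>x0\<close> plus this scalar, and the
      shifted matrix is again regular.\<close>
    define c where "c = red (ent Z 0 0)"
    define x where "x = x0 + c \<cdot>\<^sub>m 1\<^sub>m n"
    have x: "x \<in> carrier_mat n n" "regular_mat x"
      using x0 regular_mat_shift[OF finite_k x0] by (auto simp: x_def)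
    have lx: "scl (\<pi> ^ (l - 1)) (lft x) = scl (\<pi> ^ (l - 1)) X"
    proof (rule Mn_eqI[of _ n])
      fix i j assume ij: "i < n" "j < n"
      have eqv: "\<pi> ^ (l - 1) * a = \<pi> ^ (l - 1) * a'" if ra: "red a = red a'" for a a'
      proof -
        have "\<pi> dvd a - a'" using ra by (simp flip: red_simps(4) add: red_diff)
        then obtain e where "a - a' = \<pi> * e" by (rule dvdE)
        then have "\<pi> ^ (l - 1) * (a - a') = \<pi> ^ Suc (l - 1) * e" by (simp add: mult_ac)
        also have "\<dots> = 0" using l2 pi_l by simp
        finally show ?thesis by (simp add: right_diff_distrib)
      qed
      have "red (ent Z i j) = (if i = j then c else 0)"
      proof (cases "i = j")
        case True
        then show ?thesis using red_eq_ann[of "ent Z i i" "ent Z 0 0"] diag[OF ij(1)]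
          by (simp add: c_def right_diff_distrib)
      next
        case False
        then show ?thesis using red_eq_ann[of "ent Z i j" 0] off[OF ij False] red_simps(4)[of 0] by simp
      qed
      then have "red (ent X i j) = x $$ (i, j)"
        using ij x0(1) red_simps(1)[of "ent Z i j" "ent (lft x0) i j"]
        by (auto simp: Z_def x_def lft_def ent_em red_lift)
      then have "red (ent (lft x) i j) = red (ent X i j)"
        using ij x(1) by (auto simp: lft_def ent_em red_lift)
      from eqv[OF this] show "ent (scl (\<pi> ^ (l - 1)) (lft x)) i j = ent (scl (\<pi> ^ (l - 1)) X) i j"
        by simp
    qed (use X in auto)
    define v where "v = vec d (w 1)"
    have Fwv: "Fw v = w" unfolding v_def by (rule Fw_ev[OF wV])
    have vc: "v \<in> carrier_vec d" by (simp add: v_def)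
    have "v \<noteq> 0\<^sub>v d"
    proof
      assume "v = 0\<^sub>v d"
      then have "Fw v = 0" by (simp add: Fw_def)
      then show False using Fwv X(2) by (simp add: w_def)
    qed
    moreover have "\<rho> (1\<^sub>m n + (\<pi> ^ (l - 1)) \<cdot>\<^sub>m y) *\<^sub>v v = phi_x red \<pi> l \<phi> x y \<cdot>\<^sub>v v"
      if y: "y \<in> carrier_mat n n" for y
    proof -
      have "\<rho> (1\<^sub>m n + (\<pi> ^ (l - 1)) \<cdot>\<^sub>m y) *\<^sub>v v = vec d (act (H (l - 1) (em n y)) w 1)"
        using gl_H[OF y] by (simp add: \<rho>v[OF vc] Fwv act1 H_def)
      also have "\<dots> = vec d (sv (Psi (scl (\<pi> ^ (l - 1)) (X * em n y))) w 1)"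
        unfolding w_def by (subst PP_eig[OF l1 em_Mn]) simp
      also have "scl (\<pi> ^ (l - 1)) (X * em n y) = scl (\<pi> ^ (l - 1)) (lft x * em n y)"
        using lx by (metis scl_simps(1))
      also have "Psi \<dots> = phi_x red \<pi> l \<phi> x y" by (rule phi_x_Psi[OF x(1) y, symmetric])
      also have "vec d (sv (phi_x red \<pi> l \<phi> x y) w 1) = phi_x red \<pi> l \<phi> x y \<cdot>\<^sub>v v"
        by (intro eq_vecI) (auto simp: sv_def v_def)
      finally show ?thesis .
    qed
    ultimately show ?thesis using x vc unfolding contains_phi_x_def by blast
  qed
  show ?thesis
    by (rule that[of \<rho>]) (use irr\<rho> reg\<rho> \<rho>\<delta> in \<open>auto simp: regular_rep_GL_def\<close>)
qed

end

theorem theorem6p6: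
  fixes \<pi> :: "'r::{comm_ring_1,finite}"
    and red :: "'r \<Rightarrow> 'k::field"
    and \<phi> :: "'r \<Rightarrow> complex"
    and p n l d :: nat
    and \<delta> :: "'r mat \<Rightarrow> complex mat"
  assumes "trunc_dvr \<pi> l"
    and "residue_map red \<pi>"
    and "prime p" and "of_nat p = (0::'k)"
    and "odd p"
    and "\<not> p dvd n"
    and "l \<ge> 2"
    and "primitive_char \<pi> l \<phi>"
    and "regular_rep_SL n d \<delta> red \<pi> l \<phi>"
  shows "(\<forall>\<theta>. nondeg_char \<pi> l n \<theta> \<longrightarrow> has_whittaker (SL_mat n) (U_mat n) d \<delta> \<theta>)
         \<longleftrightarrow> special_regular n d \<delta> red \<pi> l \<phi>"
proof -
  have n0: "n > 0" using assms(6) by (cases n) auto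
  interpret red: comm_ring_hom red by (rule residue_map_hom[OF assms(2)])
  \<comment> \<open>Odd residue characteristic makes 2 a unit; its inverse is the parameter
    \<open>hf\<close>.\<close>
  have "\<not> \<pi> dvd 2"
  proof
    assume "\<pi> dvd 2"
    then have "red (1 + 1) = 0" using assms(2) by (simp add: residue_map_def)
    then have two: "(1::'k) + 1 = 0" by (simp only: red.hom_add red.hom_one)
    obtain q where "p = 2 * q + 1" using assms(5) by (auto elim: oddE)
    then have "of_nat p = (1 + 1) * of_nat q + (1::'k)" by simp
    then show False using two assms(4) by simp
  qed
  then have "(2::'r) dvd 1" using assms(1) unfolding trunc_dvr_def by blast
  then obtain hf :: 'r where "1 = 2 * hf" by (rule dvdE)
  then have hf: "hf + hf = 1" using mult_2[of hf] by metis
  interpret rtrunc \<pi> l n \<phi> hf red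
    by unfold_locales (fact assms hf n0)+
  have rep: "is_rep (SL_mat n) n d \<delta>"
    using assms(9) by (simp add: regular_rep_SL_def irreducible_rep_def)
  show ?thesis
  proof
    assume all: "\<forall>\<theta>. nondeg_char \<pi> l n \<theta> \<longrightarrow> has_whittaker (SL_mat n) (U_mat n) d \<delta> \<theta>"
    obtain \<rho> where \<rho>: "regular_rep_GL n d \<rho> red \<pi> l \<phi>" "\<And>g. g \<in> SL_mat n \<Longrightarrow> \<rho> g = \<delta> g"
      using whittaker_special[OF assms(9)] all by metis
    have "1\<^sub>m d * \<delta> g = \<rho> g * 1\<^sub>m d" if "g \<in> SL_mat n" for g
      using rep that \<rho>(2)[OF that] by (auto simp: is_rep_def)
    moreover have "invertible_mat (1\<^sub>m d :: complex mat)"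
      unfolding invertible_mat_def inverts_mat_def by (auto intro!: exI[of _ "1\<^sub>m d"])
    ultimately have "iso_rep (SL_mat n) d \<delta> d \<rho>"
      unfolding iso_rep_def by (intro conjI bexI[of _ "1\<^sub>m d"]) auto
    then show "special_regular n d \<delta> red \<pi> l \<phi>"
      unfolding special_regular_def using \<rho>(1) assms(9) by blast
  next
    assume "special_regular n d \<delta> red \<pi> l \<phi>"
    then obtain \<rho> P where \<rho>: "regular_rep_GL n d \<rho> red \<pi> l \<phi>" and P: "P \<in> carrier_mat d d" "invertible_mat P"
      "\<forall>g\<in>SL_mat n. P * \<delta> g = \<rho> g * P"
      unfolding special_regular_def iso_rep_def by blast
    then show "\<forall>\<theta>. nondeg_char \<pi> l n \<theta> \<longrightarrow> has_whittaker (SL_mat n) (U_mat n) d \<delta> \<theta>"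
      using special_whittaker[OF \<rho> P(1,2) rep] by blast
  qed
qed

end
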